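(* Let $p>1$, $N\ge2$, $\beta<0$ and $\omega>\frac{p+1}{p-1}\frac{N^2}{\beta^2}$. Assume that a solution (minimizer) to the problem $$d_\omega=\inf\{S_\omega(v):\ v\in H^1(\Gamma)\setminus\{0\},\ I_\omega(v)=0\}$$ exists. Then (up to permutation of the edges of $\Gamma$ and multiplication by $e^{i\theta}$, $\theta\in\mathbb{R}$) it is given by $\phi_1$.
   Context: $\Gamma$ is the star graph with $N\ge2$ half-lines $(0,\infty)$ joined at the vertex $0$. A function on $\Gamma$ is $v=(v_j)_{j=1}^N$ with $v_j:(0,\infty)\to\mathbb{C}$. $L^q(\Gamma)=\bigoplus_{j=1}^N L^q(\mathbb{R}^+)$ with norm $\|\cdot\|_q$, $H^1(\Gamma)=\bigoplus_{j=1}^N H^1(\mathbb{R}^+)$ (no continuity condition at the vertex). For $v\in H^1(\Gamma)$, $$F_\beta(v)=\|v'\|_2^2+\frac1\beta\Big|\sum_{j=1}^Nv_j(0)\Big|^2,\quad S_\omega(v)=\tfrac12F_\beta(v)+\tfrac\omega2\|v\|_2^2-\tfrac1{p+1}\|v\|_{p+1}^{p+1},\quad I_\omega(v)=F_\beta(v)+\omega\|v\|_2^2-\|v\|_{p+1}^{p+1}.$$ For $a\in\mathbb{R}$, $\phi_a(x)=\big\{\frac{(p+1)\omega}2\mathrm{sech}^2\big(\frac{(p-1)\sqrt\omega}2(x+a)\big)\big\}^{\frac1{p-1}}$. The profile $\phi_1$ has first component $\phi_{x_1}$ and the remaining $N-1$ components equal to $\phi_{x_N}$, where (for $\beta<0$)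 $x_1=\frac{2}{(p-1)\sqrt\omega}\tanh^{-1}(t_1)>0$, $x_N=\frac{2}{(p-1)\sqrt\omega}\tanh^{-1}(t_N)>0$ and $0<t_1<t_N<1$ is the (unique) solution of $$t_1^{p-1}-t_1^{p+1}=t_N^{p-1}-t_N^{p+1},\qquad t_1^{-1}+(N-1)t_N^{-1}=|\beta|\sqrt\omega .$$ *)

theory Defs
  imports "HOL-Analysis.Analysis"
begin

text \<open>
  The star graph has edges \<open>1, \<dots>, N\<close>, each a copy of the open half-line.  A function on it is a
  family \<open>v :: nat \<Rightarrow> real \<Rightarrow> complex\<close>; only the values \<open>v j x\<close> with \<open>j \<in> {1..N}\<close> and \<open>x > 0\<close>
  are meaningful, and elements of the function spaces are identified when they agree almost
  everywhere there.
\<close>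

abbreviation half_line :: "real measure"
  where "half_line \<equiv> lebesgue_on {0<..}"

definition test_function :: "(real \<Rightarrow> real) \<Rightarrow> bool"
  where "test_function \<psi> \<longleftrightarrow>
    (\<forall>n x. (deriv ^^ n) \<psi> differentiable (at x)) \<and>
    (\<exists>a b. 0 < a \<and> (\<forall>x. \<psi> x \<noteq> 0 \<longrightarrow> x \<in> {a..b}))"

definition has_weak_derivative :: "(real \<Rightarrow> complex) \<Rightarrow> (real \<Rightarrow> complex) \<Rightarrow> bool"
  where "has_weak_derivative f g \<longleftrightarrow>
    (\<forall>a b. 0 < a \<longrightarrow> set_integrable lebesgue {a..b} f \<and> set_integrable lebesgue {a..b} g) \<and>
    (\<forall>\<psi>. test_function \<psi> \<longrightarrow>
      (LINT x|half_line. f x * of_real (deriv \<psi> x)) =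
      - (LINT x|half_line. g x * of_real (\<psi> x)))"

text \<open>Weak derivatives are unique up to null sets; this picks a representative.\<close>

definition weak_derivative :: "(real \<Rightarrow> complex) \<Rightarrow> real \<Rightarrow> complex"
  where "weak_derivative f = (SOME g. has_weak_derivative f g)"

definition Lq_half_line :: "real \<Rightarrow> (real \<Rightarrow> complex) set"
  where "Lq_half_line q =
    {f \<in> borel_measurable half_line. integrable half_line (\<lambda>x. norm (f x) powr q)}"

definition H1_half_line :: "(real \<Rightarrow> complex) set"
  where "H1_half_line =
    {f \<in> Lq_half_line 2. \<exists>g \<in> Lq_half_line 2. has_weak_derivative f g}"

text \<open>The value \<open>f(0)\<close> of an \<open>H\<^sup>1\<close> function is that of its continuous representative on
  \<open>[0,\<infinity>)\<close>.\<close>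

definition trace_at_0 :: "(real \<Rightarrow> complex) \<Rightarrow> complex"
  where "trace_at_0 f = (THE c. \<exists>h. continuous_on {0..} h \<and> (AE x in half_line. f x = h x) \<and> h 0 = c)"

definition H1_graph :: "nat \<Rightarrow> (nat \<Rightarrow> real \<Rightarrow> complex) set"
  where "H1_graph N = {v. \<forall>j\<in>{1..N}. v j \<in> H1_half_line}"

definition graph_eq :: "nat \<Rightarrow> (nat \<Rightarrow> real \<Rightarrow> complex) \<Rightarrow> (nat \<Rightarrow> real \<Rightarrow> complex) \<Rightarrow> bool"
  where "graph_eq N u v \<longleftrightarrow> (\<forall>j\<in>{1..N}. AE x in half_line. u j x = v j x)"

definition graph_norm :: "nat \<Rightarrow> real \<Rightarrow> (nat \<Rightarrow> real \<Rightarrow> complex) \<Rightarrow> real"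
  where "graph_norm N q v = (\<Sum>j=1..N. LINT x|half_line. norm (v j x) powr q) powr (1 / q)"

definition F_beta :: "nat \<Rightarrow> real \<Rightarrow> (nat \<Rightarrow> real \<Rightarrow> complex) \<Rightarrow> real"
  where "F_beta N \<beta> v =
    (graph_norm N 2 (\<lambda>j. weak_derivative (v j)))\<^sup>2
    + (1 / \<beta>) * (norm (\<Sum>j=1..N. trace_at_0 (v j)))\<^sup>2"

definition S_omega :: "nat \<Rightarrow> real \<Rightarrow> real \<Rightarrow> real \<Rightarrow> (nat \<Rightarrow> real \<Rightarrow> complex) \<Rightarrow> real"
  where "S_omega N p \<beta> \<omega> v =
    1 / 2 * F_beta N \<beta> v + \<omega> / 2 * (graph_norm N 2 v)\<^sup>2
    - 1 / (p + 1) * graph_norm N (p + 1) v powr (p + 1)"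

definition I_omega :: "nat \<Rightarrow> real \<Rightarrow> real \<Rightarrow> real \<Rightarrow> (nat \<Rightarrow> real \<Rightarrow> complex) \<Rightarrow> real"
  where "I_omega N p \<beta> \<omega> v =
    F_beta N \<beta> v + \<omega> * (graph_norm N 2 v)\<^sup>2 - graph_norm N (p + 1) v powr (p + 1)"

definition nehari_set :: "nat \<Rightarrow> real \<Rightarrow> real \<Rightarrow> real \<Rightarrow> (nat \<Rightarrow> real \<Rightarrow> complex) set"
  where "nehari_set N p \<beta> \<omega> =
    {v \<in> H1_graph N. \<not> graph_eq N v (\<lambda>j x. 0) \<and> I_omega N p \<beta> \<omega> v = 0}"

definition d_omega :: "nat \<Rightarrow> real \<Rightarrow> real \<Rightarrow> real \<Rightarrow> real"
  where "d_omega N p \<beta> \<omega> = (INF v \<in> nehari_set N p \<beta> \<omega>. S_omega N p \<beta> \<omega> v)"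

definition is_minimizer :: "nat \<Rightarrow> real \<Rightarrow> real \<Rightarrow> real \<Rightarrow> (nat \<Rightarrow> real \<Rightarrow> complex) \<Rightarrow> bool"
  where "is_minimizer N p \<beta> \<omega> u \<longleftrightarrow>
    u \<in> nehari_set N p \<beta> \<omega> \<and> S_omega N p \<beta> \<omega> u = d_omega N p \<beta> \<omega>"

definition sech :: "real \<Rightarrow> real"
  where "sech x = 1 / cosh x"

definition phi :: "real \<Rightarrow> real \<Rightarrow> real \<Rightarrow> real \<Rightarrow> real"
  where "phi p \<omega> a x =
    ((p + 1) * \<omega> / 2 * (sech ((p - 1) * sqrt \<omega> / 2 * (x + a)))\<^sup>2) powr (1 / (p - 1))"

definition t_pair :: "nat \<Rightarrow> real \<Rightarrow> real \<Rightarrow> real \<Rightarrow> real \<times> real"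
  where "t_pair N p \<beta> \<omega> = (THE (t1, tN).
    0 < t1 \<and> t1 < tN \<and> tN < 1 \<and>
    t1 powr (p - 1) - t1 powr (p + 1) = tN powr (p - 1) - tN powr (p + 1) \<and>
    1 / t1 + (real N - 1) / tN = \<bar>\<beta>\<bar> * sqrt \<omega>)"

definition x_1 :: "nat \<Rightarrow> real \<Rightarrow> real \<Rightarrow> real \<Rightarrow> real"
  where "x_1 N p \<beta> \<omega> = 2 / ((p - 1) * sqrt \<omega>) * artanh (fst (t_pair N p \<beta> \<omega>))"

definition x_N :: "nat \<Rightarrow> real \<Rightarrow> real \<Rightarrow> real \<Rightarrow> real"
  where "x_N N p \<beta> \<omega> = 2 / ((p - 1) * sqrt \<omega>) * artanh (snd (t_pair N p \<beta> \<omega>))"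

definition phi_1 :: "nat \<Rightarrow> real \<Rightarrow> real \<Rightarrow> real \<Rightarrow> nat \<Rightarrow> real \<Rightarrow> complex"
  where "phi_1 N p \<beta> \<omega> j x =
    of_real (phi p \<omega> (if j = 1 then x_1 N p \<beta> \<omega> else x_N N p \<beta> \<omega>) x)"

end

theory Submission
  imports Defs
begin

text \<open>
  Why the minimizer is the profile \<open>\<phi>\<^sub>1\<close>.  On the Nehari set the action is a positive multiple of the total of the powers
  \<open>|v|\<^sup>p\<^sup>+\<^sup>1\<close>.  Rescaling \<open>v\<close> removes the constraint: a minimizer makes a quotient of homogeneous functionals as
  small as possible (\<open>minimizer_inequality\<close>).  Perturbing it gives the Euler-Lagrange
  equation (\<open>minimizer_euler_lagrange\<close>), in which the nonlinear term is treated by convexity alone.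

  On each edge this is the equation \<open>u'' = \<omega> u - |u|\<^sup>p\<^sup>-\<^sup>1 u\<close>.  Its two conserved quantities, the energy and
  \<open>Im (cnj u u')\<close>, are integrable constants on a half-line and therefore zero.  So \<open>u\<close> either vanishes or
  has constant phase, and \<open>s = |u|\<^sup>-\<^sup>(\<^sup>p\<^sup>-\<^sup>1\<^sup>)\<^sup>/\<^sup>2\<close> solves a linear equation; its solutions are the shifted
  solitons (locale \<open>stationary\<close>, \<open>minimizer_profiles\<close>).  To get there from weak derivatives one needs that a
  function with a weak derivative is a primitive of it (\<open>weak_derivative_primitive\<close>), which rests on
  smooth bumps and Lebesgue points.

  At the vertex, rotating the phase of a single edge and testing with the solution or with a soliton show that
  no edge vanishes, that all phases agree, and that all derivatives at 0 equal \<open>1/\<beta>\<close> times the sum of the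
  boundary values (\<open>minimizer_vertex\<close>).  For \<open>t\<^sub>j = tanh ((p - 1) \<surd>\<omega> a\<^sub>j / 2)\<close>, where \<open>a\<^sub>j\<close> is the shift on edge \<open>j\<close>, this means
  that the numbers \<open>t\<^sub>j\<close> lie in \<open>(0, 1)\<close>, that \<open>t\<^sub>j\<^sup>p\<^sup>-\<^sup>1 - t\<^sub>j\<^sup>p\<^sup>+\<^sup>1\<close> does not depend on \<open>j\<close>, and that the sum of the \<open>1 / t\<^sub>j\<close> is
  \<open>|\<beta>| \<surd>\<omega>\<close>.  The function \<open>t\<^sup>p\<^sup>-\<^sup>1 - t\<^sup>p\<^sup>+\<^sup>1\<close> increases up to \<open>t\<^sub>* = \<surd>((p - 1) / (p + 1))\<close> and decreases afterwards, so the \<open>t\<^sub>j\<close> take at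
  most two values, one on each side of \<open>t\<^sub>*\<close>.

  It remains to count the values below \<open>t\<^sub>*\<close>.  If two edges had one, they would carry the same profile, and shifting
  one of them to the left and the other to the right would lower the action (\<open>minimizer_equal_edges\<close>).  If no edge
  had one, the sum of the \<open>1 / t\<^sub>j\<close> would be at most \<open>N / t\<^sub>*\<close>, which the assumption on \<open>\<omega>\<close>
  excludes.  Hence exactly one edge has a value below \<open>t\<^sub>*\<close>, the others share one above it, and the two values solve the
  system that defines \<open>\<phi>\<^sub>1\<close>.  That system has only one solution under the same assumption on \<open>\<omega>\<close>
  (\<open>t_pair_eqI\<close>).
\<close>

section \<open>Smooth bumps\<close>

text \<open>The function \<open>exp (- 1 / x)\<close>, extended by zero, and its quotients by powers of \<open>x\<close>.  The
  quotients are there because derivatives produce them.\<close>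

definition flat :: "nat \<Rightarrow> real \<Rightarrow> real"
  where "flat n x = (if 0 < x then exp (- 1 / x) / x ^ n else 0)"

lemma tendsto_flat_at_right_0: "((\<lambda>x. exp (- 1 / x) / x ^ n) \<longlongrightarrow> 0) (at_right (0::real))"
proof -
  have "((\<lambda>x::real. x ^ n / exp x) \<longlongrightarrow> 0) at_top"
    by (rule tendsto_power_div_exp_0)
  then have "((\<lambda>x. inverse x ^ n / exp (inverse x)) \<longlongrightarrow> 0) (at_right (0::real))"
    by (rule filterlim_compose) (rule filterlim_inverse_at_top_right)
  then show ?thesis
    by (simp add: exp_minus divide_inverse power_inverse mult.commute)
qed

lemma flat_has_derivative:
  "(flat n has_real_derivative flat (n + 2) x - real n * flat (n + 1) x) (at x)"
proof (cases x "0::real" rule: linorder_cases)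
  case greater
  have "((\<lambda>x. exp (- 1 / x) / x ^ n) has_real_derivative
      flat (n + 2) x - real n * flat (n + 1) x) (at x)"
  proof -
    have e: "((\<lambda>x. exp (- 1 / x)) has_real_derivative exp (- 1 / x) / x ^ 2) (at x)"
      using greater by (auto intro!: derivative_eq_intros simp: field_simps power2_eq_square)
    have p: "((\<lambda>x. x ^ n) has_real_derivative real n * (x ^ n / x)) (at x)"
      using DERIV_pow[of n x] greater by (cases n) (auto simp: field_simps)
    have "x ^ n \<noteq> 0" using greater by simp
    from DERIV_divide[OF e p this] show ?thesis
      by (rule DERIV_cong) (use greater in \<open>simp add: flat_def field_simps power2_eq_square\<close>)
  qed
  then show ?thesis
    by (rule has_field_derivative_transform_within_open[where S="{0<..}"])
      (use greater in \<open>auto simp: flat_def\<close>)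
next
  case less
  have "((\<lambda>x. 0) has_real_derivative flat (n + 2) x - real n * flat (n + 1) x) (at x)"
    using less by (simp add: flat_def)
  then show ?thesis
    by (rule has_field_derivative_transform_within_open[where S="{..<0}"])
      (use less in \<open>auto simp: flat_def\<close>)
next
  case equal
  have "((\<lambda>h. flat n h / h) \<longlongrightarrow> 0) (at_left 0)"
    by (rule tendsto_eventually) (auto simp: flat_def eventually_at_filter)
  moreover have "((\<lambda>h. flat n h / h) \<longlongrightarrow> 0) (at_right 0)"
    by (rule Lim_transform_eventually[OF tendsto_flat_at_right_0[of "Suc n"]])
      (auto simp: flat_def eventually_at_filter)
  ultimately have "((\<lambda>h. flat n h / h) \<longlongrightarrow> 0) (at 0)"
    by (simp add: filterlim_at_split)
  then show ?thesis
    using equal by (simp add: has_field_derivative_iff flat_def)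
qed

text \<open>An algebra of functions that is closed under differentiation.  Membership gives derivatives of
  every order at once, so no formula for a higher derivative is ever needed.\<close>

inductive bump_algebra :: "(real \<Rightarrow> real) \<Rightarrow> bool" where
  gen: "bump_algebra (\<lambda>x. flat n (m * x + c))"
| const: "bump_algebra (\<lambda>x. c)"
| add: "bump_algebra f \<Longrightarrow> bump_algebra g \<Longrightarrow> bump_algebra (\<lambda>x. f x + g x)"
| mult: "bump_algebra f \<Longrightarrow> bump_algebra g \<Longrightarrow> bump_algebra (\<lambda>x. f x * g x)"

lemma bump_algebra_derivative:
  assumes "bump_algebra f"
  shows "\<exists>f'. bump_algebra f' \<and> (\<forall>x. (f has_real_derivative f' x) (at x))"
  using assms
proof induction
  case (gen n m c)
  have "((\<lambda>x. flat n (m * x + c)) has_real_derivative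
      m * flat (n + 2) (m * x + c) + (- m * real n) * flat (n + 1) (m * x + c)) (at x)" for x
  proof -
    have "((\<lambda>x. m * x + c) has_real_derivative m) (at x)"
      by (auto intro!: derivative_eq_intros)
    from DERIV_chain2[OF flat_has_derivative this, of n] show ?thesis
      by (simp add: algebra_simps)
  qed
  moreover have "bump_algebra (\<lambda>x. m * flat (n + 2) (m * x + c) + (- m * real n) * flat (n + 1) (m * x + c))"
    by (intro bump_algebra.intros)
  ultimately show ?case by blast
next
  case (const c)
  show ?case by (rule exI[of _ "\<lambda>x. 0"]) (auto intro: bump_algebra.const)
next
  case (add f g)
  then obtain f' g' where *: "bump_algebra f'" "bump_algebra g'"
      "\<And>x. (f has_real_derivative f' x) (at x)" "\<And>x. (g has_real_derivative g' x) (at x)"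
    by blast
  show ?case
    by (rule exI[of _ "\<lambda>x. f' x + g' x"])
      (auto intro!: bump_algebra.intros * derivative_eq_intros)
next
  case (mult f g)
  then obtain f' g' where *: "bump_algebra f'" "bump_algebra g'"
      "\<And>x. (f has_real_derivative f' x) (at x)" "\<And>x. (g has_real_derivative g' x) (at x)"
    by blast
  show ?case
    by (rule exI[of _ "\<lambda>x. f' x * g x + f x * g' x"])
      (auto intro!: bump_algebra.intros * mult derivative_eq_intros)
qed

lemma bump_algebra_deriv:
  assumes "bump_algebra f"
  shows "bump_algebra (deriv f)" "f differentiable (at x)"
proof -
  obtain f' where f': "bump_algebra f'" "\<And>x. (f has_real_derivative f' x) (at x)"
    using bump_algebra_derivative[OF assms] by blast
  have "deriv f = f'" using f'(2) DERIV_imp_deriv by blast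
  with f' show "bump_algebra (deriv f)" by simp
  show "f differentiable (at x)" using f'(2) real_differentiable_def by blast
qed

lemma bump_algebra_continuous: "bump_algebra f \<Longrightarrow> continuous_on S f"
  using bump_algebra_deriv(2) differentiable_imp_continuous_within
  by (metis continuous_at_imp_continuous_on)

text \<open>A test function is recognised from its derivative: the primitive itself need not lie in the
  algebra, which matters because some of the test functions below are primitives of differences of
  bumps.\<close>

lemma test_function_primitive:
  assumes "bump_algebra \<rho>" and der: "\<And>t. (\<psi> has_real_derivative \<rho> t) (at t)"
    and "0 < a" "\<And>t. \<psi> t \<noteq> 0 \<Longrightarrow> t \<in> {a..b}"
  shows "test_function \<psi>"
proof -
  have alg: "bump_algebra ((deriv ^^ n) \<rho>)" for n
    by (induction n) (auto intro: bump_algebra_deriv assms)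
  have d: "deriv \<psi> = \<rho>" using der DERIV_imp_deriv by blast
  have "(deriv ^^ n) \<psi> differentiable (at x)" for n x
  proof (cases n)
    case 0
    then show ?thesis using der[of x] by (auto simp: real_differentiable_def)
  next
    case (Suc m)
    have "(deriv ^^ n) \<psi> = (deriv ^^ m) \<rho>"
      unfolding Suc funpow_Suc_right by (simp add: d)
    then show ?thesis using bump_algebra_deriv(2)[OF alg] by simp
  qed
  with assms(3,4) show ?thesis unfolding test_function_def by blast
qed

lemma test_function_DERIV:
  assumes "test_function \<psi>"
  shows "(\<psi> has_real_derivative deriv \<psi> t) (at t)" "isCont (deriv \<psi>) t" "isCont \<psi> t"
proof -
  have "(deriv ^^ 0) \<psi> differentiable (at t)" "(deriv ^^ 1) \<psi> differentiable (at t)"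
    using assms unfolding test_function_def by blast+
  then have *: "\<psi> differentiable (at t)" "deriv \<psi> differentiable (at t)" by auto
  show "(\<psi> has_real_derivative deriv \<psi> t) (at t)"
    using *(1) DERIV_deriv_iff_real_differentiable by blast
  show "isCont (deriv \<psi>) t" "isCont \<psi> t"
    using * differentiable_imp_continuous_within by blast+
qed

text \<open>As \<open>n\<close> grows, these bumps increase to the indicator function of the open interval, and they
  stay between 0 and 1.  Dominated convergence then turns identities for test functions into identities
  for intervals.\<close>

definition bump :: "nat \<Rightarrow> real \<Rightarrow> real \<Rightarrow> real \<Rightarrow> real"
  where "bump n x y t = flat 0 (real n * t + - (real n * x)) * flat 0 (- real n * t + real n * y)"

lemma bump_algebra_bump: "bump_algebra (bump n x y)"
  unfolding bump_def by (intro bump_algebra.intros)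

lemma flat_0_bounds: "0 \<le> flat 0 t" "flat 0 t \<le> 1"
  by (auto simp: flat_def)

lemma bump_bounds: "0 \<le> bump n x y t" "bump n x y t \<le> 1"
  unfolding bump_def using flat_0_bounds by (auto intro: mult_le_one)

lemma bump_outside: "t \<notin> {x<..<y} \<Longrightarrow> bump n x y t = 0"
proof -
  assume "t \<notin> {x<..<y}"
  then consider "t \<le> x" | "y \<le> t" by force
  then show ?thesis
  proof cases
    case 1
    then have "\<not> 0 < real n * t + - (real n * x)"
      using mult_left_mono[of t x "real n"] by simp
    then show ?thesis by (simp add: bump_def flat_def)
  next
    case 2
    then have "\<not> 0 < - real n * t + real n * y"
      using mult_left_mono[of y t "real n"] by simp
    then show ?thesis by (simp add: bump_def flat_def)
  qed
qed

lemma flat_0_rescaled_tendsto: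
  assumes "0 < c" shows "(\<lambda>n. flat 0 (real n * c)) \<longlonglongrightarrow> 1"
proof -
  have "(\<lambda>n. exp (- ((1/c) * (1 / real n)))) \<longlonglongrightarrow> exp (- ((1/c) * 0))"
    by (intro tendsto_intros lim_1_over_n)
  moreover have "\<forall>\<^sub>F n in sequentially. exp (- ((1/c) * (1 / real n))) = flat 0 (real n * c)"
    using eventually_gt_at_top[of 0] by eventually_elim (use assms in \<open>auto simp: flat_def field_simps\<close>)
  ultimately show ?thesis by (auto intro: Lim_transform_eventually)
qed

lemma bump_tendsto: "(\<lambda>n. bump n x y t) \<longlonglongrightarrow> indicator {x<..<y} t"
proof (cases "t \<in> {x<..<y}")
  case True
  have "(\<lambda>n. flat 0 (real n * (t - x)) * flat 0 (real n * (y - t))) \<longlonglongrightarrow> 1 * 1"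
    by (intro tendsto_mult flat_0_rescaled_tendsto) (use True in auto)
  then show ?thesis using True by (simp add: bump_def algebra_simps)
qed (simp add: bump_outside)

lemma test_function_bump:
  assumes "0 < x" shows "test_function (bump n x y)"
proof -
  obtain f' where f': "bump_algebra f'" "\<And>t. (bump n x y has_real_derivative f' t) (at t)"
    using bump_algebra_derivative[OF bump_algebra_bump] by blast
  show ?thesis
  proof (rule test_function_primitive[OF f' assms])
    show "bump n x y t \<noteq> 0 \<Longrightarrow> t \<in> {x..y}" for t
      using bump_outside[of t x y n] by force
  qed
qed

section \<open>Weak derivatives on the half-line\<close>

lemma borel_measurable_half_line:
  "\<phi> \<in> borel_measurable borel \<Longrightarrow> \<phi> \<in> borel_measurable half_line"
  by (intro measurable_restrict_space1 measurable_completion) simp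

lemma integrable_half_line_cutoff:
  assumes "set_integrable lebesgue {a..b} f"
  shows "integrable half_line (\<lambda>t. indicator {a..b} t *\<^sub>R f t :: complex)"
  using assms integrable_mult_indicator[of "{0<..}" lebesgue "\<lambda>t. indicator {a..b} t *\<^sub>R f t"]
  unfolding set_integrable_def by (subst integrable_restrict_space) auto

lemma integrable_half_line_weighted:
  fixes f :: "real \<Rightarrow> complex" and \<phi> :: "real \<Rightarrow> real"
  assumes f: "set_integrable lebesgue {a..b} f"
    and meas: "\<phi> \<in> borel_measurable half_line"
    and bound: "\<And>t. \<bar>\<phi> t\<bar> \<le> C" and supp: "\<And>t. t \<notin> {a..b} \<Longrightarrow> \<phi> t = 0"
  shows "integrable half_line (\<lambda>t. f t * of_real (\<phi> t))"
proof -
  let ?F = "\<lambda>t. indicator {a..b} t *\<^sub>R f t :: complex"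
  have F: "integrable half_line ?F" by (rule integrable_half_line_cutoff[OF f])
  have eq: "(\<lambda>t. f t * of_real (\<phi> t)) = (\<lambda>t. ?F t * of_real (\<phi> t))"
    using supp by (auto simp: indicator_def fun_eq_iff)
  have "integrable half_line (\<lambda>t. ?F t * of_real (\<phi> t))"
  proof (rule Bochner_Integration.integrable_bound)
    show "integrable half_line (\<lambda>t. C * norm (?F t))"
      by (intro integrable_mult_right integrable_norm F)
    show "(\<lambda>t. ?F t * of_real (\<phi> t)) \<in> borel_measurable half_line"
      using F meas by (intro borel_measurable_times borel_measurable_of_real) auto
    have "norm (?F t * of_real (\<phi> t)) \<le> norm (C * norm (?F t))" for t
      using mult_left_mono[OF bound[of t], of "norm (?F t)"] bound[of t]
      by (auto simp: norm_mult abs_mult mult_ac)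
    then show "AE t in half_line. norm (?F t * of_real (\<phi> t)) \<le> norm (C * norm (?F t))" by simp
  qed
  with eq show ?thesis by simp
qed

lemma weighted_integral_tendsto:
  fixes f :: "real \<Rightarrow> complex" and \<phi> :: "nat \<Rightarrow> real \<Rightarrow> real"
  assumes f: "set_integrable lebesgue {a..b} f"
    and meas: "\<And>n. \<phi> n \<in> borel_measurable half_line"
    and bound: "\<And>n t. \<bar>\<phi> n t\<bar> \<le> C" and supp: "\<And>n t. t \<notin> {a..b} \<Longrightarrow> \<phi> n t = 0"
    and lim: "\<And>t. 0 < t \<Longrightarrow> (\<lambda>n. \<phi> n t) \<longlonglongrightarrow> \<phi>' t"
  shows "(\<lambda>n. LINT t|half_line. f t * of_real (\<phi> n t)) \<longlonglongrightarrow> (LINT t|half_line. f t * of_real (\<phi>' t))"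
proof -
  let ?F = "\<lambda>t. indicator {a..b} t *\<^sub>R f t :: complex"
  have F: "integrable half_line ?F" by (rule integrable_half_line_cutoff[OF f])
  have "0 < t \<Longrightarrow> t \<notin> {a..b} \<Longrightarrow> \<phi>' t = 0" for t
    using lim[of t] supp[of t] by (simp add: LIMSEQ_const_iff)
  then have eq: "(LINT t|half_line. f t * of_real (\<phi>' t)) = (LINT t|half_line. ?F t * of_real (\<phi>' t))"
    by (intro Bochner_Integration.integral_cong) (auto simp: indicator_def)
  have eq2: "(\<lambda>t. f t * of_real (\<phi> n t)) = (\<lambda>t. ?F t * of_real (\<phi> n t))" for n
    using supp[of _ n] by (auto simp: indicator_def fun_eq_iff)
  have [measurable]: "\<phi>' \<in> borel_measurable half_line"
    by (rule borel_measurable_LIMSEQ_real[OF _ meas]) (use lim in auto)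
  note meas[measurable]
  have [measurable]: "?F \<in> borel_measurable half_line" using F by auto
  have "(\<lambda>n. LINT t|half_line. ?F t * of_real (\<phi> n t)) \<longlonglongrightarrow> (LINT t|half_line. ?F t * of_real (\<phi>' t))"
  proof (rule integral_dominated_convergence[where w="\<lambda>t. C * norm (?F t)"])
    show "integrable half_line (\<lambda>t. C * norm (?F t))"
      by (intro integrable_mult_right integrable_norm F)
    have "norm (?F t * of_real (\<phi> n t)) \<le> C * norm (?F t)" for n t
      using mult_left_mono[OF bound[of n t], of "norm (?F t)"] by (auto simp: norm_mult mult_ac)
    then show "AE t in half_line. norm (?F t * of_real (\<phi> n t)) \<le> C * norm (?F t)" for n by simp
    show "AE t in half_line. (\<lambda>n. ?F t * of_real (\<phi> n t)) \<longlonglongrightarrow> ?F t * of_real (\<phi>' t)"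
      using lim by (intro AE_I2) (auto intro!: tendsto_intros)
  qed measurable
  with eq eq2 show ?thesis by simp
qed

lemma half_line_integral_indicator:
  fixes f :: "real \<Rightarrow> complex"
  assumes "set_integrable lebesgue {a..b} f" "0 < a"
    and "{a<..<b} \<subseteq> S" "S \<subseteq> {a..b}" "S \<in> sets lebesgue"
  shows "(LINT t|half_line. f t * of_real (indicator S t)) = integral {a..b} f"
proof -
  have "(LINT t|half_line. f t * of_real (indicator S t)) = (LINT t:S|lebesgue. f t)"
    using assms unfolding set_lebesgue_integral_def
    by (subst integral_restrict_space) (auto intro!: Bochner_Integration.integral_cong simp: indicator_def)
  also have "\<dots> = integral S f"
    by (rule set_lebesgue_integral_eq_integral(2)[OF set_integrable_subset]) (use assms in auto)
  also have "\<dots> = integral {a..b} f"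
  proof (rule integral_spike_set)
    have n: "negligible {a, b}" by simp
    show "negligible {x \<in> S - {a..b}. f x \<noteq> 0}" using assms by (intro negligible_subset[OF n]) auto
    have "{x \<in> {a..b} - S. f x \<noteq> 0} \<subseteq> {a, b}" using assms(3) by (force simp: less_le subset_iff)
    then show "negligible {x \<in> {a..b} - S. f x \<noteq> 0}" using negligible_subset[OF n] by blast
  qed
  finally show ?thesis .
qed

definition locally_integrable :: "(real \<Rightarrow> complex) \<Rightarrow> bool"
  where "locally_integrable f \<longleftrightarrow> (\<forall>a b. 0 < a \<longrightarrow> set_integrable lebesgue {a..b} f)"

lemma locally_integrableD:
  "locally_integrable f \<Longrightarrow> 0 < a \<Longrightarrow> set_integrable lebesgue {a..b} f"
  "locally_integrable f \<Longrightarrow> 0 < a \<Longrightarrow> f integrable_on {a..b}"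
  unfolding locally_integrable_def using set_lebesgue_integral_eq_integral(1) by blast+

lemma AE_half_lineI:
  assumes "negligible N" "\<And>x. 0 < x \<Longrightarrow> x \<notin> N \<Longrightarrow> P x"
  shows "AE x in half_line. P x"
proof -
  have "AE x in lebesgue. x \<notin> N"
    using assms(1) negligible_iff_null_sets AE_not_in by blast
  then have "AE x in lebesgue. x \<in> {0<..} \<longrightarrow> P x"
    by eventually_elim (use assms(2) in auto)
  then show ?thesis by (subst AE_restrict_space_iff) auto
qed

lemma AE_half_lineE:
  assumes "AE x in half_line. P x"
  obtains N where "negligible N" "\<And>x. 0 < x \<Longrightarrow> x \<notin> N \<Longrightarrow> P x"
proof -
  have "AE x in lebesgue. x \<in> {0<..} \<longrightarrow> P x"
    using assms by (subst (asm) AE_restrict_space_iff) auto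
  then obtain N where "N \<in> null_sets lebesgue" "{x \<in> space lebesgue. \<not> (x \<in> {0<..} \<longrightarrow> P x)} \<subseteq> N"
    unfolding eventually_ae_filter by blast
  then show ?thesis by (intro that[of N]) (auto simp: negligible_iff_null_sets)
qed

text \<open>Almost every point is a Lebesgue point.  The differentiation theorem for functions on the whole line
  is applied to the truncations to \<open>[1/(k+1), \<infinity>)\<close>, because nothing is known up to the endpoint 0; the
  countably many exceptional sets are then collected.\<close>

lemma AE_lebesgue_point:
  assumes f: "locally_integrable f"
  shows "AE x in half_line. (\<lambda>n. real (Suc n) *\<^sub>R integral {x..x + 1 / real (Suc n)} f) \<longlonglongrightarrow> f x"
proof -
  define F where "F k = (\<lambda>t. if t \<in> {1 / real (Suc k)..} then f t else 0)" for k
  have "F k integrable_on cbox a b" for k a b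
  proof -
    have "f integrable_on {max a (1 / real (Suc k))..b}"
      by (rule locally_integrableD(2)[OF f]) (auto simp: less_max_iff_disj)
    moreover have "{1 / real (Suc k)..} \<inter> {a..b} = {max a (1 / real (Suc k))..b}" by auto
    ultimately show ?thesis
      unfolding F_def by (subst integrable_restrict_Int) (simp add: Int_commute)
  qed
  then have "\<forall>k. \<exists>N. negligible N \<and> (\<forall>x e. x \<notin> N \<longrightarrow> 0 < e \<longrightarrow>
      (\<exists>d>0. \<forall>h. 0 < h \<and> h < d \<longrightarrow> norm (integral {x..x + h} (F k) /\<^sub>R h - F k x) < e))"
  proof (intro allI)
    fix k
    assume "\<And>k a b. F k integrable_on cbox a b"
    then show "\<exists>N. negligible N \<and> (\<forall>x e. x \<notin> N \<longrightarrow> 0 < e \<longrightarrow>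
      (\<exists>d>0. \<forall>h. 0 < h \<and> h < d \<longrightarrow> norm (integral {x..x + h} (F k) /\<^sub>R h - F k x) < e))"
      using integrable_ccontinuous_explicit[of "F k"] by simp metis
  qed
  then obtain N where neg: "\<And>k. negligible (N k)" and
    N: "\<And>k x e. x \<notin> N k \<Longrightarrow> 0 < e \<Longrightarrow>
      \<exists>d>0. \<forall>h. 0 < h \<and> h < d \<longrightarrow> norm (integral {x..x + h} (F k) /\<^sub>R h - F k x) < e"
    by metis
  show ?thesis
  proof (rule AE_half_lineI)
    show "negligible (\<Union>k. N k)" using neg by (intro negligible_countable_Union) auto
    fix x :: real assume x: "0 < x" "x \<notin> (\<Union>k. N k)"
    obtain k where k: "1 / real (Suc k) < x"
      using x(1) nat_approx_posE by blast
    have eq: "integral {x..x + h} (F k) = integral {x..x + h} f" for h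
      by (rule Henstock_Kurzweil_Integration.integral_cong) (use k in \<open>auto simp: F_def\<close>)
    show "(\<lambda>n. real (Suc n) *\<^sub>R integral {x..x + 1 / real (Suc n)} f) \<longlonglongrightarrow> f x"
    proof (rule LIMSEQ_I)
      fix e :: real assume "0 < e"
      from N[OF _ this, of x k] x(2) obtain d where d: "0 < d"
        "\<And>h. 0 < h \<and> h < d \<Longrightarrow> norm (integral {x..x + h} (F k) /\<^sub>R h - F k x) < e" by auto
      obtain m where m: "1 / real (Suc m) < d" using d(1) nat_approx_posE by blast
      have "norm (real (Suc n) *\<^sub>R integral {x..x + 1 / real (Suc n)} f - f x) < e" if "m \<le> n" for n
      proof -
        have "1 / real (Suc n) \<le> 1 / real (Suc m)" using that by (simp add: field_simps)
        with d(2)[of "1 / real (Suc n)"] m k show ?thesis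
          unfolding eq by (simp add: F_def)
      qed
      then show "\<exists>no. \<forall>n\<ge>no. norm (real (Suc n) *\<^sub>R integral {x..x + 1 / real (Suc n)} f - f x) < e"
        by blast
    qed
  qed
qed

lemma has_weak_derivative_locally_integrable:
  assumes "has_weak_derivative f g" shows "locally_integrable f" "locally_integrable g"
  using assms unfolding has_weak_derivative_def locally_integrable_def by blast+

lemma integrable_half_line_compact_support:
  assumes f: "locally_integrable f" and cont: "continuous_on UNIV \<phi>"
    and "0 < a" "\<And>x. x \<notin> {a..b} \<Longrightarrow> \<phi> x = 0"
  shows "integrable half_line (\<lambda>x. f x * of_real (\<phi> x))"
proof -
  have "bounded (\<phi> ` {a..b})"
    by (intro compact_imp_bounded compact_continuous_image continuous_on_subset[OF cont]) auto
  then obtain C where "\<forall>y\<in>\<phi> ` {a..b}. norm y \<le> C" unfolding bounded_iff by blast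
  then have C: "\<bar>\<phi> x\<bar> \<le> \<bar>C\<bar>" for x using assms(4)[of x] by (cases "\<phi> x = 0") force+
  show ?thesis
    by (rule integrable_half_line_weighted[OF locally_integrableD(1)[OF f \<open>0 < a\<close>] _ C])
      (use assms(4) in \<open>auto intro!: borel_measurable_half_line borel_measurable_continuous_onI cont\<close>)
qed

lemma test_function_support:
  assumes "test_function \<psi>"
  obtains a b where "0 < a" "a < b" "\<And>x. x \<notin> {a<..<b} \<Longrightarrow> \<psi> x = 0" "\<And>x. x \<notin> {a<..<b} \<Longrightarrow> deriv \<psi> x = 0"
proof -
  obtain a b where ab: "0 < a" "\<And>x. \<psi> x \<noteq> 0 \<Longrightarrow> x \<in> {a..b}"
    using assms unfolding test_function_def by blast
  have z: "\<psi> x = 0" if "x \<notin> {a..b}" for x using ab(2) that by blast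
  have d: "deriv \<psi> x = 0" if "x \<notin> {a..b}" for x
  proof -
    have "((\<lambda>x. 0) has_real_derivative 0) (at x)" by simp
    then have "(\<psi> has_real_derivative 0) (at x)"
      by (rule has_field_derivative_transform_within_open[where S="- {a..b}"]) (use z that in auto)
    then show ?thesis by (rule DERIV_imp_deriv)
  qed
  show ?thesis
    by (rule that[of "a/2" "max a b + 1"]) (use ab(1) in \<open>auto intro!: z d\<close>)
qed

lemma integrable_test_function:
  assumes "locally_integrable f" "test_function \<psi>"
  shows "integrable half_line (\<lambda>x. f x * of_real (\<psi> x))"
    and "integrable half_line (\<lambda>x. f x * of_real (deriv \<psi> x))"
proof -
  obtain a b where ab: "0 < a" "a < b" "\<And>x. x \<notin> {a<..<b} \<Longrightarrow> \<psi> x = 0"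
      "\<And>x. x \<notin> {a<..<b} \<Longrightarrow> deriv \<psi> x = 0"
    using test_function_support[OF assms(2)] by metis
  note c = continuous_at_imp_continuous_on[of UNIV]
  show "integrable half_line (\<lambda>x. f x * of_real (\<psi> x))"
    by (rule integrable_half_line_compact_support[OF assms(1) _ ab(1), of _ b])
      (use ab(3) test_function_DERIV(3)[OF assms(2)] in \<open>auto intro!: c\<close>)
  show "integrable half_line (\<lambda>x. f x * of_real (deriv \<psi> x))"
    by (rule integrable_half_line_compact_support[OF assms(1) _ ab(1), of _ b])
      (use ab(4) test_function_DERIV(2)[OF assms(2)] in \<open>auto intro!: c\<close>)
qed

text \<open>The fundamental lemma of the calculus of variations.  Bumps converge to indicator functions, so
  all integrals over intervals vanish, and the function vanishes at its Lebesgue points.\<close>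

lemma AE_zero_if_test_integrals_zero:
  assumes f: "locally_integrable f"
    and zero: "\<And>\<psi>. test_function \<psi> \<Longrightarrow> (LINT x|half_line. f x * of_real (\<psi> x)) = 0"
  shows "AE x in half_line. f x = 0"
proof -
  have "integral {x..y} f = 0" if "0 < x" for x y
  proof -
    have "(\<lambda>n. LINT t|half_line. f t * of_real (bump n x y t))
        \<longlonglongrightarrow> (LINT t|half_line. f t * of_real (indicator {x<..<y} t))"
    proof (rule weighted_integral_tendsto[where C=1])
      show "set_integrable lebesgue {x..y} f" by (rule locally_integrableD[OF f that])
      show "bump n x y \<in> borel_measurable half_line" for n
        by (intro borel_measurable_half_line borel_measurable_continuous_onI
            bump_algebra_continuous bump_algebra_bump)
      show "\<bar>bump n x y t\<bar> \<le> 1" for n t using bump_bounds[of n x y t] by simp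
      show "t \<notin> {x..y} \<Longrightarrow> bump n x y t = 0" for n t by (rule bump_outside) auto
      show "(\<lambda>n. bump n x y t) \<longlonglongrightarrow> indicator {x<..<y} t" for t by (rule bump_tendsto)
    qed
    moreover have "(LINT t|half_line. f t * of_real (indicator {x<..<y} t)) = integral {x..y} f"
      by (rule half_line_integral_indicator) (use locally_integrableD[OF f that] that in auto)
    ultimately show ?thesis
      using zero[OF test_function_bump[OF that]] by (simp add: LIMSEQ_const_iff)
  qed
  then show ?thesis
    using AE_lebesgue_point[OF f] AE_space[of half_line]
    by (auto elim!: eventually_elim2 simp: LIMSEQ_const_iff)
qed

lemma has_weak_derivative_unique:
  assumes "has_weak_derivative f g" "has_weak_derivative f h"
  shows "AE x in half_line. g x = h x"
proof -
  have g: "locally_integrable g" and h: "locally_integrable h"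
    using assms has_weak_derivative_locally_integrable by blast+
  have "AE x in half_line. g x - h x = 0"
  proof (rule AE_zero_if_test_integrals_zero)
    show "locally_integrable (\<lambda>x. g x - h x)"
      using g h unfolding locally_integrable_def by (auto intro: set_integral_diff)
    fix \<psi> assume \<psi>: "test_function \<psi>"
    show "(LINT x|half_line. (g x - h x) * of_real (\<psi> x)) = 0"
      using assms \<psi> integrable_test_function(1)[OF g \<psi>] integrable_test_function(1)[OF h \<psi>]
      unfolding has_weak_derivative_def by (simp add: left_diff_distrib)
  qed
  then show ?thesis by eventually_elim simp
qed

section \<open>Functions with a weak derivative are primitives\<close>

text \<open>The primitive of the indicator function of \<open>(0, e)\<close> that vanishes on the left.\<close>

definition ramp :: "real \<Rightarrow> real \<Rightarrow> real"
  where "ramp e s = max 0 (min e s)"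

text \<open>The lower limit \<open>-1\<close> lies to the left of the support of the bump, so that the primitive is
  differentiable at 0 from both sides.\<close>

definition smooth_ramp :: "nat \<Rightarrow> real \<Rightarrow> real \<Rightarrow> real"
  where "smooth_ramp n e s = integral {-1..s} (bump n 0 e)"

lemma continuous_bump: "continuous_on S (bump n x y)"
  by (intro bump_algebra_continuous bump_algebra_bump)

lemma smooth_ramp_eq_0: "s \<le> 0 \<Longrightarrow> smooth_ramp n e s = 0"
  unfolding smooth_ramp_def
  by (intro integral_unique has_integral_is_0) (auto simp: bump_outside)

lemma smooth_ramp_has_derivative:
  "(smooth_ramp n e has_real_derivative bump n 0 e s) (at s)"
proof (cases "s < 0")
  case True
  have "((\<lambda>x. 0) has_real_derivative bump n 0 e s) (at s)"
    using True by (simp add: bump_outside)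
  then show ?thesis
    by (rule has_field_derivative_transform_within_open[where S="{..<0}"])
      (use True in \<open>auto simp: smooth_ramp_eq_0\<close>)
next
  case False
  have "((\<lambda>s. integral {-1..s} (bump n 0 e)) has_real_derivative bump n 0 e s) (at s within {-1..s+1})"
    by (rule integral_has_real_derivative) (use False in \<open>auto intro: continuous_bump\<close>)
  moreover have "at s within {-1..s+1} = at s"
    by (rule at_within_interior) (use False in auto)
  ultimately show ?thesis unfolding smooth_ramp_def by simp
qed

lemma integral_indicator_ramp:
  assumes "0 \<le> e"
  shows "(indicator {0<..<e} has_integral ramp e s) {-1..s}"
proof -
  have "{0<..<e} \<inter> {-1..s} = (if s < e then {0<..s} else {0<..<e})" by auto
  then have "measure lebesgue ({0<..<e} \<inter> {-1..s}) = ramp e s"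
    using assms by (cases "s < 0") (auto simp: ramp_def measure_lborel_Ioc)
  moreover have m2: "{0<..<e} \<inter> {-1..s} \<in> lmeasurable" by (intro fmeasurable.Int) auto
  ultimately show ?thesis
    using integral_indicator[OF m2] integrable_on_indicator[of "{0<..<e}" "{-1..s}"]
      integrable_integral[of "indicat_real {0<..<e}" "{-1..s}"] by simp
qed

lemma smooth_ramp_bounds:
  assumes "0 \<le> e" shows "0 \<le> smooth_ramp n e s" "smooth_ramp n e s \<le> ramp e s"
proof -
  have i: "bump n 0 e integrable_on {-1..s}"
    by (rule integrable_continuous_interval[OF continuous_bump])
  show "0 \<le> smooth_ramp n e s" unfolding smooth_ramp_def
    by (rule integral_nonneg[OF i]) (rule bump_bounds)
  show "smooth_ramp n e s \<le> ramp e s" unfolding smooth_ramp_def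
  proof (rule has_integral_le[OF integrable_integral[OF i] integral_indicator_ramp[OF assms]])
    show "bump n 0 e x \<le> indicator {0<..<e} x" for x
      using bump_bounds[of n 0 e x] bump_outside[of x 0 e n] by (cases "x \<in> {0<..<e}") auto
  qed
qed

lemma smooth_ramp_tendsto:
  assumes "0 \<le> e" shows "(\<lambda>n. smooth_ramp n e s) \<longlonglongrightarrow> ramp e s"
proof -
  have "(\<lambda>n. integral {-1..s} (bump n 0 e)) \<longlonglongrightarrow> integral {-1..s} (indicator {0<..<e})"
  proof (rule dominated_convergence)
    show "bump n 0 e integrable_on {-1..s}" for n
      by (rule integrable_continuous_interval[OF continuous_bump])
    show "(\<lambda>x. 1) integrable_on {-1..s}" by (rule integrable_const_ivl)
    show "norm (bump n 0 e x) \<le> 1" for n x using bump_bounds[of n 0 e x] by simp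
    show "(\<lambda>n. bump n 0 e x) \<longlonglongrightarrow> indicator {0<..<e} x" for x by (rule bump_tendsto)
  qed
  then show ?thesis
    using integral_unique[OF integral_indicator_ramp[OF assms]] by (simp add: smooth_ramp_def)
qed

lemma smooth_ramp_const: "e \<le> s \<Longrightarrow> 0 \<le> e \<Longrightarrow> smooth_ramp n e s = smooth_ramp n e e"
proof -
  assume a: "e \<le> s" "0 \<le> e"
  have "smooth_ramp n e s = integral {-1..e} (bump n 0 e) + integral {e..s} (bump n 0 e)"
    unfolding smooth_ramp_def
    by (rule Henstock_Kurzweil_Integration.integral_combine[symmetric])
      (use a in \<open>auto intro: integrable_continuous_interval continuous_bump\<close>)
  moreover have "integral {e..s} (bump n 0 e) = 0"
    by (intro integral_unique has_integral_is_0) (auto simp: bump_outside)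
  ultimately show ?thesis by (simp add: smooth_ramp_def)
qed

text \<open>The difference of two shifted smooth ramps is a test function, since beyond the second ramp both
  have the same value.  Its derivative is a difference of two bumps, so in the limit the definition of the
  weak derivative compares the means of \<open>f\<close> over two short intervals.\<close>

lemma weak_derivative_mean_increment:
  assumes wd: "has_weak_derivative f g" and "0 < x" "x \<le> y" "0 < e"
  shows "integral {y..y+e} f - integral {x..x+e} f
    = (LINT t|half_line. g t * of_real (ramp e (t - x) - ramp e (t - y)))"
proof -
  define \<psi> where "\<psi> n t = smooth_ramp n e (t - x) - smooth_ramp n e (t - y)" for n t
  define \<rho> where "\<rho> n t = bump n x (x + e) t - bump n y (y + e) t" for n t
  have shift: "bump n z (z + e) t = bump n 0 e (t - z)" for n z t
    by (simp add: bump_def algebra_simps)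
  have der: "(\<psi> n has_real_derivative \<rho> n t) (at t)" for n t
  proof -
    have "((\<lambda>t. smooth_ramp n e (t - z)) has_real_derivative bump n 0 e (t - z)) (at t)" for z
    proof -
      have "((\<lambda>t. t - z) has_real_derivative 1) (at t)" by (auto intro!: derivative_eq_intros)
      from DERIV_chain2[OF smooth_ramp_has_derivative this] show ?thesis by simp
    qed
    then show ?thesis unfolding \<psi>_def \<rho>_def shift by (intro derivative_intros)
  qed
  have alg: "bump_algebra (\<rho> n)" for n
  proof -
    have "bump_algebra (\<lambda>t. bump n x (x + e) t + (- 1) * bump n y (y + e) t)"
      by (intro bump_algebra.intros bump_algebra_bump)
    then show ?thesis by (simp add: \<rho>_def[abs_def])
  qed
  have supp: "t \<notin> {x..y + e} \<Longrightarrow> \<psi> n t = 0" for n t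
    using assms smooth_ramp_const[of e "t - x" n] smooth_ramp_const[of e "t - y" n]
    by (cases "t < x") (auto simp: \<psi>_def smooth_ramp_eq_0)
  have test: "test_function (\<psi> n)" for n
    by (rule test_function_primitive[OF alg der \<open>0 < x\<close>]) (use supp in blast)
  have d\<psi>: "deriv (\<psi> n) = \<rho> n" for n using der DERIV_imp_deriv by blast
  note lf = has_weak_derivative_locally_integrable(1)[OF wd]
    and lg = has_weak_derivative_locally_integrable(2)[OF wd]
  have bmp: "(\<lambda>n. LINT t|half_line. f t * of_real (bump n z (z + e) t)) \<longlonglongrightarrow> integral {z..z + e} f"
    and int: "integrable half_line (\<lambda>t. f t * of_real (bump n z (z + e) t))" if "0 < z" for z n
  proof -
    note l = locally_integrableD(1)[OF lf that, of "z + e"]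
    have m: "bump n z (z + e) \<in> borel_measurable half_line" for n
      by (intro borel_measurable_half_line borel_measurable_continuous_onI continuous_bump)
    have b: "\<bar>bump n z (z + e) t\<bar> \<le> 1" for n t using bump_bounds[of n z "z+e" t] by simp
    have o: "t \<notin> {z..z + e} \<Longrightarrow> bump n z (z + e) t = 0" for n t by (rule bump_outside) auto
    show "integrable half_line (\<lambda>t. f t * of_real (bump n z (z + e) t))"
      by (rule integrable_half_line_weighted[OF l m b o])
    have "(\<lambda>n. LINT t|half_line. f t * of_real (bump n z (z + e) t))
        \<longlonglongrightarrow> (LINT t|half_line. f t * of_real (indicator {z<..<z + e} t))"
      by (rule weighted_integral_tendsto[OF l m b o bump_tendsto])
    then show "(\<lambda>n. LINT t|half_line. f t * of_real (bump n z (z + e) t)) \<longlonglongrightarrow> integral {z..z + e} f"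
      by (subst (asm) half_line_integral_indicator[OF l that]) auto
  qed
  have y: "0 < y" using assms by simp
  have "(\<lambda>n. LINT t|half_line. f t * of_real (deriv (\<psi> n) t))
      \<longlonglongrightarrow> integral {x..x + e} f - integral {y..y + e} f"
    using tendsto_diff[OF bmp[OF \<open>0 < x\<close>] bmp[OF y]] int[OF \<open>0 < x\<close>] int[OF y]
    by (simp add: d\<psi> \<rho>_def right_diff_distrib)
  moreover have "(\<lambda>n. LINT t|half_line. g t * of_real (\<psi> n t))
      \<longlonglongrightarrow> (LINT t|half_line. g t * of_real (ramp e (t - x) - ramp e (t - y)))"
  proof (rule weighted_integral_tendsto[where C=e])
    show "set_integrable lebesgue {x..y + e} g" by (rule locally_integrableD[OF lg \<open>0 < x\<close>])
    have "continuous_on UNIV (\<psi> n)" for n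
      using der DERIV_isCont continuous_at_imp_continuous_on by blast
    then show "\<psi> n \<in> borel_measurable half_line" for n
      by (intro borel_measurable_half_line borel_measurable_continuous_onI)
    have "ramp e s \<le> e" for s using \<open>0 < e\<close> by (simp add: ramp_def)
    then have "0 \<le> smooth_ramp n e s" "smooth_ramp n e s \<le> e" for n s
      using smooth_ramp_bounds[of e n s] \<open>0 < e\<close> order_trans by (auto intro: order_trans)
    note bd = this
    show "\<bar>\<psi> n t\<bar> \<le> e" for n t
      using bd[of n "t - x"] bd[of n "t - y"] by (auto simp: \<psi>_def)
    show "(\<lambda>n. \<psi> n t) \<longlonglongrightarrow> ramp e (t - x) - ramp e (t - y)" for t
      unfolding \<psi>_def by (intro tendsto_diff smooth_ramp_tendsto) (use \<open>0 < e\<close> in auto)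
  qed (use supp in blast)
  then have "(\<lambda>n. LINT t|half_line. f t * of_real (deriv (\<psi> n) t))
      \<longlonglongrightarrow> - (LINT t|half_line. g t * of_real (ramp e (t - x) - ramp e (t - y)))"
    using wd test unfolding has_weak_derivative_def by (simp add: tendsto_minus)
  ultimately have "integral {x..x + e} f - integral {y..y + e} f
      = - (LINT t|half_line. g t * of_real (ramp e (t - x) - ramp e (t - y)))"
    by (rule LIMSEQ_unique)
  then show ?thesis by (simp add: algebra_simps)
qed

lemma ramp_rescaled_tendsto:
  "(\<lambda>n. real (Suc n) * ramp (1 / real (Suc n)) s) \<longlonglongrightarrow> (if 0 < s then 1 else 0)"
proof (cases "0 < s")
  case True
  then obtain m where m: "1 / real (Suc m) < s" using nat_approx_posE by blast
  have "real (Suc n) * ramp (1 / real (Suc n)) s = 1" if "m \<le> n" for n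
  proof -
    have "1 / real (Suc n) \<le> 1 / real (Suc m)" using that by (simp add: field_simps)
    with m have "min (1 / real (Suc n)) s = 1 / real (Suc n)" by (simp add: min_def)
    then show ?thesis by (simp add: ramp_def)
  qed
  then have "\<forall>\<^sub>F n in sequentially. real (Suc n) * ramp (1 / real (Suc n)) s = 1"
    unfolding eventually_sequentially by blast
  with True show ?thesis by (simp add: tendsto_eventually)
next
  case False
  then have "ramp (1 / real (Suc n)) s = 0" for n by (auto simp: ramp_def)
  with False show ?thesis by simp
qed

text \<open>The rescaled trapezoids \<open>ramp e (t - x) - ramp e (t - y)\<close> tend to the indicator function of
  \<open>(x, y]\<close> as \<open>e\<close> tends to 0, while the means of \<open>f\<close> tend to its values at Lebesgue points.\<close>

lemma weak_derivative_increment: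
  assumes wd: "has_weak_derivative f g" and "0 < x" "x \<le> y"
    and x: "(\<lambda>n. real (Suc n) *\<^sub>R integral {x..x + 1 / real (Suc n)} f) \<longlonglongrightarrow> f x"
    and y: "(\<lambda>n. real (Suc n) *\<^sub>R integral {y..y + 1 / real (Suc n)} f) \<longlonglongrightarrow> f y"
  shows "f y - f x = integral {x..y} g"
proof -
  let ?T = "\<lambda>n t. real (Suc n) * (ramp (1 / real (Suc n)) (t - x) - ramp (1 / real (Suc n)) (t - y))"
  note lg = has_weak_derivative_locally_integrable(2)[OF wd]
  have "(\<lambda>n. LINT t|half_line. g t * of_real (?T n t))
      \<longlonglongrightarrow> (LINT t|half_line. g t * of_real (indicator {x<..y} t))"
  proof (rule weighted_integral_tendsto[where C=1])
    show "set_integrable lebesgue {x..y + 1} g" by (rule locally_integrableD[OF lg \<open>0 < x\<close>])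
    show "?T n \<in> borel_measurable half_line" for n
      unfolding ramp_def
      by (intro borel_measurable_half_line borel_measurable_continuous_onI continuous_intros)
    have T: "0 \<le> ramp e (t - x) - ramp e (t - y)" "ramp e (t - x) - ramp e (t - y) \<le> e"
      if "0 < e" for e t
      using that \<open>x \<le> y\<close> by (auto simp: ramp_def)
    show "\<bar>?T n t\<bar> \<le> 1" for n t
      using T[of "1 / real (Suc n)" t] by (simp add: abs_mult pos_le_divide_eq mult.commute)
    show "?T n t = 0" if "t \<notin> {x..y + 1}" for n t
    proof (cases "t < x")
      case False
      then have "1 \<le> t - x" "1 \<le> t - y" using that \<open>x \<le> y\<close> by auto
      moreover have "1 / real (Suc n) \<le> 1" by simp
      ultimately have "min (1 / real (Suc n)) (t - x) = 1 / real (Suc n)"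
          "min (1 / real (Suc n)) (t - y) = 1 / real (Suc n)"
        by linarith+
      then show ?thesis by (simp add: ramp_def)
    qed (use \<open>x \<le> y\<close> in \<open>auto simp: ramp_def\<close>)
    show "(\<lambda>n. ?T n t) \<longlonglongrightarrow> indicator {x<..y} t" for t
    proof -
      have "(\<lambda>n. ?T n t) \<longlonglongrightarrow> (if 0 < t - x then 1 else 0) - (if 0 < t - y then 1 else 0)"
        unfolding right_diff_distrib by (intro tendsto_diff ramp_rescaled_tendsto)
      then show ?thesis using \<open>x \<le> y\<close> by (auto simp: indicator_def split: if_splits)
    qed
  qed
  moreover have "(LINT t|half_line. g t * of_real (indicator {x<..y} t)) = integral {x..y} g"
    by (rule half_line_integral_indicator[OF locally_integrableD(1)[OF lg]])
      (use \<open>0 < x\<close> in auto)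
  moreover have "(LINT t|half_line. g t * of_real (?T n t))
      = real (Suc n) *\<^sub>R integral {y..y + 1 / real (Suc n)} f - real (Suc n) *\<^sub>R integral {x..x + 1 / real (Suc n)} f" for n
  proof -
    have "(LINT t|half_line. g t * of_real (?T n t)) = real (Suc n) *\<^sub>R
        (LINT t|half_line. g t * of_real (ramp (1 / real (Suc n)) (t - x) - ramp (1 / real (Suc n)) (t - y)))"
      unfolding scaleR_conv_of_real
      by (subst integral_mult_right_zero[symmetric])
        (simp only: of_real_mult mult.assoc mult.left_commute)
    then show ?thesis
      using weak_derivative_mean_increment[OF wd \<open>0 < x\<close> \<open>x \<le> y\<close>, of "1 / real (Suc n)"]
      by (simp add: scaleR_diff_right[symmetric] del: of_nat_Suc)
  qed
  ultimately show ?thesis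
    using LIMSEQ_unique[OF tendsto_diff[OF y x]] by simp
qed

text \<open>One of the two integrals always vanishes, because its interval is empty or a point; the formula thus covers points
  on either side of 1.\<close>

definition primitive :: "(real \<Rightarrow> complex) \<Rightarrow> real \<Rightarrow> complex"
  where "primitive g x = integral {1..x} g - integral {x..1} g"

lemma primitive_diff:
  assumes g: "locally_integrable g" and "0 < x" "x \<le> y"
  shows "primitive g y - primitive g x = integral {x..y} g"
proof -
  have c: "integral {a..b} g + integral {b..c} g = integral {a..c} g" if "0 < a" "a \<le> b" "b \<le> c" for a b c
    by (rule Henstock_Kurzweil_Integration.integral_combine) (use that locally_integrableD(2)[OF g] in auto)
  have z: "integral {a..b} g = 0" if "b \<le> a" for a b :: real
    using that by (cases "a = b") auto
  consider "1 \<le> x" | "x \<le> 1" "1 \<le> y" | "y \<le> 1" using assms by linarith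
  then show ?thesis
  proof cases
    case 1
    then show ?thesis using c[of 1 x y] assms by (simp add: primitive_def algebra_simps z)
  next
    case 2
    then show ?thesis using c[of x 1 y] assms by (simp add: primitive_def algebra_simps z)
  next
    case 3
    then show ?thesis using c[of x y 1] assms by (simp add: primitive_def algebra_simps z)
  qed
qed

text \<open>By the increment formula, \<open>f - primitive g\<close> takes the same value at all Lebesgue points of
  \<open>f\<close>.\<close>

lemma weak_derivative_primitive:
  assumes wd: "has_weak_derivative f g"
  shows "\<exists>c. AE x in half_line. f x = c + primitive g x"
proof -
  note lf = has_weak_derivative_locally_integrable(1)[OF wd]
    and lg = has_weak_derivative_locally_integrable(2)[OF wd]
  define L where "L x \<longleftrightarrow> 0 < x \<and> (\<lambda>n. real (Suc n) *\<^sub>R integral {x..x + 1 / real (Suc n)} f) \<longlonglongrightarrow> f x" for x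
  have L: "AE x in half_line. L x"
    using AE_lebesgue_point[OF lf] AE_space[of half_line]
    by eventually_elim (auto simp: L_def)
  have incr: "f y - f x = primitive g y - primitive g x" if "L x" "L y" for x y
  proof -
    have "f y - f x = primitive g y - primitive g x" if "x \<le> y" "L x" "L y" for x y
      using weak_derivative_increment[OF wd, of x y] primitive_diff[OF lg, of x y] that
      by (auto simp: L_def)
    from this[of x y] this[of y x] that show ?thesis
      by (cases "x \<le> y") (auto simp: algebra_simps)
  qed
  show ?thesis
  proof (cases "\<exists>x. L x")
    case True
    then obtain x0 where x0: "L x0" by blast
    have "AE x in half_line. f x = (f x0 - primitive g x0) + primitive g x"
      using L by eventually_elim (use incr[OF x0] in \<open>simp add: algebra_simps\<close>)
    then show ?thesis by blast
  next
    case False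
    with L show ?thesis by (auto elim: eventually_mono)
  qed
qed

lemma primitive_has_vector_derivative:
  assumes g: "locally_integrable g" and "0 < x"
    and eq: "AE x in half_line. g x = k x" and k: "continuous_on {0<..} k"
  shows "(primitive g has_vector_derivative k x) (at x)"
proof -
  obtain N where N: "negligible N" and gk0: "\<And>t. 0 < t \<Longrightarrow> t \<notin> N \<Longrightarrow> g t = k t"
    using AE_half_lineE[OF eq] by blast
  have gk: "integral {a..t} g = integral {a..t} k" if "0 < a" for a t
    by (rule integral_spike[OF N]) (use gk0 that in auto)
  have kc: "continuous_on {x/2..x+1} k" by (rule continuous_on_subset[OF k]) (use \<open>0 < x\<close> in auto)
  have "((\<lambda>t. integral {x/2..t} k) has_vector_derivative k x) (at x within {x/2..x+1})"
    by (rule integral_has_vector_derivative[OF kc]) (use \<open>0 < x\<close> in auto)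
  moreover have "at x within {x/2..x+1} = at x" by (rule at_within_interior) (use \<open>0 < x\<close> in auto)
  ultimately have "((\<lambda>t. primitive g (x/2) + integral {x/2..t} k) has_vector_derivative k x) (at x)"
    by (auto intro!: derivative_eq_intros)
  then show ?thesis
  proof (rule has_vector_derivative_transform_within_open)
    show "open {x/2<..}" "x \<in> {x/2<..}" using \<open>0 < x\<close> by auto
    fix t assume "t \<in> {x/2<..}"
    then show "primitive g (x/2) + integral {x/2..t} k = primitive g t"
      using primitive_diff[OF g, of "x/2" t] \<open>0 < x\<close> gk[of "x/2" t] by (auto simp: algebra_simps)
  qed
qed

section \<open>The Sobolev space on the half-line\<close>

lemma Lq_2_iff:
  "f \<in> Lq_half_line 2 \<longleftrightarrow> f \<in> borel_measurable half_line \<and> integrable half_line (\<lambda>x. (norm (f x))\<^sup>2)"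
  by (simp add: Lq_half_line_def)

lemma Lq_2_D:
  assumes "f \<in> Lq_half_line 2"
  shows "f \<in> borel_measurable half_line" "integrable half_line (\<lambda>x. (norm (f x))\<^sup>2)"
  using assms by (auto simp: Lq_2_iff)

lemma two_mult_le_sum_squares: "2 * (a * b) \<le> a\<^sup>2 + (b::real)\<^sup>2"
  using sum_squares_bound[of a b] by simp

lemma norm_le_one_plus_square: "norm z \<le> 1 + (norm (z::complex))\<^sup>2"
  using two_mult_le_sum_squares[of 1 "norm z"] norm_ge_zero[of z] by (simp del: norm_ge_zero)

lemma Lq_2_add:
  assumes f: "f \<in> Lq_half_line 2" and g: "g \<in> Lq_half_line 2"
  shows "(\<lambda>x. f x + z * g x) \<in> Lq_half_line 2"
  unfolding Lq_2_iff
proof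
  note [measurable] = Lq_2_D(1)[OF f] Lq_2_D(1)[OF g]
  show "(\<lambda>x. f x + z * g x) \<in> borel_measurable half_line" by measurable
  show "integrable half_line (\<lambda>x. (norm (f x + z * g x))\<^sup>2)"
  proof (rule Bochner_Integration.integrable_bound)
    show "integrable half_line (\<lambda>x. 2 * (norm (f x))\<^sup>2 + 2 * (norm z)\<^sup>2 * (norm (g x))\<^sup>2)"
      using Lq_2_D(2)[OF f] Lq_2_D(2)[OF g] by auto
    have "(norm (a + z * b))\<^sup>2 \<le> 2 * (norm a)\<^sup>2 + 2 * (norm z)\<^sup>2 * (norm b)\<^sup>2" for a b :: complex
    proof -
      have "(norm (a + z * b))\<^sup>2 \<le> (norm a + norm (z * b))\<^sup>2"
        by (intro power_mono norm_triangle_ineq) auto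
      then show ?thesis
        using two_mult_le_sum_squares[of "norm a" "norm (z * b)"]
        by (simp add: power2_sum norm_mult power_mult_distrib)
    qed
    then show "AE x in half_line. norm ((norm (f x + z * g x))\<^sup>2)
        \<le> norm (2 * (norm (f x))\<^sup>2 + 2 * (norm z)\<^sup>2 * (norm (g x))\<^sup>2)"
      by (intro AE_I2) (simp add: order_trans[OF _ abs_ge_self])
  qed measurable
qed

lemma Lq_2_zero: "(\<lambda>x. 0) \<in> Lq_half_line 2"
  by (simp add: Lq_2_iff)

lemma Lq_2_scale:
  assumes "f \<in> Lq_half_line 2" shows "(\<lambda>x. z * f x) \<in> Lq_half_line 2"
  using Lq_2_add[OF Lq_2_zero assms, of z] by simp

lemma integrable_Lq_2_mult:
  assumes f: "f \<in> Lq_half_line 2" and g: "g \<in> Lq_half_line 2"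
  shows "integrable half_line (\<lambda>x. cnj (f x) * g x)"
proof (rule Bochner_Integration.integrable_bound)
  note [measurable] = Lq_2_D(1)[OF f] Lq_2_D(1)[OF g]
  show "integrable half_line (\<lambda>x. (norm (f x))\<^sup>2 + (norm (g x))\<^sup>2)"
    using Lq_2_D(2)[OF f] Lq_2_D(2)[OF g] by auto
  have "(\<lambda>x. cnj (f x)) \<in> borel_measurable half_line"
    by (rule borel_measurable_continuous_on[OF _ Lq_2_D(1)[OF f]]) (intro continuous_intros)
  then show "(\<lambda>x. cnj (f x) * g x) \<in> borel_measurable half_line" by measurable
  have "norm (cnj a * b) \<le> (norm a)\<^sup>2 + (norm b)\<^sup>2" for a b :: complex
  proof -
    have "0 \<le> norm a * norm b" by simp
    with two_mult_le_sum_squares[of "norm a" "norm b"] show ?thesis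
      unfolding norm_mult complex_mod_cnj by linarith
  qed
  then show "AE x in half_line. norm (cnj (f x) * g x) \<le> norm ((norm (f x))\<^sup>2 + (norm (g x))\<^sup>2)"
    by (intro AE_I2) (simp add: order_trans[OF _ abs_ge_self])
qed

lemma Lq_2_imp_integrable_on:
  assumes g: "g \<in> Lq_half_line 2"
  shows "g integrable_on {0..b}"
proof -
  have "integrable half_line (\<lambda>t. indicator {0<..b} t *\<^sub>R g t)"
  proof (rule Bochner_Integration.integrable_bound)
    have "integrable half_line (indicator {0<..b} :: real \<Rightarrow> real)"
    proof -
      have "set_integrable lebesgue {0<..b} (\<lambda>_. 1::real)"
        by (rule set_integrable_subset[OF absolutely_integrable_continuous_real[of 0 b]]) auto
      moreover have "(\<lambda>t. indicator {0<..} t *\<^sub>R indicator {0<..b} t :: real) = (\<lambda>t. indicator {0<..b} t *\<^sub>R 1)"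
        by (auto simp: indicator_def)
      ultimately show ?thesis
        by (subst integrable_restrict_space) (auto simp: set_integrable_def)
    qed
    then show "integrable half_line (\<lambda>t. indicator {0<..b} t + (norm (g t))\<^sup>2)"
      using Lq_2_D(2)[OF g] by auto
    show "(\<lambda>t. indicator {0<..b} t *\<^sub>R g t) \<in> borel_measurable half_line"
      by (rule borel_measurable_scaleR[OF borel_measurable_half_line Lq_2_D(1)[OF g]]) auto
    show "AE t in half_line. norm (indicator {0<..b} t *\<^sub>R g t) \<le> norm (indicator {0<..b} t + (norm (g t))\<^sup>2)"
      using norm_le_one_plus_square by (intro AE_I2) (auto simp: indicator_def)
  qed
  then have "(\<lambda>t. indicator {0<..b} t *\<^sub>R g t) integrable_on {0<..}"
    by (rule integrable_on_lebesgue_on) auto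
  then have "(\<lambda>t. if t \<in> {0<..b} then g t else 0) integrable_on {0<..}"
    by (rule integrable_eq) (auto simp: indicator_def)
  moreover have "{0<..b} \<inter> {0<..} = {0<..b}" by auto
  ultimately have "g integrable_on {0<..b}" by (simp only: integrable_restrict_Int)
  then show ?thesis
  proof (rule integrable_spike_set)
    have n: "negligible {0::real}" by simp
    show "negligible {x \<in> {0<..b} - {0..b}. g x \<noteq> 0}" by (rule negligible_subset[OF n]) auto
    show "negligible {x \<in> {0..b} - {0<..b}. g x \<noteq> 0}" by (rule negligible_subset[OF n]) auto
  qed
qed

lemma locally_integrable_add:
  assumes "locally_integrable f" "locally_integrable g"
  shows "locally_integrable (\<lambda>x. f x + z * g x)"
  using assms unfolding locally_integrable_def
  by (auto intro!: set_integral_add(1) set_integrable_mult_right)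

lemma has_weak_derivative_iff:
  "has_weak_derivative f g \<longleftrightarrow> locally_integrable f \<and> locally_integrable g \<and>
    (\<forall>\<psi>. test_function \<psi> \<longrightarrow>
      (LINT x|half_line. f x * of_real (deriv \<psi> x)) = - (LINT x|half_line. g x * of_real (\<psi> x)))"
  unfolding has_weak_derivative_def locally_integrable_def by blast

lemma has_weak_derivative_add:
  assumes "has_weak_derivative f f'" "has_weak_derivative g g'"
  shows "has_weak_derivative (\<lambda>x. f x + z * g x) (\<lambda>x. f' x + z * g' x)"
  unfolding has_weak_derivative_iff
proof (intro conjI allI impI)
  have li: "locally_integrable f" "locally_integrable f'" "locally_integrable g" "locally_integrable g'"
    using assms by (auto simp: has_weak_derivative_iff)
  then show "locally_integrable (\<lambda>x. f x + z * g x)" "locally_integrable (\<lambda>x. f' x + z * g' x)"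
    by (auto intro: locally_integrable_add)
  fix \<psi> assume \<psi>: "test_function \<psi>"
  have *: "(LINT x|half_line. (h x + z * k x) * of_real (\<phi> x)) =
      (LINT x|half_line. h x * of_real (\<phi> x)) + z * (LINT x|half_line. k x * of_real (\<phi> x))"
    if "integrable half_line (\<lambda>x. h x * of_real (\<phi> x))" "integrable half_line (\<lambda>x. k x * of_real (\<phi> x))"
    for h k and \<phi> :: "real \<Rightarrow> real"
    using that by (simp add: distrib_right mult.assoc)
  show "(LINT x|half_line. (f x + z * g x) * of_real (deriv \<psi> x))
      = - (LINT x|half_line. (f' x + z * g' x) * of_real (\<psi> x))"
    using assms \<psi> unfolding has_weak_derivative_iff
    by (simp add: * integrable_test_function li)
qed

lemma has_weak_derivative_smooth:
  fixes f f' :: "real \<Rightarrow> complex"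
  assumes der: "\<And>x. (f has_vector_derivative f' x) (at x)" and cont: "continuous_on UNIV f'"
  shows "has_weak_derivative f f'"
  unfolding has_weak_derivative_iff
proof (intro conjI allI impI)
  have fc: "continuous_on UNIV f"
    using der has_vector_derivative_continuous continuous_at_imp_continuous_on by blast
  have li: "locally_integrable h" if "continuous_on UNIV h" for h
    unfolding locally_integrable_def
    by (auto intro!: absolutely_integrable_continuous_real continuous_on_subset[OF that])
  show "locally_integrable f" "locally_integrable f'" by (auto intro: li fc cont)
  fix \<psi> assume \<psi>: "test_function \<psi>"
  obtain a b where ab: "0 < a" "a < b" "\<And>x. x \<notin> {a<..<b} \<Longrightarrow> \<psi> x = 0"
      "\<And>x. x \<notin> {a<..<b} \<Longrightarrow> deriv \<psi> x = 0"
    using test_function_support[OF \<psi>] by metis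
  have "((\<lambda>x. f x * of_real (deriv \<psi> x) + f' x * of_real (\<psi> x)) has_integral
      f b * of_real (\<psi> b) - f a * of_real (\<psi> a)) {a..b}"
  proof (rule fundamental_theorem_of_calculus)
    fix x assume "x \<in> {a..b}"
    have "((\<lambda>x. complex_of_real (\<psi> x)) has_vector_derivative of_real (deriv \<psi> x)) (at x)"
      using test_function_DERIV(1)[OF \<psi>, of x] by (rule has_vector_derivative_of_real)
    from has_vector_derivative_mult[OF der this]
    show "((\<lambda>x. f x * of_real (\<psi> x)) has_vector_derivative f x * of_real (deriv \<psi> x) + f' x * of_real (\<psi> x))
        (at x within {a..b})"
      by (rule has_vector_derivative_at_within)
  qed (use ab in simp)
  then have I: "((\<lambda>x. f x * of_real (deriv \<psi> x) + f' x * of_real (\<psi> x)) has_integral 0) {a..b}"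
    using ab(3)[of a] ab(3)[of b] by simp
  have I0: "((\<lambda>x. f x * of_real (deriv \<psi> x) + f' x * of_real (\<psi> x)) has_integral 0) {0<..}"
    by (rule has_integral_on_superset[OF I]) (use ab ab(3,4) in force)+
  note int = integrable_test_function(2)[OF li[OF fc] \<psi>] integrable_test_function(1)[OF li[OF cont] \<psi>]
  have S: "{0::real<..} \<in> sets lebesgue" by simp
  have "(LINT x|half_line. f x * of_real (deriv \<psi> x)) + (LINT x|half_line. f' x * of_real (\<psi> x))
      = (LINT x|half_line. f x * of_real (deriv \<psi> x) + f' x * of_real (\<psi> x))"
    by (rule Bochner_Integration.integral_add[OF int, symmetric])
  also have "\<dots> = 0"
    using lebesgue_integral_eq_integral[OF Bochner_Integration.integrable_add[OF int] S]
      integral_unique[OF I0] by (rule trans)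
  finally show "(LINT x|half_line. f x * of_real (deriv \<psi> x)) = - (LINT x|half_line. f' x * of_real (\<psi> x))"
    by (rule eq_neg_iff_add_eq_0[THEN iffD2])
qed

text \<open>Two continuous functions that differ at one point differ on an open interval, which is not
  negligible.  The point 0 is allowed although the measure does not see it.\<close>

lemma AE_half_line_continuous_eq:
  fixes h k :: "real \<Rightarrow> complex"
  assumes "AE x in half_line. h x = k x" "continuous_on {0..} h" "continuous_on {0..} k" "0 \<le> x"
  shows "h x = k x"
proof (rule ccontr)
  assume ne: "h x \<noteq> k x"
  have "continuous_on {0..} (\<lambda>y. h y - k y)" using assms by (intro continuous_intros)
  then obtain d where d: "0 < d" "\<And>y. 0 \<le> y \<Longrightarrow> dist y x < d \<Longrightarrow> dist (h y - k y) (h x - k x) < norm (h x - k x)"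
    using ne assms(4) unfolding continuous_on_iff by (metis atLeast_iff right_minus_eq zero_less_norm_iff)
  obtain N where N: "negligible N" "\<And>t. 0 < t \<Longrightarrow> t \<notin> N \<Longrightarrow> h t = k t"
    using AE_half_lineE[OF assms(1)] by blast
  have "{x<..<x + d} \<subseteq> N"
  proof
    fix y assume y: "y \<in> {x<..<x + d}"
    then have "dist (h y - k y) (h x - k x) < norm (h x - k x)"
      using d(2)[of y] assms(4) by (auto simp: dist_real_def)
    then have "h y \<noteq> k y" by (auto simp: dist_norm norm_minus_commute)
    with y N(2)[of y] assms(4) show "y \<in> N" by auto
  qed
  then have "negligible {x<..<x + d}" by (rule negligible_subset[OF N(1)])
  then show False using open_not_negligible[of "{x<..<x+d}"] d(1) by auto
qed

text \<open>A function of the Sobolev space together with a weak derivative and its boundary value.  Carrying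
  the three objects along makes the functionals computable from the data and keeps the
  choice operators in \<^const>\<open>weak_derivative\<close> and \<^const>\<open>trace_at_0\<close> out of the argument.\<close>

definition H1_data :: "(real \<Rightarrow> complex) \<Rightarrow> (real \<Rightarrow> complex) \<Rightarrow> complex \<Rightarrow> bool"
  where "H1_data f g c \<longleftrightarrow> f \<in> Lq_half_line 2 \<and> g \<in> Lq_half_line 2 \<and> has_weak_derivative f g \<and>
    (\<exists>h. continuous_on {0..} h \<and> (AE x in half_line. f x = h x) \<and> h 0 = c)"

text \<open>A square integrable weak derivative is integrable up to 0, so the primitive, which a priori lives on
  the open half-line, extends continuously to the endpoint.\<close>

lemma weak_derivative_continuous_representative:
  assumes wd: "has_weak_derivative f g" and g: "g \<in> Lq_half_line 2"
  shows "\<exists>h. continuous_on {0..} h \<and> (AE x in half_line. f x = h x) \<and>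
    (\<forall>x y. 0 \<le> x \<longrightarrow> x \<le> y \<longrightarrow> h y - h x = integral {x..y} g)"
proof -
  note i = Lq_2_imp_integrable_on[OF g]
  note lg = has_weak_derivative_locally_integrable(2)[OF wd]
  obtain c where c: "AE x in half_line. f x = c + primitive g x"
    using weak_derivative_primitive[OF wd] by blast
  define h where "h x = (c + primitive g 1 - integral {0..1} g) + integral {0..x} g" for x
  have inc: "h y - h x = integral {x..y} g" if "0 \<le> x" "x \<le> y" for x y
    using Henstock_Kurzweil_Integration.integral_combine[OF that i] by (simp add: h_def diff_eq_eq add.commute)
  have hp: "c + primitive g x = h x" if "0 < x" for x
  proof (cases "1 \<le> x")
    case True
    then show ?thesis using inc[of 1 x] primitive_diff[OF lg, of 1 x] by (simp add: h_def algebra_simps)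
  next
    case False
    then show ?thesis using inc[of x 1] primitive_diff[OF lg, of x 1] that by (simp add: h_def algebra_simps)
  qed
  have "continuous_on {0..} h"
    unfolding continuous_on_eq_continuous_within
  proof
    fix x :: real assume x: "x \<in> {0..}"
    have "continuous_on {0..x+1} h"
      unfolding h_def by (intro continuous_intros indefinite_integral_continuous_1 i)
    then have "continuous (at x within {0..x+1}) h"
      using x by (auto simp: continuous_on_eq_continuous_within)
    moreover have "at x within {0..x+1} = at x within {0..}"
      by (rule at_within_nhd[of _ "{..<x+1}"]) auto
    ultimately show "continuous (at x within {0..}) h" by (simp add: continuous_within)
  qed
  moreover have "AE x in half_line. f x = h x"
    using c AE_space[of half_line] by eventually_elim (use hp in auto)
  ultimately show ?thesis using inc by blast
qed

lemma H1_half_line_data: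
  assumes "f \<in> H1_half_line" shows "\<exists>g c. H1_data f g c"
proof -
  obtain g where g: "f \<in> Lq_half_line 2" "g \<in> Lq_half_line 2" "has_weak_derivative f g"
    using assms unfolding H1_half_line_def by blast
  with weak_derivative_continuous_representative[OF g(3,2)] show ?thesis
    unfolding H1_data_def by blast
qed

lemma H1_data_H1_half_line: "H1_data f g c \<Longrightarrow> f \<in> H1_half_line"
  unfolding H1_data_def H1_half_line_def by blast

lemma trace_at_0_eqI:
  assumes "continuous_on {0..} h" "AE x in half_line. f x = h x"
  shows "trace_at_0 f = h 0"
  unfolding trace_at_0_def
proof (rule the_equality)
  show "\<exists>ha. continuous_on {0..} ha \<and> (AE x in half_line. f x = ha x) \<and> ha 0 = h 0"
    using assms by blast
  fix c assume "\<exists>k. continuous_on {0..} k \<and> (AE x in half_line. f x = k x) \<and> k 0 = c"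
  then obtain k where k: "continuous_on {0..} k" "AE x in half_line. f x = k x" "k 0 = c" by blast
  have "AE x in half_line. k x = h x" using assms(2) k(2) by eventually_elim simp
  from AE_half_line_continuous_eq[OF this k(1) assms(1)] k(3) show "c = h 0" by simp
qed

lemma H1_data_trace: "H1_data f g c \<Longrightarrow> trace_at_0 f = c"
  unfolding H1_data_def using trace_at_0_eqI by blast

lemma H1_data_weak_derivative:
  assumes "H1_data f g c" shows "AE x in half_line. weak_derivative f x = g x"
proof -
  have "has_weak_derivative f g" using assms by (simp add: H1_data_def)
  then have "has_weak_derivative f (weak_derivative f)"
    unfolding weak_derivative_def by (rule someI[of "has_weak_derivative f"])
  then show ?thesis using has_weak_derivative_unique \<open>has_weak_derivative f g\<close> by blast
qed

lemma H1_data_add: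
  assumes "H1_data f f' c" "H1_data g g' d"
  shows "H1_data (\<lambda>x. f x + z * g x) (\<lambda>x. f' x + z * g' x) (c + z * d)"
proof -
  obtain h k where hk: "continuous_on {0..} h" "AE x in half_line. f x = h x" "h 0 = c"
      "continuous_on {0..} k" "AE x in half_line. g x = k x" "k 0 = d"
    using assms unfolding H1_data_def by blast
  have "continuous_on {0..} (\<lambda>x. h x + z * k x)" using hk by (intro continuous_intros)
  moreover have "AE x in half_line. f x + z * g x = h x + z * k x"
    using hk(2,5) by eventually_elim simp
  ultimately show ?thesis
    using assms hk unfolding H1_data_def
    by (auto intro!: Lq_2_add has_weak_derivative_add exI[of _ "\<lambda>x. h x + z * k x"])
qed

lemma H1_data_zero: "H1_data (\<lambda>x. 0) (\<lambda>x. 0) 0"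
proof -
  have "has_weak_derivative (\<lambda>x. 0) (\<lambda>x. 0)"
    by (rule has_weak_derivative_smooth) auto
  then show ?thesis
    unfolding H1_data_def by (auto simp: Lq_2_zero intro!: exI[of _ "\<lambda>x. 0"])
qed

lemma H1_data_scale:
  assumes "H1_data f f' c" shows "H1_data (\<lambda>x. z * f x) (\<lambda>x. z * f' x) (z * c)"
  using H1_data_add[OF H1_data_zero assms, of z] by simp

lemma H1_data_smooth:
  fixes f f' :: "real \<Rightarrow> complex"
  assumes der: "\<And>x. (f has_vector_derivative f' x) (at x)" and cont: "continuous_on UNIV f'"
    and "f \<in> Lq_half_line 2" "f' \<in> Lq_half_line 2"
  shows "H1_data f f' (f 0)"
proof -
  have "continuous_on {0..} f"
    using der has_vector_derivative_continuous continuous_at_imp_continuous_on by blast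
  then show ?thesis
    unfolding H1_data_def using assms has_weak_derivative_smooth[OF der cont] by auto
qed

section \<open>Integrability of the nonlinear terms\<close>

lemma integral_diff_bound:
  assumes g: "g \<in> Lq_half_line 2" and "0 < x" "x \<le> y" "y \<le> x + 1"
  shows "norm (integral {x..y} g) \<le> 1 + (LINT t|half_line. (norm (g t))\<^sup>2)"
proof -
  have S: "{0::real<..} \<in> sets lebesgue" by simp
  note G = Lq_2_D(2)[OF g]
  have i: "(\<lambda>t. (norm (g t))\<^sup>2) integrable_on {0<..}"
    by (rule integrable_on_lebesgue_on[OF G S])
  have ixy: "(\<lambda>t. (norm (g t))\<^sup>2) integrable_on {x..y}"
    by (rule integrable_on_subinterval[OF i]) (use assms in auto)
  have gi: "g integrable_on {x..y}"
    by (rule integrable_on_subinterval[OF Lq_2_imp_integrable_on[OF g, of y]]) (use assms in auto)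
  have "norm (integral {x..y} g) \<le> integral {x..y} (\<lambda>t. 1 + (norm (g t))\<^sup>2)"
    by (intro integral_norm_bound_integral gi Henstock_Kurzweil_Integration.integrable_add ixy
        norm_le_one_plus_square) auto
  also have "\<dots> = (y - x) + integral {x..y} (\<lambda>t. (norm (g t))\<^sup>2)"
    using assms by (subst Henstock_Kurzweil_Integration.integral_add[OF _ ixy]) auto
  also have "integral {x..y} (\<lambda>t. (norm (g t))\<^sup>2) \<le> integral {0<..} (\<lambda>t. (norm (g t))\<^sup>2)"
    by (rule integral_subset_le[OF _ ixy i]) (use assms in auto)
  also have "integral {0<..} (\<lambda>t. (norm (g t))\<^sup>2) = (LINT t|half_line. (norm (g t))\<^sup>2)"
    by (rule lebesgue_integral_eq_integral[OF G S, symmetric])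
  finally show ?thesis using assms by simp
qed

text \<open>The values of the continuous representative at \<open>x\<close> and at a point of \<open>[x, x+1]\<close> differ by at most
  \<open>1 + \<integral>|g|\<^sup>2\<close>; averaging over that interval gives a bound in terms of the two square integrals.\<close>

lemma H1_data_bounded:
  assumes "H1_data f g c"
  shows "\<exists>C\<ge>0. AE x in half_line. norm (f x) \<le> C"
proof -
  have f: "f \<in> Lq_half_line 2" and g: "g \<in> Lq_half_line 2" and wd: "has_weak_derivative f g"
    using assms by (auto simp: H1_data_def)
  obtain h where h: "continuous_on {0..} h" "AE x in half_line. f x = h x"
      "\<And>x y. 0 \<le> x \<Longrightarrow> x \<le> y \<Longrightarrow> h y - h x = integral {x..y} g"
    using weak_derivative_continuous_representative[OF wd g] by blast
  define B where "B = (LINT t|half_line. (norm (g t))\<^sup>2)"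
  define A where "A = (LINT t|half_line. (norm (h t))\<^sup>2)"
  have S: "{0::real<..} \<in> sets lebesgue" by simp
  have "h \<in> borel_measurable half_line"
    by (rule continuous_imp_measurable_on_sets_lebesgue[OF continuous_on_subset[OF h(1)] S]) auto
  then have H: "integrable half_line (\<lambda>t. (norm (h t))\<^sup>2)"
    using Lq_2_D[OF f] h(2)
    by (subst integrable_cong_AE[where g="\<lambda>t. (norm (f t))\<^sup>2"]) (auto elim: eventually_mono)
  have iH: "(\<lambda>t. (norm (h t))\<^sup>2) integrable_on {0<..}" by (rule integrable_on_lebesgue_on[OF H S])
  have bound: "norm (h x) \<le> 2 + B + A" if "0 < x" for x
  proof -
    have ixy: "(\<lambda>t. (norm (h t))\<^sup>2) integrable_on {x..x+1}"
      by (rule integrable_on_subinterval[OF iH]) (use that in auto)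
    have pt: "norm (h x) \<le> 2 + B + (norm (h y))\<^sup>2" if y: "y \<in> {x..x+1}" for y
    proof -
      have "norm (h x) \<le> norm (h y) + norm (h y - h x)"
        using norm_triangle_ineq4[of "h y" "h y - h x"] by simp
      moreover have "norm (h y - h x) \<le> 1 + B"
        using integral_diff_bound[OF g \<open>0 < x\<close>, of y] h(3)[of x y] y \<open>0 < x\<close> by (simp add: B_def)
      moreover have "norm (h y) \<le> 1 + (norm (h y))\<^sup>2" by (rule norm_le_one_plus_square)
      ultimately show ?thesis by linarith
    qed
    have "norm (h x) = integral {x..x+1} (\<lambda>y. norm (h x))" by simp
    also have "\<dots> \<le> integral {x..x+1} (\<lambda>y. (2 + B) + (norm (h y))\<^sup>2)"
      by (intro integral_le Henstock_Kurzweil_Integration.integrable_add ixy pt) auto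
    also have "\<dots> = (2 + B) + integral {x..x+1} (\<lambda>y. (norm (h y))\<^sup>2)"
      by (subst Henstock_Kurzweil_Integration.integral_add[OF _ ixy]) auto
    also have "integral {x..x+1} (\<lambda>y. (norm (h y))\<^sup>2) \<le> integral {0<..} (\<lambda>y. (norm (h y))\<^sup>2)"
      by (rule integral_subset_le[OF _ ixy iH]) (use that in auto)
    also have "\<dots> = A" unfolding A_def by (rule lebesgue_integral_eq_integral[OF H S, symmetric])
    finally show ?thesis by simp
  qed
  have "0 \<le> 2 + B + A" using bound[of 1] norm_ge_zero[of "h 1"] by linarith
  moreover have "AE x in half_line. norm (f x) \<le> 2 + B + A"
    using h(2) AE_space[of half_line] by eventually_elim (use bound in auto)
  ultimately show ?thesis by blast
qed

definition nonlin :: "real \<Rightarrow> complex \<Rightarrow> complex"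
  where "nonlin p z = of_real (norm z powr (p - 1)) * z"

definition sq_integral :: "(real \<Rightarrow> complex) \<Rightarrow> real"
  where "sq_integral f = (LINT x|half_line. (norm (f x))\<^sup>2)"

definition pow_integral :: "real \<Rightarrow> (real \<Rightarrow> complex) \<Rightarrow> real"
  where "pow_integral p f = (LINT x|half_line. norm (f x) powr (p + 1))"

lemma norm_powr_split: "norm z powr (p + 1) = norm z powr (p - 1) * (norm (z::complex))\<^sup>2"
proof (cases "z = 0")
  case False
  then have "norm z powr (p + 1) = norm z powr (p - 1) * norm z powr 2"
    by (subst powr_add[symmetric]) (simp add: add.commute)
  then show ?thesis by simp
qed simp

text \<open>This is the embedding into the spaces of higher exponent: for a bounded function the higher powers are
  dominated by the square.\<close>

lemma H1_data_powr_integrable: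
  assumes "H1_data f g c" "1 < p"
  shows "integrable half_line (\<lambda>x. norm (f x) powr (p + 1))"
    and "(\<lambda>x. nonlin p (f x)) \<in> Lq_half_line 2"
proof -
  obtain C where C: "0 \<le> C" "AE x in half_line. norm (f x) \<le> C"
    using H1_data_bounded[OF assms(1)] by blast
  have f: "f \<in> Lq_half_line 2" using assms by (auto simp: H1_data_def)
  note [measurable] = Lq_2_D(1)[OF f]
  show "integrable half_line (\<lambda>x. norm (f x) powr (p + 1))"
  proof (rule Bochner_Integration.integrable_bound)
    show "integrable half_line (\<lambda>x. C powr (p - 1) * (norm (f x))\<^sup>2)"
      using Lq_2_D(2)[OF f] by auto
    show "AE x in half_line. norm (norm (f x) powr (p + 1)) \<le> norm (C powr (p - 1) * (norm (f x))\<^sup>2)"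
      using C(2) by eventually_elim
        (use assms(2) in \<open>auto simp: norm_powr_split intro!: mult_right_mono powr_mono2\<close>)
  qed measurable
  show "(\<lambda>x. nonlin p (f x)) \<in> Lq_half_line 2"
    unfolding Lq_2_iff
  proof
    show m: "(\<lambda>x. nonlin p (f x)) \<in> borel_measurable half_line"
      unfolding nonlin_def by measurable
    show "integrable half_line (\<lambda>x. (norm (nonlin p (f x)))\<^sup>2)"
    proof (rule Bochner_Integration.integrable_bound)
      show "integrable half_line (\<lambda>x. (C powr (p - 1))\<^sup>2 * (norm (f x))\<^sup>2)"
        using Lq_2_D(2)[OF f] by auto
      show "AE x in half_line. norm ((norm (nonlin p (f x)))\<^sup>2) \<le> norm ((C powr (p - 1))\<^sup>2 * (norm (f x))\<^sup>2)"
        using C(2) by eventually_elim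
          (use assms(2) in \<open>auto simp: nonlin_def norm_mult power_mult_distrib
             intro!: mult_right_mono power_mono powr_mono2\<close>)
    qed (use m in measurable)
  qed
qed

section \<open>Variational characterisation of the minimizer\<close>

lemma graph_norm_2: "(graph_norm N 2 v)\<^sup>2 = (\<Sum>j=1..N. sq_integral (v j))"
proof -
  have "0 \<le> (\<Sum>j=1..N. sq_integral (v j))" by (intro sum_nonneg) (simp add: sq_integral_def)
  then show ?thesis
    by (simp add: graph_norm_def sq_integral_def powr_half_sqrt)
qed

lemma graph_norm_powr:
  assumes "0 < p" shows "graph_norm N (p + 1) v powr (p + 1) = (\<Sum>j=1..N. pow_integral p (v j))"
proof -
  have "0 \<le> (\<Sum>j=1..N. pow_integral p (v j))" by (intro sum_nonneg) (simp add: pow_integral_def)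
  then show ?thesis using assms by (simp add: graph_norm_def pow_integral_def powr_powr)
qed

text \<open>The family \<open>g\<close> collects the weak derivatives on the edges, the family \<open>c\<close> the boundary
  values at the vertex.\<close>

definition graph_data ::
  "nat \<Rightarrow> (nat \<Rightarrow> real \<Rightarrow> complex) \<Rightarrow> (nat \<Rightarrow> real \<Rightarrow> complex) \<Rightarrow> (nat \<Rightarrow> complex) \<Rightarrow> bool"
  where "graph_data N v g c \<longleftrightarrow> (\<forall>j\<in>{1..N}. H1_data (v j) (g j) (c j))"

text \<open>The quadratic part \<open>F(v) + \<omega> |v|\<^sup>2\<close> of the action, expressed through the data of \<open>v\<close>.  The Nehari
  constraint says that it equals \<open>pow_total\<close>, the total of the powers of exponent \<open>p + 1\<close>.\<close>

definition quad ::
  "nat \<Rightarrow> real \<Rightarrow> real \<Rightarrow> (nat \<Rightarrow> real \<Rightarrow> complex) \<Rightarrow> (nat \<Rightarrow> real \<Rightarrow> complex) \<Rightarrow> (nat \<Rightarrow> complex) \<Rightarrow> real"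
  where "quad N \<beta> \<omega> v g c =
    (\<Sum>j=1..N. sq_integral (g j) + \<omega> * sq_integral (v j)) + (1 / \<beta>) * (norm (\<Sum>j=1..N. c j))\<^sup>2"

definition pow_total :: "nat \<Rightarrow> real \<Rightarrow> (nat \<Rightarrow> real \<Rightarrow> complex) \<Rightarrow> real"
  where "pow_total N p v = (\<Sum>j=1..N. pow_integral p (v j))"

lemma pow_integral_nonneg: "0 \<le> pow_integral p f"
  by (simp add: pow_integral_def)

lemma sq_integral_cong_AE:
  assumes "f \<in> borel_measurable half_line" "AE x in half_line. f x = g x" "g \<in> borel_measurable half_line"
  shows "sq_integral f = sq_integral g"
  unfolding sq_integral_def
  by (rule integral_cong_AE) (use assms in \<open>auto elim: eventually_mono\<close>)

lemma sq_integral_weak_derivative: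
  assumes "H1_data f g c" shows "sq_integral (weak_derivative f) = sq_integral g"
proof -
  have gm: "g \<in> borel_measurable half_line" using assms Lq_2_D(1) by (auto simp: H1_data_def)
  have ae: "AE x in half_line. weak_derivative f x = g x" by (rule H1_data_weak_derivative[OF assms])
  have S: "{0::real<..} \<in> sets lebesgue" by simp
  have "AE x in lebesgue. (if x \<in> {0<..} then g x else 0) = (if x \<in> {0<..} then weak_derivative f x else 0)"
    using ae by (subst (asm) AE_restrict_space_iff) (auto elim: eventually_mono)
  then have "(\<lambda>x. if x \<in> {0<..} then weak_derivative f x else 0) \<in> borel_measurable lebesgue"
    by (rule borel_measurable_AE[OF borel_measurable_if_I[OF gm S]])
  then have "weak_derivative f \<in> borel_measurable half_line"
    by (rule borel_measurable_if_D)
  with gm ae show ?thesis by (intro sq_integral_cong_AE) auto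
qed

lemma F_beta_data:
  assumes "graph_data N v g c"
  shows "F_beta N \<beta> v + \<omega> * (graph_norm N 2 v)\<^sup>2 = quad N \<beta> \<omega> v g c"
proof -
  have "(\<Sum>j=1..N. trace_at_0 (v j)) = (\<Sum>j=1..N. c j)"
    by (intro sum.cong refl H1_data_trace) (use assms in \<open>auto simp: graph_data_def\<close>)
  moreover have "(\<Sum>j=1..N. sq_integral (weak_derivative (v j))) = (\<Sum>j=1..N. sq_integral (g j))"
    by (intro sum.cong refl sq_integral_weak_derivative) (use assms in \<open>auto simp: graph_data_def\<close>)
  ultimately show ?thesis
    unfolding F_beta_def graph_norm_2 quad_def by (simp add: sum.distrib sum_distrib_left)
qed

lemma I_omega_data:
  assumes "graph_data N v g c" "0 < p"
  shows "I_omega N p \<beta> \<omega> v = quad N \<beta> \<omega> v g c - pow_total N p v"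
  using F_beta_data[OF assms(1), of \<beta> \<omega>] graph_norm_powr[OF assms(2)]
  by (simp add: I_omega_def pow_total_def)

lemma S_omega_data:
  assumes "graph_data N v g c" "0 < p"
  shows "S_omega N p \<beta> \<omega> v = quad N \<beta> \<omega> v g c / 2 - pow_total N p v / (p + 1)"
  using F_beta_data[OF assms(1), of \<beta> \<omega>] graph_norm_powr[OF assms(2)]
  by (simp add: S_omega_def pow_total_def field_simps)

lemma H1_graph_data:
  assumes "v \<in> H1_graph N" shows "\<exists>g c. graph_data N v g c"
proof -
  have "\<forall>j\<in>{1..N}. \<exists>gc. H1_data (v j) (fst gc) (snd gc)"
    using assms H1_half_line_data unfolding H1_graph_def by fastforce
  then obtain gc where "\<forall>j\<in>{1..N}. H1_data (v j) (fst (gc j)) (snd (gc j))" by metis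
  then show ?thesis unfolding graph_data_def by (intro exI[of _ "\<lambda>j. fst (gc j)"] exI[of _ "\<lambda>j. snd (gc j)"]) auto
qed

lemma pow_total_eq_0_iff:
  assumes "graph_data N v g c" "1 < p"
  shows "pow_total N p v = 0 \<longleftrightarrow> graph_eq N v (\<lambda>j x. 0)"
proof -
  have "pow_total N p v = 0 \<longleftrightarrow> (\<forall>j\<in>{1..N}. pow_integral p (v j) = 0)"
    unfolding pow_total_def by (intro sum_nonneg_eq_0_iff) (auto simp: pow_integral_nonneg)
  also have "\<dots> \<longleftrightarrow> (\<forall>j\<in>{1..N}. AE x in half_line. v j x = 0)"
  proof (intro ball_cong refl)
    fix j assume "j \<in> {1..N}"
    then have "H1_data (v j) (g j) (c j)" using assms by (auto simp: graph_data_def)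
    from H1_data_powr_integrable(1)[OF this assms(2)]
    show "pow_integral p (v j) = 0 \<longleftrightarrow> (AE x in half_line. v j x = 0)"
      unfolding pow_integral_def using assms(2)
      by (subst integral_nonneg_eq_0_iff_AE) auto
  qed
  finally show ?thesis by (simp add: graph_eq_def)
qed

lemma graph_data_scale:
  assumes "graph_data N v g c"
  shows "graph_data N (\<lambda>j x. z * v j x) (\<lambda>j x. z * g j x) (\<lambda>j. z * c j)"
  using assms by (auto simp: graph_data_def intro: H1_data_scale)

lemma sq_integral_scale: "sq_integral (\<lambda>x. z * f x) = (norm z)\<^sup>2 * sq_integral f"
  by (simp add: sq_integral_def norm_mult power_mult_distrib)

lemma pow_integral_scale: "pow_integral p (\<lambda>x. z * f x) = norm z powr (p + 1) * pow_integral p f"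
  by (simp add: pow_integral_def norm_mult powr_mult)

lemma quad_scale:
  "quad N \<beta> \<omega> (\<lambda>j x. z * v j x) (\<lambda>j x. z * g j x) (\<lambda>j. z * c j) = (norm z)\<^sup>2 * quad N \<beta> \<omega> v g c"
  unfolding quad_def sq_integral_scale sum_distrib_left[symmetric] norm_mult power_mult_distrib
  by (simp add: algebra_simps sum_distrib_left sum.distrib)

lemma powr_complementary_exponents:
  assumes "0 < n" "1 < p"
  shows "n powr ((p - 1) / (p + 1)) * n powr (2 / (p + 1)) = (n::real)"
  using assms by (simp add: powr_add[symmetric] add_divide_distrib[symmetric] add.commute)

text \<open>On the Nehari set the action is a positive multiple of \<open>pow_total\<close>.  Every \<open>v\<close> with positive
  quadratic part has a positive multiple \<open>l v\<close> in the Nehari set, and minimality at that multiple is a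
  homogeneous inequality in \<open>v\<close>.  In this form the constraint has disappeared, so arbitrary perturbations of the
  minimizer are admissible.\<close>

lemma minimizer_inequality:
  assumes "is_minimizer N p \<beta> \<omega> u" "1 < p" and u: "graph_data N u gu cu"
  shows "quad N \<beta> \<omega> u gu cu = pow_total N p u" "0 < pow_total N p u"
    and "\<And>v g c. graph_data N v g c \<Longrightarrow> 0 < pow_total N p v \<Longrightarrow> 0 < quad N \<beta> \<omega> v g c \<Longrightarrow>
      pow_total N p u powr ((p - 1) / (p + 1)) * pow_total N p v powr (2 / (p + 1)) \<le> quad N \<beta> \<omega> v g c"
proof -
  have p: "0 < p" using \<open>1 < p\<close> by simp
  have un: "u \<in> nehari_set N p \<beta> \<omega>" and ud: "S_omega N p \<beta> \<omega> u = d_omega N p \<beta> \<omega>"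
    using assms(1) by (auto simp: is_minimizer_def)
  have val: "S_omega N p \<beta> \<omega> v = (1 / 2 - 1 / (p + 1)) * pow_total N p v"
    if "graph_data N v g c" "I_omega N p \<beta> \<omega> v = 0" for v g c
    using that I_omega_data[OF that(1) p, of \<beta> \<omega>] S_omega_data[OF that(1) p, of \<beta> \<omega>]
    by (simp add: algebra_simps)
  have pos: "0 \<le> pow_total N p v" for v
    unfolding pow_total_def by (intro sum_nonneg) (auto simp: pow_integral_nonneg)
  have k: "0 < 1 / 2 - 1 / (p + 1)" using \<open>1 < p\<close> by (simp add: field_simps)
  have "bdd_below (S_omega N p \<beta> \<omega> ` nehari_set N p \<beta> \<omega>)"
  proof (rule bdd_belowI2)
    fix v assume "v \<in> nehari_set N p \<beta> \<omega>"
    then have "v \<in> H1_graph N" and I: "I_omega N p \<beta> \<omega> v = 0" by (auto simp: nehari_set_def)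
    then obtain g c where "graph_data N v g c" using H1_graph_data by blast
    from val[OF this I] show "0 \<le> S_omega N p \<beta> \<omega> v" using k pos by simp
  qed
  then have least: "S_omega N p \<beta> \<omega> u \<le> S_omega N p \<beta> \<omega> v" if "v \<in> nehari_set N p \<beta> \<omega>" for v
    unfolding ud d_omega_def using that by (rule cINF_lower)
  have Iu: "I_omega N p \<beta> \<omega> u = 0" and une: "\<not> graph_eq N u (\<lambda>j x. 0)"
    using un by (auto simp: nehari_set_def)
  show "quad N \<beta> \<omega> u gu cu = pow_total N p u" using Iu I_omega_data[OF u p, of \<beta> \<omega>] by simp
  show n0: "0 < pow_total N p u"
    using une pow_total_eq_0_iff[OF u \<open>1 < p\<close>] pos[of u] by linarith
  fix v g c
  assume v: "graph_data N v g c" and n: "0 < pow_total N p v" and q: "0 < quad N \<beta> \<omega> v g c"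
  define Q where "Q = quad N \<beta> \<omega> v g c"
  define n where "n = pow_total N p v"
  \<comment> \<open>The condition \<open>l\<^sup>2 Q = l\<^sup>p\<^sup>+\<^sup>1 n\<close> of the Nehari set determines the factor.\<close>
  define l where "l = (Q / n) powr (1 / (p - 1))"
  have Qn: "0 < Q" "0 < n" using q n by (auto simp: Q_def n_def)
  then have l: "0 < l" by (simp add: l_def)
  have "l powr (p - 1) = Q / n" using Qn \<open>1 < p\<close> by (simp add: l_def powr_powr)
  then have lp: "l powr (p + 1) * n = l\<^sup>2 * Q"
    using powr_add[of l "p - 1" 2] l Qn by (simp add: add.commute mult.commute)
  let ?w = "\<lambda>j x. complex_of_real l * v j x"
  note w = graph_data_scale[OF v, of "complex_of_real l"]
  have nw: "pow_total N p ?w = l\<^sup>2 * Q"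
    using l lp by (simp add: pow_total_def pow_integral_scale n_def sum_distrib_left)
  have Iw: "I_omega N p \<beta> \<omega> ?w = 0"
    using l by (simp add: I_omega_data[OF w p] quad_scale nw Q_def)
  have "\<not> graph_eq N ?w (\<lambda>j x. 0)"
    using pow_total_eq_0_iff[OF w \<open>1 < p\<close>] nw l Qn by simp
  moreover have "?w \<in> H1_graph N"
    using w H1_data_H1_half_line by (fastforce simp: H1_graph_def graph_data_def)
  ultimately have "?w \<in> nehari_set N p \<beta> \<omega>" using Iw by (simp add: nehari_set_def)
  from least[OF this] have "pow_total N p u \<le> l\<^sup>2 * Q"
    using val[OF w Iw] val[OF u Iu] k nw by simp
  then have "pow_total N p u powr ((p - 1) / (p + 1)) \<le> (l\<^sup>2 * Q) powr ((p - 1) / (p + 1))"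
    using n0 \<open>1 < p\<close> by (intro powr_mono2) auto
  also have "\<dots> = (l powr (p + 1) * n) powr ((p - 1) / (p + 1))" by (simp only: lp)
  also have "\<dots> = l powr (p - 1) * n powr ((p - 1) / (p + 1))"
    using \<open>1 < p\<close> by (simp add: powr_mult powr_powr)
  also have "\<dots> = Q / n * n powr ((p - 1) / (p + 1))" by (simp add: \<open>l powr (p - 1) = Q / n\<close>)
  finally have "pow_total N p u powr ((p - 1) / (p + 1)) \<le> Q / n * n powr ((p - 1) / (p + 1))" .
  from mult_right_mono[OF this, of "n powr (2 / (p + 1))"]
  have "pow_total N p u powr ((p - 1) / (p + 1)) * n powr (2 / (p + 1))
      \<le> Q / n * (n powr ((p - 1) / (p + 1)) * n powr (2 / (p + 1)))"
    by (simp only: mult.assoc powr_ge_zero)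
  also have "n powr ((p - 1) / (p + 1)) * n powr (2 / (p + 1)) = n"
    by (rule powr_complementary_exponents[OF Qn(2) \<open>1 < p\<close>])
  finally show "pow_total N p u powr ((p - 1) / (p + 1)) * pow_total N p v powr (2 / (p + 1)) \<le> quad N \<beta> \<omega> v g c"
    using Qn by (simp add: Q_def n_def)
qed

section \<open>The Euler-Lagrange equation\<close>

text \<open>Convexity of the power, in the form of Young's inequality for \<open>a\<^sup>q\<^sup>-\<^sup>1 b\<close>.\<close>

lemma powr_above_tangent:
  assumes "1 < q" "0 \<le> a" "0 \<le> b"
  shows "a powr q + q * a powr (q - 1) * (b - a) \<le> b powr (q::real)"
proof -
  let ?r = "q / (q - 1)"
  have "a powr (q - 1) * b \<le> (a powr (q - 1)) powr ?r / ?r + b powr q / q"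
    by (rule Youngs_inequality) (use assms in \<open>auto simp: field_simps\<close>)
  moreover have "(a powr (q - 1)) powr ?r = a powr q" using assms by (simp add: powr_powr)
  ultimately have "q * (a powr (q - 1) * b) \<le> (q - 1) * a powr q + b powr q"
    using assms by (simp add: field_simps)
  moreover have "a powr (q - 1) * a = a powr q"
    using assms powr_add[of a "q - 1" 1] by (cases "a = 0") auto
  ultimately show ?thesis by (simp add: algebra_simps)
qed

text \<open>The tangent inequality for the modulus combines with the Cauchy-Schwarz inequality for the real inner
  product of \<open>z\<close> and \<open>z + h\<close>.\<close>

lemma norm_powr_above_tangent:
  assumes "1 < p"
  shows "norm z powr (p + 1) + (p + 1) * Re (cnj (nonlin p z) * h) \<le> norm (z + h) powr (p + 1)"
proof -
  let ?a = "norm z" and ?b = "norm (z + h)"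
  have "Re (cnj z * (z + h)) \<le> ?a * ?b"
    using complex_Re_le_cmod[of "cnj z * (z + h)"] by (simp add: norm_mult)
  then have "Re (cnj z * h) \<le> ?a * (?b - ?a)"
    by (simp add: algebra_simps cmod_def power2_eq_square[symmetric])
  then have "?a powr (p - 1) * Re (cnj z * h) \<le> ?a powr (p - 1) * (?a * (?b - ?a))"
    by (rule mult_left_mono) simp
  also have "\<dots> = ?a powr p * (?b - ?a)"
    using powr_add[of ?a "p - 1" 1] by (cases "z = 0") (auto simp: mult.assoc)
  finally have t1: "(p + 1) * (?a powr (p - 1) * Re (cnj z * h)) \<le> (p + 1) * (?a powr p * (?b - ?a))"
    using assms by (intro mult_left_mono) auto
  have t2: "Re (cnj (nonlin p z) * h) = ?a powr (p - 1) * Re (cnj z * h)"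
    by (simp add: nonlin_def algebra_simps)
  have t3: "?a powr (p + 1) + (p + 1) * (?a powr p * (?b - ?a)) \<le> ?b powr (p + 1)"
    using powr_above_tangent[of "p + 1" ?a ?b] assms by (simp add: mult.assoc)
  show ?thesis unfolding t2 by (rule order_trans[OF add_left_mono[OF t1] t3])
qed

definition pairing :: "(real \<Rightarrow> complex) \<Rightarrow> (real \<Rightarrow> complex) \<Rightarrow> complex"
  where "pairing f g = (LINT x|half_line. cnj (f x) * g x)"

lemma sq_integral_add:
  assumes f: "f \<in> Lq_half_line 2" and g: "g \<in> Lq_half_line 2"
  shows "sq_integral (\<lambda>x. f x + of_real s * g x)
    = sq_integral f + 2 * s * Re (pairing f g) + s\<^sup>2 * sq_integral g"
proof -
  have "(norm (a + of_real s * b))\<^sup>2 = (norm a)\<^sup>2 + 2 * s * Re (cnj a * b) + s\<^sup>2 * (norm b)\<^sup>2" for a b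
    unfolding cmod_power2 by (simp add: power2_eq_square algebra_simps)
  moreover have "integrable half_line (\<lambda>x. Re (cnj (f x) * g x))"
    using integrable_Lq_2_mult[OF f g] by (rule integrable_Re)
  ultimately show ?thesis
    unfolding sq_integral_def pairing_def
    using Lq_2_D(2)[OF f] Lq_2_D(2)[OF g] integral_Re[OF integrable_Lq_2_mult[OF f g]]
    by simp
qed

lemma pow_integral_above_tangent:
  assumes "H1_data f f' c" "H1_data g g' d" "1 < p"
  shows "pow_integral p f + s * ((p + 1) * Re (pairing (\<lambda>x. nonlin p (f x)) g))
    \<le> pow_integral p (\<lambda>x. f x + of_real s * g x)"
proof -
  have g: "g \<in> Lq_half_line 2" using assms by (simp add: H1_data_def)
  note i = integrable_Lq_2_mult[OF H1_data_powr_integrable(2)[OF assms(1,3)] g]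
  note ir = integrable_Re[OF i]
  have "norm (f x) powr (p + 1) + (s * (p + 1)) * Re (cnj (nonlin p (f x)) * g x)
      \<le> norm (f x + of_real s * g x) powr (p + 1)" for x
  proof -
    have "Re (cnj (nonlin p (f x)) * (of_real s * g x)) = s * Re (cnj (nonlin p (f x)) * g x)"
      by (simp add: algebra_simps)
    with norm_powr_above_tangent[OF assms(3), of "f x" "of_real s * g x"] show ?thesis
      by (simp only: mult.assoc mult.left_commute)
  qed
  then have "(LINT x|half_line. norm (f x) powr (p + 1) + (s * (p + 1)) * Re (cnj (nonlin p (f x)) * g x))
      \<le> pow_integral p (\<lambda>x. f x + of_real s * g x)"
    unfolding pow_integral_def
    by (intro integral_mono H1_data_powr_integrable[OF H1_data_add[OF assms(1,2)] assms(3)]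
        Bochner_Integration.integrable_add integrable_mult_right H1_data_powr_integrable[OF assms(1,3)] ir)
  also have "(LINT x|half_line. norm (f x) powr (p + 1) + (s * (p + 1)) * Re (cnj (nonlin p (f x)) * g x))
    = pow_integral p f + (s * (p + 1)) * (LINT x|half_line. Re (cnj (nonlin p (f x)) * g x))"
    unfolding pow_integral_def
    by (subst Bochner_Integration.integral_add)
      (auto intro!: H1_data_powr_integrable[OF assms(1,3)] integrable_mult_right ir simp del: times_complex.sel)
  finally show ?thesis
    unfolding pairing_def integral_Re[OF i] by (simp only: mult.assoc)
qed

lemma sum_fun_upd:
  fixes F :: "'b \<Rightarrow> 'c::ab_group_add"
  assumes "finite A" "j \<in> A"
  shows "(\<Sum>i\<in>A. F ((u(j := y)) i)) = (\<Sum>i\<in>A. F (u i)) + (F y - F (u j))"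
proof -
  have "(\<Sum>i\<in>A - {j}. F ((u(j := y)) i)) = (\<Sum>i\<in>A - {j}. F (u i))" by (intro sum.cong) auto
  then show ?thesis using assms by (simp add: sum.remove[of A j])
qed

lemma graph_data_upd:
  assumes "graph_data N u g c" "H1_data v g' c'"
  shows "graph_data N (u(j := v)) (g(j := g')) (c(j := c'))"
  using assms by (auto simp: graph_data_def)

lemma pow_total_upd:
  assumes "j \<in> {1..N}"
  shows "pow_total N p (u(j := v)) = pow_total N p u + (pow_integral p v - pow_integral p (u j))"
  unfolding pow_total_def using sum_fun_upd[of "{1..N}" j "pow_integral p" u v] assms by simp

lemma quad_upd:
  assumes "j \<in> {1..N}"
  shows "quad N \<beta> \<omega> (u(j := v)) (g(j := g')) (c(j := d)) = quad N \<beta> \<omega> u g c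
    + (sq_integral g' + \<omega> * sq_integral v - sq_integral (g j) - \<omega> * sq_integral (u j))
    + (1 / \<beta>) * ((norm ((\<Sum>i=1..N. c i) + (d - c j)))\<^sup>2 - (norm (\<Sum>i=1..N. c i))\<^sup>2)"
proof -
  have e1: "(\<Sum>i=1..N. (c(j := d)) i) = (\<Sum>i=1..N. c i) + (d - c j)"
    using sum_fun_upd[of "{1..N}" j "\<lambda>z. z" c d] assms by simp
  have e2: "(\<Sum>i=1..N. sq_integral ((g(j := g')) i)) = (\<Sum>i=1..N. sq_integral (g i)) + (sq_integral g' - sq_integral (g j))"
    using sum_fun_upd[of "{1..N}" j sq_integral g g'] assms by simp
  have e3: "(\<Sum>i=1..N. sq_integral ((u(j := v)) i)) = (\<Sum>i=1..N. sq_integral (u i)) + (sq_integral v - sq_integral (u j))"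
    using sum_fun_upd[of "{1..N}" j sq_integral u v] assms by simp
  show ?thesis
    unfolding quad_def sum.distrib sum_distrib_left[symmetric] e1 e2 e3
    by (simp add: algebra_simps)
qed

text \<open>The nonlinear term is not differentiated: by convexity it lies above its tangent, and the
  minimality inequality bounds it from above.  Replacing it by the tangent therefore gives a function of \<open>s\<close>
  that is nonnegative near 0, vanishes at 0, and is visibly differentiable.\<close>

lemma minimizer_first_variation:
  assumes min: "is_minimizer N p \<beta> \<omega> u" and p: "1 < p" and u: "graph_data N u g c"
    and j: "j \<in> {1..N}" and w: "H1_data w w' d"
  shows "Re (pairing (g j) w' + of_real \<omega> * pairing (u j) w - pairing (\<lambda>x. nonlin p (u j x)) w
    + of_real (1 / \<beta>) * (cnj (\<Sum>i=1..N. c i) * d)) = 0"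
proof -
  define B where "B = (\<Sum>i=1..N. c i)"
  define n0 where "n0 = pow_total N p u"
  define L where "L = Re (pairing (\<lambda>x. nonlin p (u j x)) w)"
  define A where "A = Re (pairing (g j) w') + \<omega> * Re (pairing (u j) w) + (1 / \<beta>) * Re (cnj B * d)"
  define q where "q = sq_integral w' + \<omega> * sq_integral w + (1 / \<beta>) * (norm d)\<^sup>2"
  define \<mu> where "\<mu> = n0 powr ((p - 1) / (p + 1))"
  note m = minimizer_inequality[OF min p u]
  have n0: "0 < n0" "quad N \<beta> \<omega> u g c = n0" using m by (auto simp: n0_def)
  have uj: "H1_data (u j) (g j) (c j)" using u j by (auto simp: graph_data_def)
  then have L2: "u j \<in> Lq_half_line 2" "g j \<in> Lq_half_line 2" "w \<in> Lq_half_line 2" "w' \<in> Lq_half_line 2"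
    using w by (auto simp: H1_data_def)
  define \<psi> where "\<psi> s = n0 + 2 * s * A + s\<^sup>2 * q - \<mu> * (n0 + s * ((p + 1) * L)) powr (2 / (p + 1))" for s
  define v where "v s = u(j := \<lambda>x. u j x + of_real s * w x)" for s
  define gv where "gv s = g(j := \<lambda>x. g j x + of_real s * w' x)" for s
  define cv where "cv s = c(j := c j + of_real s * d)" for s
  have data: "graph_data N (v s) (gv s) (cv s)" for s
    unfolding v_def gv_def cv_def by (intro graph_data_upd u H1_data_add uj w)
  have quad: "quad N \<beta> \<omega> (v s) (gv s) (cv s) = n0 + 2 * s * A + s\<^sup>2 * q" for s
  proof -
    have "(norm (B + of_real s * d))\<^sup>2 = (norm B)\<^sup>2 + 2 * s * Re (cnj B * d) + s\<^sup>2 * (norm d)\<^sup>2"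
      unfolding cmod_power2 by (simp add: power2_eq_square algebra_simps)
    then show ?thesis
      unfolding v_def gv_def cv_def quad_upd[OF j] n0(2) B_def[symmetric]
        sq_integral_add[OF L2(1,3)] sq_integral_add[OF L2(2,4)] A_def q_def
      by (simp add: algebra_simps)
  qed
  have pow: "n0 + s * ((p + 1) * L) \<le> pow_total N p (v s)" for s
    using pow_integral_above_tangent[OF uj w p, of s]
    unfolding v_def pow_total_upd[OF j] n0_def[symmetric] L_def by simp
  have c1: "((\<lambda>s. n0 + 2 * s * A + s\<^sup>2 * q) \<longlongrightarrow> n0 + 2 * 0 * A + 0\<^sup>2 * q) (at 0)"
    by (intro tendsto_intros)
  have c2: "((\<lambda>s. n0 + s * ((p + 1) * L)) \<longlongrightarrow> n0 + 0 * ((p + 1) * L)) (at 0)"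
    by (intro tendsto_intros)
  have "\<forall>\<^sub>F s in at 0. 0 < n0 + 2 * s * A + s\<^sup>2 * q \<and> 0 < n0 + s * ((p + 1) * L)"
    using order_tendstoD(1)[OF c1, of 0] order_tendstoD(1)[OF c2, of 0] n0(1)
    by (intro eventually_conj) auto
  then obtain e where e: "0 < e" "\<And>s. s \<noteq> 0 \<Longrightarrow> \<bar>s\<bar> < e \<Longrightarrow> 0 < n0 + 2 * s * A + s\<^sup>2 * q \<and> 0 < n0 + s * ((p + 1) * L)"
    unfolding eventually_at by (auto simp: dist_real_def)
  have zero: "\<psi> 0 = 0"
    using powr_complementary_exponents[OF n0(1) p] by (simp add: \<psi>_def \<mu>_def)
  have nonneg: "0 \<le> \<psi> s" if "\<bar>s\<bar> < e" for s
  proof (cases "s = 0")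
    case False
    note e' = e(2)[OF False that]
    have "0 < pow_total N p (v s)" using e' pow[of s] by linarith
    from m(3)[OF data this] e' have "\<mu> * pow_total N p (v s) powr (2 / (p + 1)) \<le> n0 + 2 * s * A + s\<^sup>2 * q"
      by (simp add: quad \<mu>_def n0_def)
    moreover have "\<mu> * (n0 + s * ((p + 1) * L)) powr (2 / (p + 1)) \<le> \<mu> * pow_total N p (v s) powr (2 / (p + 1))"
      using e' pow[of s] p by (intro mult_left_mono powr_mono2) (auto simp: \<mu>_def)
    ultimately show ?thesis by (simp add: \<psi>_def)
  qed (simp add: zero)
  have "(\<psi> has_real_derivative 2 * A - \<mu> * ((2 / (p + 1)) * n0 powr (2 / (p + 1) - 1) * ((p + 1) * L))) (at 0)"
    unfolding \<psi>_def using n0(1) by (auto intro!: derivative_eq_intros simp: field_simps)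
  then have "2 * A - \<mu> * ((2 / (p + 1)) * n0 powr (2 / (p + 1) - 1) * ((p + 1) * L)) = 0"
    by (rule DERIV_local_min[OF _ e(1)]) (use nonneg zero in auto)
  moreover have "\<mu> * n0 powr (2 / (p + 1) - 1) = 1"
  proof -
    have "(p - 1) / (p + 1) + (2 / (p + 1) - 1) = 0" using p by (simp add: field_simps)
    then show ?thesis unfolding \<mu>_def powr_add[symmetric] using n0(1) by simp
  qed
  moreover have "\<mu> * ((2 / (p + 1)) * n0 powr (2 / (p + 1) - 1) * ((p + 1) * L))
      = (\<mu> * n0 powr (2 / (p + 1) - 1)) * (2 * L)"
    using p by simp
  ultimately have "A = L" by simp
  then show ?thesis by (simp add: A_def L_def B_def)
qed

lemma pairing_ii: "pairing f (\<lambda>x. \<i> * g x) = \<i> * pairing f g"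
  unfolding pairing_def by (simp add: mult.left_commute)

text \<open>Testing with \<open>w\<close> and with \<open>\<i> w\<close> gives the real and the imaginary part of the equation.\<close>

lemma minimizer_euler_lagrange:
  assumes "is_minimizer N p \<beta> \<omega> u" "1 < p" "graph_data N u g c" "j \<in> {1..N}" and w: "H1_data w w' d"
  shows "pairing (g j) w' + of_real \<omega> * pairing (u j) w - pairing (\<lambda>x. nonlin p (u j x)) w
    + of_real (1 / \<beta>) * (cnj (\<Sum>i=1..N. c i) * d) = 0"
proof -
  note fv = minimizer_first_variation[OF assms(1-4)]
  let ?E = "pairing (g j) w' + of_real \<omega> * pairing (u j) w - pairing (\<lambda>x. nonlin p (u j x)) w
    + of_real (1 / \<beta>) * (cnj (\<Sum>i=1..N. c i) * d)"
  have "Re (\<i> * ?E) = 0"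
    using fv[OF H1_data_scale[OF w, of \<i>]] unfolding pairing_ii by (simp add: algebra_simps)
  moreover have "Re ?E = 0" by (rule fv[OF w])
  ultimately show ?thesis by (simp add: complex_eq_iff)
qed

lemma test_function_Lq_2:
  assumes "continuous_on UNIV \<phi>" "0 < a" "\<And>x. x \<notin> {a..b} \<Longrightarrow> \<phi> x = 0"
  shows "(\<lambda>x. complex_of_real (\<phi> x)) \<in> Lq_half_line 2"
proof -
  have li: "locally_integrable (\<lambda>x. of_real (\<phi> x))"
    unfolding locally_integrable_def
    by (auto intro!: absolutely_integrable_continuous_real continuous_intros continuous_on_subset[OF assms(1)])
  have "integrable half_line (\<lambda>x. complex_of_real (\<phi> x) * of_real (\<phi> x))"
    by (rule integrable_half_line_compact_support[OF li assms])
  then have "integrable half_line (\<lambda>x. Re (complex_of_real (\<phi> x) * of_real (\<phi> x)))"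
    by (rule integrable_Re)
  then show ?thesis
    unfolding Lq_2_iff using assms(1)
    by (auto simp: power2_eq_square intro!: borel_measurable_half_line borel_measurable_continuous_onI continuous_intros)
qed

lemma H1_data_test_function:
  assumes \<psi>: "test_function \<psi>"
  shows "H1_data (\<lambda>x. of_real (\<psi> x)) (\<lambda>x. of_real (deriv \<psi> x)) 0"
proof -
  obtain a b where ab: "0 < a" "a < b" "\<And>x. x \<notin> {a<..<b} \<Longrightarrow> \<psi> x = 0"
      "\<And>x. x \<notin> {a<..<b} \<Longrightarrow> deriv \<psi> x = 0"
    using test_function_support[OF \<psi>] by metis
  have c: "continuous_on UNIV \<psi>" "continuous_on UNIV (deriv \<psi>)"
    using test_function_DERIV(2,3)[OF \<psi>] continuous_at_imp_continuous_on by blast+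
  have "H1_data (\<lambda>x. of_real (\<psi> x)) (\<lambda>x. of_real (deriv \<psi> x)) (of_real (\<psi> 0))"
  proof (rule H1_data_smooth)
    show "((\<lambda>x. complex_of_real (\<psi> x)) has_vector_derivative of_real (deriv \<psi> x)) (at x)" for x
      by (rule has_vector_derivative_of_real[OF test_function_DERIV(1)[OF \<psi>]])
    show "(\<lambda>x. complex_of_real (\<psi> x)) \<in> Lq_half_line 2"
      by (rule test_function_Lq_2[OF c(1) ab(1), of b]) (use ab(3) in auto)
    show "(\<lambda>x. complex_of_real (deriv \<psi> x)) \<in> Lq_half_line 2"
      by (rule test_function_Lq_2[OF c(2) ab(1), of b]) (use ab(4) in auto)
  qed (intro continuous_intros c)
  moreover have "\<psi> 0 = 0" using ab(1) ab(3)[of 0] by auto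
  ultimately show ?thesis by simp
qed

lemma Lq_2_locally_integrable:
  assumes g: "g \<in> Lq_half_line 2" shows "locally_integrable g"
  unfolding locally_integrable_def
proof (intro allI impI)
  fix a b :: real assume "0 < a"
  show "set_integrable lebesgue {a..b} g"
  proof (rule measurable_bounded_by_integrable_imp_absolutely_integrable)
    have "g \<in> borel_measurable (restrict_space half_line {a..b})"
      by (rule measurable_restrict_space1[OF Lq_2_D(1)[OF g]])
    moreover have "{0<..} \<inter> {a..b} = {a..b}" using \<open>0 < a\<close> by auto
    ultimately show "g \<in> borel_measurable (lebesgue_on {a..b})"
      by (simp add: restrict_restrict_space)
    show "(\<lambda>t. 1 + (norm (g t))\<^sup>2) integrable_on {a..b}"
      by (intro Henstock_Kurzweil_Integration.integrable_add
          integrable_on_subinterval[OF integrable_on_lebesgue_on[OF Lq_2_D(2)[OF g]]])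
        (use \<open>0 < a\<close> in auto)
    show "norm (g x) \<le> 1 + (norm (g x))\<^sup>2" for x by (rule norm_le_one_plus_square)
  qed simp
qed

text \<open>Real test functions vanish at the vertex, so only the edge terms of the Euler-Lagrange equation
  remain.  They state that the weak derivative \<open>u'\<close> has itself a weak derivative.\<close>

lemma minimizer_weak_equation:
  assumes min: "is_minimizer N p \<beta> \<omega> u" and p: "1 < p" and u: "graph_data N u g c" and j: "j \<in> {1..N}"
  shows "has_weak_derivative (g j) (\<lambda>x. of_real \<omega> * u j x - nonlin p (u j x))"
  unfolding has_weak_derivative_iff
proof (intro conjI allI impI)
  have uj: "H1_data (u j) (g j) (c j)" using u j by (auto simp: graph_data_def)
  then have L2: "u j \<in> Lq_half_line 2" "g j \<in> Lq_half_line 2" by (auto simp: H1_data_def)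
  note nl = H1_data_powr_integrable(2)[OF uj p]
  have rhs: "(\<lambda>x. of_real \<omega> * u j x - nonlin p (u j x)) \<in> Lq_half_line 2"
    using Lq_2_add[OF Lq_2_scale[OF L2(1), of "of_real \<omega>"] nl, of "-1"] by simp
  show "locally_integrable (g j)" "locally_integrable (\<lambda>x. of_real \<omega> * u j x - nonlin p (u j x))"
    by (rule Lq_2_locally_integrable[OF L2(2)], rule Lq_2_locally_integrable[OF rhs])
  fix \<psi> assume \<psi>: "test_function \<psi>"
  have pr: "pairing f (\<lambda>x. of_real (\<phi> x)) = cnj (LINT x|half_line. f x * of_real (\<phi> x))" for f and \<phi> :: "real \<Rightarrow> real"
    unfolding pairing_def by (simp flip: Bochner_Integration.integral_cnj)
  note eq = minimizer_euler_lagrange[OF min p u j H1_data_test_function[OF \<psi>], unfolded pr]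
  have "cnj ((LINT x|half_line. g j x * of_real (deriv \<psi> x)) + of_real \<omega> * (LINT x|half_line. u j x * of_real (\<psi> x))
      - (LINT x|half_line. nonlin p (u j x) * of_real (\<psi> x))) = 0"
    using eq by simp
  then have e0: "(LINT x|half_line. g j x * of_real (deriv \<psi> x)) + of_real \<omega> * (LINT x|half_line. u j x * of_real (\<psi> x))
      - (LINT x|half_line. nonlin p (u j x) * of_real (\<psi> x)) = 0"
    by (simp only: complex_cnj_zero_iff)
  have R: "(LINT x|half_line. (of_real \<omega> * u j x - nonlin p (u j x)) * of_real (\<psi> x))
      = of_real \<omega> * (LINT x|half_line. u j x * of_real (\<psi> x)) - (LINT x|half_line. nonlin p (u j x) * of_real (\<psi> x))"
    using integrable_test_function(1)[OF Lq_2_locally_integrable[OF L2(1)] \<psi>]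
      integrable_test_function(1)[OF Lq_2_locally_integrable[OF nl] \<psi>]
    by (simp add: left_diff_distrib mult.assoc)
  show "(LINT x|half_line. g j x * of_real (deriv \<psi> x))
      = - (LINT x|half_line. (of_real \<omega> * u j x - nonlin p (u j x)) * of_real (\<psi> x))"
    unfolding R using e0 by (simp only: add_diff_eq[symmetric] eq_neg_iff_add_eq_0)
qed

section \<open>Solitons\<close>

definition rate :: "real \<Rightarrow> real \<Rightarrow> real"
  where "rate p \<omega> = (p - 1) * sqrt \<omega> / 2"

text \<open>The derivative of the soliton.\<close>

definition dphi :: "real \<Rightarrow> real \<Rightarrow> real \<Rightarrow> real \<Rightarrow> real"
  where "dphi p \<omega> a x = - (sqrt \<omega> * tanh (rate p \<omega> * (x + a)) * phi p \<omega> a x)"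

lemma phi_shift: "phi p \<omega> a x = phi p \<omega> 0 (x + a)" "dphi p \<omega> a x = dphi p \<omega> 0 (x + a)"
  by (simp_all add: phi_def dphi_def)

lemma phi_cosh:
  assumes "1 < p" "0 < \<omega>"
  shows "phi p \<omega> a x = ((p + 1) * \<omega> / 2) powr (1 / (p - 1)) * cosh (rate p \<omega> * (x + a)) powr (- 2 / (p - 1))"
proof -
  have "((1 / cosh y)\<^sup>2) powr (1 / (p - 1)) = cosh y powr (- 2 / (p - 1))" for y :: real
  proof -
    have "(1 / cosh y)\<^sup>2 = cosh y powr (-2)"
      by (simp add: powr_minus power_divide divide_inverse power_inverse)
    then show ?thesis by (simp add: powr_powr)
  qed
  note sq = this
  have "phi p \<omega> a x = ((p + 1) * \<omega> / 2) powr (1 / (p - 1)) * ((sech (rate p \<omega> * (x + a)))\<^sup>2) powr (1 / (p - 1))"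
    unfolding phi_def rate_def by (rule powr_mult)
  then show ?thesis unfolding sech_def sq .
qed

lemma phi_pos: "1 < p \<Longrightarrow> 0 < \<omega> \<Longrightarrow> 0 < phi p \<omega> a x"
  by (simp add: phi_cosh)

lemma sech_sq: "(sech y)\<^sup>2 = 1 - (tanh y)\<^sup>2"
proof -
  have "1 - (tanh y)\<^sup>2 = ((cosh y)\<^sup>2 - (sinh y)\<^sup>2) / (cosh y)\<^sup>2"
    by (simp add: tanh_def power_divide diff_divide_distrib)
  also have "(cosh y)\<^sup>2 - (sinh y)\<^sup>2 = 1" by (simp add: cosh_square_eq)
  finally show ?thesis by (simp only: sech_def power_divide power_one)
qed

lemma phi_powr:
  assumes "1 < p" "0 < \<omega>"
  shows "phi p \<omega> a x powr (p - 1) = (p + 1) * \<omega> / 2 * (1 - (tanh (rate p \<omega> * (x + a)))\<^sup>2)"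
proof -
  have "0 \<le> (p + 1) * \<omega> / 2 * (sech (rate p \<omega> * (x + a)))\<^sup>2" using assms by simp
  then show ?thesis
    using assms by (simp add: phi_def powr_powr rate_def sech_sq)
qed

lemma phi_powr_p:
  assumes "1 < p" "0 < \<omega>"
  shows "phi p \<omega> a x powr p = phi p \<omega> a x powr (p - 1) * phi p \<omega> a x"
    and "phi p \<omega> a x powr (p + 1) = phi p \<omega> a x powr (p - 1) * (phi p \<omega> a x)\<^sup>2"
  using phi_pos[OF assms, of a x] powr_add[of "phi p \<omega> a x" "p - 1" 1] powr_add[of "phi p \<omega> a x" "p - 1" 2]
  by (simp_all add: add.commute)

lemma phi_has_derivative:
  assumes "1 < p" "0 < \<omega>"
  shows "(phi p \<omega> a has_real_derivative dphi p \<omega> a x) (at x)"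
proof -
  let ?y = "\<lambda>x. rate p \<omega> * (x + a)"
  have cy: "cosh (?y x) \<noteq> 0" "0 < cosh (?y x)" by simp_all
  have y: "(?y has_real_derivative rate p \<omega>) (at x)"
    by (auto intro!: derivative_eq_intros)
  have c: "((\<lambda>x. cosh (?y x)) has_real_derivative sinh (?y x) * rate p \<omega>) (at x)"
    by (rule DERIV_chain2[OF _ y]) (auto intro!: derivative_eq_intros)
  have D: "((\<lambda>x. cosh (?y x) powr (- 2 / (p - 1))) has_real_derivative
      - 2 / (p - 1) * cosh (?y x) powr (- 2 / (p - 1) - 1) * (sinh (?y x) * rate p \<omega>)) (at x)"
    by (rule DERIV_chain2[OF has_real_derivative_powr[OF cy(2)] c])
  have E: "cosh (?y x) powr (- 2 / (p - 1) - 1) = cosh (?y x) powr (- 2 / (p - 1)) / cosh (?y x)"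
    using cy by (simp add: powr_diff)
  have "((\<lambda>x. cosh (?y x) powr (- 2 / (p - 1))) has_real_derivative
      - (sqrt \<omega> * tanh (?y x) * cosh (?y x) powr (- 2 / (p - 1)))) (at x)"
    by (rule DERIV_cong[OF D], unfold E) (use assms in \<open>simp add: tanh_def rate_def field_simps\<close>)
  from DERIV_cmult[OF this, of "((p + 1) * \<omega> / 2) powr (1 / (p - 1))"]
  have "((\<lambda>x. ((p + 1) * \<omega> / 2) powr (1 / (p - 1)) * cosh (?y x) powr (- 2 / (p - 1)))
      has_real_derivative dphi p \<omega> a x) (at x)"
    by (rule DERIV_cong) (simp add: dphi_def phi_cosh[OF assms])
  moreover have "phi p \<omega> a = (\<lambda>x. ((p + 1) * \<omega> / 2) powr (1 / (p - 1)) * cosh (?y x) powr (- 2 / (p - 1)))"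
    using phi_cosh[OF assms] by blast
  ultimately show ?thesis by (simp only:)
qed

lemma dphi_has_derivative:
  assumes "1 < p" "0 < \<omega>"
  shows "(dphi p \<omega> a has_real_derivative \<omega> * phi p \<omega> a x - phi p \<omega> a x powr p) (at x)"
proof -
  let ?y = "\<lambda>x. rate p \<omega> * (x + a)"
  have y: "(?y has_real_derivative rate p \<omega>) (at x)"
    by (auto intro!: derivative_eq_intros)
  have t: "((\<lambda>x. tanh (?y x)) has_real_derivative (1 - (tanh (?y x))\<^sup>2) * rate p \<omega>) (at x)"
    by (rule DERIV_chain2[OF _ y]) (auto intro!: derivative_eq_intros)
  have "((\<lambda>x. - (sqrt \<omega> * tanh (?y x) * phi p \<omega> a x)) has_real_derivative
     - (sqrt \<omega> * ((1 - (tanh (?y x))\<^sup>2) * rate p \<omega>) * phi p \<omega> a x + sqrt \<omega> * tanh (?y x) * dphi p \<omega> a x)) (at x)"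
    by (rule DERIV_cong[OF DERIV_minus[OF DERIV_mult[OF DERIV_cmult[OF t, of "sqrt \<omega>"] phi_has_derivative[OF assms]]]])
      (simp add: algebra_simps)
  moreover have "- (sqrt \<omega> * ((1 - (tanh (?y x))\<^sup>2) * rate p \<omega>) * phi p \<omega> a x + sqrt \<omega> * tanh (?y x) * dphi p \<omega> a x)
    = \<omega> * phi p \<omega> a x - phi p \<omega> a x powr p"
  proof -
    define T where "T = tanh (?y x)"
    define r where "r = sqrt \<omega>"
    have r: "r * (r * z) = \<omega> * z" for z using assms by (simp add: r_def flip: mult.assoc)
    have R: "rate p \<omega> = (p - 1) * r / 2" by (simp add: rate_def r_def)
    show ?thesis
      unfolding phi_powr_p[OF assms] phi_powr[OF assms] dphi_def T_def[symmetric] r_def[symmetric] R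
      by (simp add: algebra_simps r power2_eq_square)
        (simp add: field_simps)
  qed
  moreover have "dphi p \<omega> a = (\<lambda>x. - (sqrt \<omega> * tanh (?y x) * phi p \<omega> a x))"
    by (rule ext) (rule dphi_def)
  ultimately show ?thesis by (simp only:)
qed

lemma phi_continuous:
  assumes "1 < p" "0 < \<omega>"
  shows "continuous_on S (phi p \<omega> a)" "continuous_on S (dphi p \<omega> a)"
  using DERIV_isCont[OF phi_has_derivative[OF assms]] DERIV_isCont[OF dphi_has_derivative[OF assms]]
  by (simp_all add: continuous_at_imp_continuous_on)

lemma dphi_abs_le:
  assumes "1 < p" "0 < \<omega>"
  shows "\<bar>dphi p \<omega> a x\<bar> \<le> sqrt \<omega> * phi p \<omega> a x"
proof -
  have "\<bar>tanh y\<bar> \<le> 1" for y :: real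
    using tanh_real_bounds[of y] by (auto simp: abs_le_iff)
  then have "\<bar>tanh (rate p \<omega> * (x + a))\<bar> * phi p \<omega> a x \<le> 1 * phi p \<omega> a x"
    by (rule mult_right_mono) (simp add: phi_pos[OF assms] less_imp_le)
  then have "sqrt \<omega> * (\<bar>tanh (rate p \<omega> * (x + a))\<bar> * phi p \<omega> a x) \<le> sqrt \<omega> * (1 * phi p \<omega> a x)"
    by (rule mult_left_mono) (use assms in simp)
  moreover have "\<bar>phi p \<omega> a x\<bar> = phi p \<omega> a x" using phi_pos[OF assms, of a x] by simp
  ultimately show ?thesis using assms by (simp add: dphi_def abs_mult)
qed

lemma phi_decay:
  assumes "1 < p" "0 < \<omega>"
  shows "\<exists>K\<ge>0. \<forall>x. phi p \<omega> a x \<le> K * exp (- sqrt \<omega> * x)"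
proof -
  define M where "M = ((p + 1) * \<omega> / 2) powr (1 / (p - 1))"
  define K where "K = M * (1 / 2) powr (- 2 / (p - 1)) * exp (- sqrt \<omega> * a)"
  have "phi p \<omega> a x \<le> K * exp (- sqrt \<omega> * x)" for x
  proof -
    define y where "y = rate p \<omega> * (x + a)"
    have "1 / 2 * exp y \<le> cosh y" by (simp add: cosh_def field_simps)
    then have "cosh y powr (- 2 / (p - 1)) \<le> (1 / 2 * exp y) powr (- 2 / (p - 1))"
      using assms by (intro powr_mono2') auto
    also have "\<dots> = (1 / 2) powr (- 2 / (p - 1)) * exp (y * (- 2 / (p - 1)))"
      by (subst powr_mult) (simp_all only: exp_powr_real)
    also have "y * (- 2 / (p - 1)) = - sqrt \<omega> * a + - sqrt \<omega> * x"
      using assms by (simp add: y_def rate_def field_simps)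
    finally have "cosh y powr (- 2 / (p - 1)) \<le> (1 / 2) powr (- 2 / (p - 1)) * exp (- sqrt \<omega> * a) * exp (- sqrt \<omega> * x)"
      by (simp only: exp_add mult.assoc)
    then have "M * cosh y powr (- 2 / (p - 1)) \<le> M * ((1 / 2) powr (- 2 / (p - 1)) * exp (- sqrt \<omega> * a) * exp (- sqrt \<omega> * x))"
      by (rule mult_left_mono) (simp add: M_def)
    then show ?thesis unfolding phi_cosh[OF assms] K_def M_def[symmetric] y_def[symmetric]
      by (simp only: mult.assoc)
  qed
  moreover have "0 \<le> K" by (simp add: K_def M_def)
  ultimately show ?thesis by blast
qed

lemma integrable_half_line_exp:
  assumes "0 < c" shows "integrable half_line (\<lambda>x. exp (- c * x) :: real)"
proof -
  have "(\<lambda>x. exp (- c * x) :: real) integrable_on {0..}"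
    using integrable_on_exp_minus_to_infinity[OF assms, of 0] by simp
  then have "(\<lambda>x. exp (- c * x) :: real) absolutely_integrable_on {0..}"
    by (intro nonnegative_absolutely_integrable_1) auto
  then have "set_integrable lebesgue {0<..} (\<lambda>x. exp (- c * x) :: real)"
    by (rule set_integrable_subset) auto
  then show ?thesis by (rule absolutely_integrable_imp_integrable) auto
qed

lemma phi_Lq_2:
  assumes "1 < p" "0 < \<omega>"
  shows "(\<lambda>x. complex_of_real (phi p \<omega> a x)) \<in> Lq_half_line 2"
    and "(\<lambda>x. complex_of_real (dphi p \<omega> a x)) \<in> Lq_half_line 2"
proof -
  obtain K where K: "0 \<le> K" "\<And>x. phi p \<omega> a x \<le> K * exp (- sqrt \<omega> * x)"
    using phi_decay[OF assms] by blast
  have L2: "(\<lambda>x. complex_of_real (h x)) \<in> Lq_half_line 2"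
    if "continuous_on UNIV h" "\<And>x. \<bar>h x\<bar> \<le> C * phi p \<omega> a x" "0 \<le> C" for h C
    unfolding Lq_2_iff
  proof
    have c2: "continuous_on UNIV (\<lambda>x. (norm (complex_of_real (h x)))\<^sup>2)"
      by (intro continuous_on_power continuous_on_norm continuous_on_of_real that(1))
    show "(\<lambda>x. complex_of_real (h x)) \<in> borel_measurable half_line"
      by (intro borel_measurable_half_line borel_measurable_continuous_onI continuous_intros that)
    show "integrable half_line (\<lambda>x. (norm (complex_of_real (h x)))\<^sup>2)"
    proof (rule Bochner_Integration.integrable_bound)
      show "integrable half_line (\<lambda>x. (C * K)\<^sup>2 * exp (- (2 * sqrt \<omega>) * x))"
        using assms by (intro integrable_mult_right integrable_half_line_exp) auto
      have le: "(norm (complex_of_real (h x)))\<^sup>2 \<le> (C * K)\<^sup>2 * exp (- (2 * sqrt \<omega>) * x)" for x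
      proof -
        have "\<bar>h x\<bar> \<le> C * (K * exp (- sqrt \<omega> * x))"
          using that(2)[of x] mult_left_mono[OF K(2)[of x] that(3)] by linarith
        then have "\<bar>h x\<bar>\<^sup>2 \<le> (C * (K * exp (- sqrt \<omega> * x)))\<^sup>2" by (rule power_mono) simp
        also have "\<dots> = (C * K)\<^sup>2 * (exp (- sqrt \<omega> * x) * exp (- sqrt \<omega> * x))"
          by (simp add: power2_eq_square)
        also have "exp (- sqrt \<omega> * x) * exp (- sqrt \<omega> * x) = exp (- (2 * sqrt \<omega>) * x)"
          unfolding mult_exp_exp by simp
        finally show ?thesis by simp
      qed
      have nle: "norm ((norm (complex_of_real (h x)))\<^sup>2) \<le> norm ((C * K)\<^sup>2 * exp (- (2 * sqrt \<omega>) * x))" for x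
        unfolding real_norm_def abs_power2 by (rule order_trans[OF le abs_ge_self])
      show "AE x in half_line. norm ((norm (complex_of_real (h x)))\<^sup>2) \<le> norm ((C * K)\<^sup>2 * exp (- (2 * sqrt \<omega>) * x))"
        by (intro AE_I2 nle)
    qed (rule borel_measurable_half_line[OF borel_measurable_continuous_onI[OF c2]])
  qed
  show "(\<lambda>x. complex_of_real (phi p \<omega> a x)) \<in> Lq_half_line 2"
  proof (rule L2[where C=1])
    show "\<bar>phi p \<omega> a x\<bar> \<le> 1 * phi p \<omega> a x" for x using phi_pos[OF assms, of a x] by simp
  qed (simp_all only: phi_continuous[OF assms] zero_le_one)
  show "(\<lambda>x. complex_of_real (dphi p \<omega> a x)) \<in> Lq_half_line 2"
    by (rule L2[OF phi_continuous(2)[OF assms] dphi_abs_le[OF assms]]) (use assms in simp)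
qed

lemma H1_data_phi:
  assumes "1 < p" "0 < \<omega>"
  shows "H1_data (\<lambda>x. of_real (phi p \<omega> a x)) (\<lambda>x. of_real (dphi p \<omega> a x)) (of_real (phi p \<omega> a 0))"
proof (rule H1_data_smooth)
  show "((\<lambda>x. complex_of_real (phi p \<omega> a x)) has_vector_derivative of_real (dphi p \<omega> a x)) (at x)" for x
    by (rule has_vector_derivative_of_real[OF phi_has_derivative[OF assms]])
  show "continuous_on UNIV (\<lambda>x. complex_of_real (dphi p \<omega> a x))"
    by (rule continuous_on_of_real[OF phi_continuous(2)[OF assms]])
qed (rule phi_Lq_2[OF assms])+

text \<open>No decay of \<open>F\<close> is assumed: that it has a limit at infinity is part of the conclusion.\<close>

lemma half_line_FTC:
  assumes der: "\<And>x. (F has_real_derivative h x) (at x)" and cont: "continuous_on UNIV h"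
    and int: "integrable half_line h"
  shows "(F \<longlongrightarrow> F 0 + (LINT x|half_line. h x)) at_top"
proof -
  let ?k = "\<lambda>x. indicator {0<..} x *\<^sub>R h x"
  have hm: "h \<in> borel_measurable borel" using cont by (rule borel_measurable_continuous_onI)
  have km: "?k \<in> borel_measurable lborel" using hm by measurable
  have "integrable lebesgue ?k"
    using int by (subst (asm) integrable_restrict_space) auto
  then have ki: "integrable lborel ?k" by (simp only: integrable_completion[OF km])
  have "(LINT x|half_line. h x) = (LINT x|lebesgue. ?k x)"
    by (rule integral_restrict_space) auto
  also have "\<dots> = (LINT x|lborel. ?k x)" by (rule integral_completion[OF km])
  finally have eq: "(LINT x|half_line. h x) = (LINT x|lborel. ?k x)" .
  have "((\<lambda>y. LINT x|lborel. indicator {..y} x *\<^sub>R ?k x) \<longlongrightarrow> (LINT x|lborel. ?k x)) at_top"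
    by (rule tendsto_integral_at_top[OF _ ki]) simp
  then have "((\<lambda>y. F 0 + (LINT x|lborel. indicator {..y} x *\<^sub>R ?k x)) \<longlongrightarrow> F 0 + (LINT x|half_line. h x)) at_top"
    unfolding eq by (intro tendsto_intros)
  then show ?thesis
  proof (rule Lim_transform_eventually)
    have "F 0 + (LINT x|lborel. indicator {..y} x *\<^sub>R ?k x) = F y" if "0 < y" for y
    proof -
      have "(LINT x|lborel. indicator {..y} x *\<^sub>R ?k x) = (LINT x:{0<..y}|lborel. h x)"
        unfolding set_lebesgue_integral_def
        by (intro Bochner_Integration.integral_cong) (auto simp: indicator_def)
      also have "\<dots> = integral {0<..y} h"
        by (rule set_borel_integral_eq_integral(2)[OF set_integrable_subset[OF borel_integrable_atLeastAtMost'[of 0 y]]])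
          (auto intro: continuous_on_subset[OF cont])
      also have "\<dots> = integral {0..y} h"
      proof (rule integral_spike_set)
        have n: "negligible {0::real}" by simp
        show "negligible {x \<in> {0<..y} - {0..y}. h x \<noteq> 0}" by (rule negligible_subset[OF n]) auto
        show "negligible {x \<in> {0..y} - {0<..y}. h x \<noteq> 0}" by (rule negligible_subset[OF n]) auto
      qed
      also have "\<dots> = F y - F 0"
      proof (intro integral_unique fundamental_theorem_of_calculus)
        show "(F has_vector_derivative h x) (at x within {0..y})" for x
          using der[of x] unfolding has_real_derivative_iff_has_vector_derivative
          by (rule has_vector_derivative_at_within)
      qed (use that in simp)
      finally show ?thesis by simp
    qed
    then show "\<forall>\<^sub>F y in at_top. F 0 + (LINT x|lborel. indicator {..y} x *\<^sub>R ?k x) = F y"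
      unfolding eventually_at_top_dense by blast
  qed
qed

lemma sq_integral_of_real: "sq_integral (\<lambda>x. of_real (h x)) = (LINT x|half_line. (h x)\<^sup>2)"
  by (simp add: sq_integral_def)

lemma phi_integrable:
  assumes "1 < p" "0 < \<omega>"
  shows "integrable half_line (\<lambda>x. (phi p \<omega> a x)\<^sup>2)" "integrable half_line (\<lambda>x. (dphi p \<omega> a x)\<^sup>2)"
    "integrable half_line (\<lambda>x. phi p \<omega> a x powr (p + 1))"
proof -
  have n: "norm (complex_of_real (phi p \<omega> a x)) = phi p \<omega> a x" for x
    using phi_pos[OF assms, of a x] by simp
  have d: "(norm (complex_of_real (dphi p \<omega> a x)))\<^sup>2 = (dphi p \<omega> a x)\<^sup>2" for x
    by simp
  show "integrable half_line (\<lambda>x. (phi p \<omega> a x)\<^sup>2)"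
    using Lq_2_D(2)[OF phi_Lq_2(1)[OF assms, of a]] unfolding n .
  show "integrable half_line (\<lambda>x. (dphi p \<omega> a x)\<^sup>2)"
    using Lq_2_D(2)[OF phi_Lq_2(2)[OF assms, of a]] unfolding d .
  show "integrable half_line (\<lambda>x. phi p \<omega> a x powr (p + 1))"
    using H1_data_powr_integrable(1)[OF H1_data_phi[OF assms, of a] assms(1)] unfolding n .
qed

lemma pow_integral_phi:
  assumes "1 < p" "0 < \<omega>"
  shows "pow_integral p (\<lambda>x. of_real (phi p \<omega> a x)) = (LINT x|half_line. phi p \<omega> a x powr (p + 1))"
proof -
  have n: "norm (complex_of_real (phi p \<omega> a x)) = phi p \<omega> a x" for x
    using phi_pos[OF assms, of a x] by simp
  show ?thesis unfolding pow_integral_def n ..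
qed

lemma phi_tendsto_0:
  assumes "1 < p" "0 < \<omega>"
  shows "(phi p \<omega> a \<longlongrightarrow> 0) at_top"
proof -
  obtain K where K: "0 \<le> K" "\<And>x. phi p \<omega> a x \<le> K * exp (- sqrt \<omega> * x)"
    using phi_decay[OF assms] by blast
  have "filterlim (\<lambda>x. sqrt \<omega> * x) at_top at_top"
    using assms by (intro filterlim_tendsto_pos_mult_at_top[OF tendsto_const _ filterlim_ident]) auto
  then have "((\<lambda>x. exp (- (sqrt \<omega> * x))) \<longlongrightarrow> 0) at_top"
    by (intro filterlim_compose[OF exp_at_bot] filterlim_compose[OF filterlim_uminus_at_bot_at_top])
  then have "((\<lambda>x. K * exp (- sqrt \<omega> * x)) \<longlongrightarrow> K * 0) at_top" by (intro tendsto_mult tendsto_const) simp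
  then show ?thesis
    by (intro tendsto_sandwich[of "\<lambda>x. 0" "phi p \<omega> a" at_top "\<lambda>x. K * exp (- sqrt \<omega> * x)"] always_eventually allI)
      (use K phi_pos[OF assms, of a] in \<open>auto simp: less_imp_le\<close>)
qed

text \<open>The integrand \<open>\<phi>'\<^sup>2 + \<omega> \<phi>\<^sup>2 - \<phi>\<^sup>p\<^sup>+\<^sup>1\<close> is the derivative of \<open>\<phi> \<phi>'\<close>, by the soliton equation.\<close>

lemma phi_virial:
  assumes "1 < p" "0 < \<omega>"
  shows "sq_integral (\<lambda>x. of_real (dphi p \<omega> a x)) + \<omega> * sq_integral (\<lambda>x. of_real (phi p \<omega> a x))
    - pow_integral p (\<lambda>x. of_real (phi p \<omega> a x)) = - (phi p \<omega> a 0 * dphi p \<omega> a 0)"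
proof -
  let ?h = "\<lambda>x. (dphi p \<omega> a x)\<^sup>2 + \<omega> * (phi p \<omega> a x)\<^sup>2 - phi p \<omega> a x powr (p + 1)"
  let ?F = "\<lambda>x. phi p \<omega> a x * dphi p \<omega> a x"
  note i = phi_integrable[OF assms, of a]
  have pp: "phi p \<omega> a x powr (p + 1) = phi p \<omega> a x * phi p \<omega> a x powr p" for x
    using phi_powr_p[OF assms, of a x] by (simp add: power2_eq_square)
  have int: "integrable half_line ?h" using i by auto
  have cont: "continuous_on UNIV ?h"
    using phi_pos[OF assms, of a] by (intro continuous_intros phi_continuous assms) (auto simp: less_imp_neq[symmetric])
  have der: "(?F has_real_derivative ?h x) (at x)" for x
    by (rule DERIV_cong[OF DERIV_mult[OF phi_has_derivative[OF assms] dphi_has_derivative[OF assms]]])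
      (simp add: pp pp[unfolded add.commute[of p 1]] power2_eq_square algebra_simps)
  have "((\<lambda>x. sqrt \<omega> * (phi p \<omega> a x * phi p \<omega> a x)) \<longlongrightarrow> sqrt \<omega> * (0 * 0)) at_top"
    by (intro tendsto_intros phi_tendsto_0 assms)
  then have "((\<lambda>x. sqrt \<omega> * (phi p \<omega> a x * phi p \<omega> a x)) \<longlongrightarrow> 0) at_top" by simp
  moreover have "\<bar>?F x\<bar> \<le> sqrt \<omega> * (phi p \<omega> a x * phi p \<omega> a x)" for x
    using mult_left_mono[OF dphi_abs_le[OF assms, of a x], of "phi p \<omega> a x"] phi_pos[OF assms, of a x]
    by (simp add: abs_mult mult_ac)
  ultimately have "(?F \<longlongrightarrow> 0) at_top"
    by (intro Lim_null_comparison[of ?F "\<lambda>x. sqrt \<omega> * (phi p \<omega> a x * phi p \<omega> a x)"] always_eventually allI) auto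
  from tendsto_unique[OF _ this half_line_FTC[OF der cont int]]
  have "(LINT x|half_line. ?h x) = - ?F 0" by simp
  then show ?thesis
    unfolding sq_integral_of_real pow_integral_phi[OF assms] using i by simp
qed

text \<open>The integral is a tail of one fixed integrable function, cut at \<open>a\<close>.\<close>

lemma pow_integral_phi_has_derivative:
  assumes "1 < p" "0 < \<omega>"
  shows "((\<lambda>a. pow_integral p (\<lambda>x. of_real (phi p \<omega> a x))) has_real_derivative
    - (phi p \<omega> a 0 powr (p + 1))) (at a)"
proof -
  let ?h = "\<lambda>x. phi p \<omega> 0 x powr (p + 1)"
  have cont: "continuous_on UNIV ?h"
    using phi_pos[OF assms, of 0] by (intro continuous_intros phi_continuous assms) (auto simp: less_imp_neq[symmetric])
  obtain H where H: "\<And>x. (H has_vector_derivative ?h x) (at x)"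
    using einterval_antiderivative[of "-\<infinity>" "\<infinity>" ?h] cont
    by (auto simp: continuous_on_eq_continuous_at)
  then have H': "(H has_real_derivative ?h x) (at x)" for x
    by (simp add: has_real_derivative_iff_has_vector_derivative)
  \<comment> \<open>The limit of \<open>H\<close> at infinity.\<close>
  define L where "L = H 0 + (LINT x|half_line. ?h x)"
  have "pow_integral p (\<lambda>x. of_real (phi p \<omega> b x)) = L - H b" for b
  proof -
    have "((\<lambda>x. H (x + b)) \<longlongrightarrow> H (0 + b) + (LINT x|half_line. ?h (x + b))) at_top"
    proof (rule half_line_FTC)
      show "((\<lambda>x. H (x + b)) has_real_derivative ?h (x + b)) (at x)" for x
        by (rule DERIV_shift[THEN iffD1, OF H'])
      show "continuous_on UNIV (\<lambda>x. ?h (x + b))"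
        by (rule continuous_on_compose2[OF cont]) (auto intro!: continuous_intros)
      show "integrable half_line (\<lambda>x. ?h (x + b))"
        using phi_integrable(3)[OF assms, of b] by (simp add: phi_shift(1)[of p \<omega> b])
    qed
    moreover have "((\<lambda>x. H (x + b)) \<longlongrightarrow> L) at_top"
    proof -
      have "(H \<longlongrightarrow> L) at_top"
        unfolding L_def by (rule half_line_FTC[OF H' cont phi_integrable(3)[OF assms]])
      moreover have "filterlim (\<lambda>x. x + b) at_top at_top"
        using filterlim_tendsto_add_at_top[OF tendsto_const filterlim_ident, of b] by (simp add: add.commute)
      ultimately show ?thesis by (rule filterlim_compose)
    qed
    ultimately have "L = H b + (LINT x|half_line. ?h (x + b))"
      using tendsto_unique[OF trivial_limit_at_top_linorder] by fastforce
    moreover have "pow_integral p (\<lambda>x. of_real (phi p \<omega> b x)) = (LINT x|half_line. ?h (x + b))"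
      unfolding pow_integral_phi[OF assms] by (simp only: phi_shift(1)[of p \<omega> b])
    ultimately show ?thesis by simp
  qed
  moreover have "((\<lambda>b. L - H b) has_real_derivative - ?h a) (at a)"
    using H'[of a] by (auto intro!: derivative_eq_intros)
  ultimately show ?thesis by (simp add: phi_shift(1)[of p \<omega> a])
qed

section \<open>The stationary equation on an edge\<close>

lemma integrable_half_line_const:
  assumes "integrable half_line (\<lambda>x. c::real)" shows "c = 0"
proof (rule ccontr)
  assume "c \<noteq> 0"
  have S: "{0::real<..} \<in> sets lebesgue" by simp
  have i: "(\<lambda>x. \<bar>c\<bar>) integrable_on {0::real<..}"
    by (rule integrable_on_lebesgue_on[OF integrable_abs[OF assms] S])
  have "real n * \<bar>c\<bar> \<le> integral {0::real<..} (\<lambda>x. \<bar>c\<bar>)" for n :: nat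
  proof -
    have "integral {1..1 + real n} (\<lambda>x. \<bar>c\<bar>) \<le> integral {0::real<..} (\<lambda>x. \<bar>c\<bar>)"
      by (rule integral_subset_le[OF _ _ i]) (auto intro: integrable_const_ivl)
    then show ?thesis by simp
  qed
  moreover obtain n :: nat where "integral {0::real<..} (\<lambda>x. \<bar>c\<bar>) < real n * \<bar>c\<bar>"
    using reals_Archimedean3[of "\<bar>c\<bar>"] \<open>c \<noteq> 0\<close> by auto
  ultimately show False by (metis not_le)
qed

lemma half_line_zero_derivative:
  fixes f :: "real \<Rightarrow> 'a::real_normed_vector"
  assumes "\<And>x. 0 < x \<Longrightarrow> (f has_vector_derivative 0) (at x)"
  shows "\<exists>c. \<forall>x>0. f x = c"
proof -
  have "\<exists>c. \<forall>x\<in>{0<..}. f x = c"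
  proof (rule has_vector_derivative_zero_constant)
    show "convex {0::real<..}" by (rule convex_real_interval)
    show "(f has_vector_derivative 0) (at x within {0<..})" if "x \<in> {0<..}" for x
      using assms[of x] that by (auto intro: has_vector_derivative_at_within)
  qed auto
  then show ?thesis by auto
qed

lemma half_line_zero_derivative_integrable:
  fixes f :: "real \<Rightarrow> real"
  assumes der: "\<And>x. 0 < x \<Longrightarrow> (f has_real_derivative 0) (at x)" and int: "integrable half_line f" and "0 < x"
  shows "f x = 0"
proof -
  obtain c where c: "\<And>x. 0 < x \<Longrightarrow> f x = c"
    using half_line_zero_derivative[of f] der
    by (auto simp: has_real_derivative_iff_has_vector_derivative)
  have "integrable half_line (\<lambda>x. c)"
    using int by (rule Bochner_Integration.integrable_cong[THEN iffD1, rotated -1]) (auto simp: c)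
  then show ?thesis using integrable_half_line_const c \<open>0 < x\<close> by blast
qed

text \<open>At a zero of \<open>R\<close> the difference quotient is \<open>R\<^sup>m\<^sup>-\<^sup>1\<close>, which tends to 0, times a convergent factor.\<close>

lemma has_real_derivative_powr_nonneg:
  assumes R: "(R has_real_derivative D) (at x)" and nn: "\<And>y. 0 \<le> R y" and m: "1 < m"
  shows "((\<lambda>y. R y powr m) has_real_derivative m * R x powr (m - 1) * D) (at x)"
proof (cases "R x = 0")
  case False
  then have "0 < R x" using nn[of x] by simp
  then show ?thesis by (rule DERIV_chain2[OF has_real_derivative_powr R])
next
  case True
  have "(R \<longlongrightarrow> R x) (at x)" using DERIV_isCont[OF R] by (simp add: isCont_def)
  then have "((\<lambda>y. R y powr (m - 1)) \<longlongrightarrow> R x powr (m - 1)) (at x)"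
    using m nn by (intro tendsto_powr') auto
  moreover have "((\<lambda>y. (R y - R x) / (y - x)) \<longlongrightarrow> D) (at x)"
    using R by (simp add: has_field_derivative_iff)
  ultimately have "((\<lambda>y. R y powr (m - 1) * ((R y - R x) / (y - x))) \<longlongrightarrow> R x powr (m - 1) * D) (at x)"
    by (rule tendsto_mult)
  moreover have "R y powr (m - 1) * ((R y - R x) / (y - x)) = (R y powr m - R x powr m) / (y - x)" for y
    using powr_add[of "R y" "m - 1" 1] nn[of y] True m by (cases "R y = 0") auto
  ultimately have "((\<lambda>y. (R y powr m - R x powr m) / (y - x)) \<longlongrightarrow> R x powr (m - 1) * D) (at x)"
    by (simp only:)
  moreover have "R x powr (m - 1) * D = m * R x powr (m - 1) * D" using True m by simp
  ultimately show ?thesis by (simp only: has_field_derivative_iff)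
qed

lemma norm_sq_has_derivative:
  fixes f :: "real \<Rightarrow> complex"
  assumes "(f has_vector_derivative f') (at x)"
  shows "((\<lambda>x. (norm (f x))\<^sup>2) has_real_derivative 2 * Re (cnj (f x) * f')) (at x)"
proof -
  have re: "((\<lambda>x. Re (f x)) has_real_derivative Re f') (at x)"
    and im: "((\<lambda>x. Im (f x)) has_real_derivative Im f') (at x)"
    unfolding has_real_derivative_iff_has_vector_derivative
    using bounded_linear.has_vector_derivative[OF bounded_linear_Re assms]
      bounded_linear.has_vector_derivative[OF bounded_linear_Im assms] by auto
  have "((\<lambda>x. (Re (f x))\<^sup>2 + (Im (f x))\<^sup>2) has_real_derivative 2 * Re (cnj (f x) * f')) (at x)"
    by (rule DERIV_cong[OF DERIV_add[OF DERIV_power[OF re, of 2] DERIV_power[OF im, of 2]]])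
      (simp add: algebra_simps)
  then show ?thesis by (simp add: cmod_power2)
qed

lemma norm_powr_eq_sq_powr: "norm (z::complex) powr q = ((norm z)\<^sup>2) powr (q / 2)"
proof -
  have "((norm z)\<^sup>2) powr (q / 2) = (norm z powr 2) powr (q / 2)" by simp
  then show ?thesis unfolding powr_powr by simp
qed

text \<open>The stationary equation \<open>f'' = \<omega> f - |f|\<^sup>p\<^sup>-\<^sup>1 f\<close>, written as a first order system with \<open>g = f'\<close>, for
  a solution of finite energy on the half-line.\<close>

locale stationary =
  fixes p \<omega> :: real and f g :: "real \<Rightarrow> complex"
  assumes p: "1 < p" and \<omega>: "0 < \<omega>"
    and f': "\<And>x. 0 < x \<Longrightarrow> (f has_vector_derivative g x) (at x)"
    and g': "\<And>x. 0 < x \<Longrightarrow> (g has_vector_derivative of_real \<omega> * f x - nonlin p (f x)) (at x)"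
    and fi: "integrable half_line (\<lambda>x. (norm (f x))\<^sup>2)"
    and gi: "integrable half_line (\<lambda>x. (norm (g x))\<^sup>2)"
    and fpi: "integrable half_line (\<lambda>x. norm (f x) powr (p + 1))"
    and fgi: "integrable half_line (\<lambda>x. cnj (f x) * g x)"
begin

definition "R x = (norm (f x))\<^sup>2"

lemma R_nonneg: "0 \<le> R x" by (simp add: R_def)

lemma R_half: "R x powr (1 / 2) = norm (f x)"
proof -
  have "(norm (f x) powr 2) powr (1 / 2) = norm (f x)" unfolding powr_powr by simp
  then show ?thesis by (simp only: R_def powr_numeral norm_ge_zero)
qed

lemma R_derivative: "0 < x \<Longrightarrow> (R has_real_derivative 2 * Re (cnj (f x) * g x)) (at x)"
  unfolding R_def by (rule norm_sq_has_derivative[OF f'])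

lemma nonlin_R: "nonlin p (f x) = of_real (R x powr ((p - 1) / 2)) * f x"
  unfolding nonlin_def R_def norm_powr_eq_sq_powr[of _ "p - 1"] ..

text \<open>The energy of the equation is constant and integrable, hence zero.\<close>

lemma energy:
  assumes x: "0 < x"
  shows "(norm (g x))\<^sup>2 = \<omega> * R x - 2 / (p + 1) * R x powr ((p + 1) / 2)"
proof -
  let ?E = "\<lambda>x. (norm (g x))\<^sup>2 - \<omega> * R x + 2 / (p + 1) * R x powr ((p + 1) / 2)"
  have "?E x = 0"
  proof (rule half_line_zero_derivative_integrable[OF _ _ x])
    fix x :: real assume x: "0 < x"
    define P where "P = Re (cnj (f x) * g x)"
    have e1: "(R has_real_derivative 2 * P) (at x)" unfolding P_def by (rule R_derivative[OF x])
    have e2: "((\<lambda>y. R y powr ((p + 1) / 2)) has_real_derivative (p + 1) / 2 * R x powr ((p + 1) / 2 - 1) * (2 * P)) (at x)"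
      by (rule has_real_derivative_powr_nonneg[OF e1 R_nonneg]) (use p in simp)
    have e3: "((\<lambda>y. (norm (g y))\<^sup>2) has_real_derivative
        2 * Re (cnj (g x) * (of_real \<omega> * f x - nonlin p (f x)))) (at x)"
      by (rule norm_sq_has_derivative[OF g'[OF x]])
    have "Re (cnj (g x) * (of_real \<omega> * f x - nonlin p (f x))) = (\<omega> - R x powr ((p - 1) / 2)) * P"
      unfolding nonlin_R P_def by (simp add: algebra_simps)
    moreover have "(p + 1) / 2 - 1 = (p - 1) / 2" by (simp add: field_simps)
    ultimately have e3': "((\<lambda>y. (norm (g y))\<^sup>2) has_real_derivative 2 * ((\<omega> - R x powr ((p + 1) / 2 - 1)) * P)) (at x)"
      using e3 by simp
    show "(?E has_real_derivative 0) (at x)"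
      by (rule DERIV_cong[OF DERIV_add[OF DERIV_diff[OF e3' DERIV_cmult[OF e1]] DERIV_cmult[OF e2]]])
        (use p in \<open>simp add: field_simps\<close>)
  next
    have "integrable half_line (\<lambda>x. R x powr ((p + 1) / 2))"
      using fpi unfolding norm_powr_eq_sq_powr[of _ "p + 1"] R_def .
    then show "integrable half_line ?E"
      using gi fi unfolding R_def by auto
  qed
  then show ?thesis by simp
qed

text \<open>The same argument applies to the conserved quantity that belongs to multiplication by phases.  Its
  vanishing means that \<open>f\<close> moves along a ray through the origin.\<close>

lemma momentum:
  assumes x: "0 < x"
  shows "Im (cnj (f x) * g x) = 0"
proof (rule half_line_zero_derivative_integrable[OF _ _ x])
  fix x :: real assume x: "0 < x"
  have "((\<lambda>x. cnj (f x) * g x) has_vector_derivative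
      cnj (f x) * (of_real \<omega> * f x - nonlin p (f x)) + cnj (g x) * g x) (at x)"
    by (intro has_vector_derivative_mult has_vector_derivative_cnj f' g' x)
  then have "((\<lambda>x. Im (cnj (f x) * g x)) has_vector_derivative
      Im (cnj (f x) * (of_real \<omega> * f x - nonlin p (f x)) + cnj (g x) * g x)) (at x)"
    by (rule bounded_linear.has_vector_derivative[OF bounded_linear_Im])
  moreover have "Im (cnj (f x) * (of_real \<omega> * f x - nonlin p (f x)) + cnj (g x) * g x) = 0"
    unfolding nonlin_R by (simp add: algebra_simps)
  ultimately show "((\<lambda>x. Im (cnj (f x) * g x)) has_real_derivative 0) (at x)"
    by (simp only: has_real_derivative_iff_has_vector_derivative)
next
  show "integrable half_line (\<lambda>x. Im (cnj (f x) * g x))" by (rule integrable_Im[OF fgi])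
qed

lemma R_derivative_bound:
  assumes x: "0 < x" shows "\<bar>2 * Re (cnj (f x) * g x)\<bar> \<le> 2 * sqrt \<omega> * R x"
proof -
  have "(norm (g x))\<^sup>2 \<le> \<omega> * R x" using energy[OF x] p by simp
  then have "norm (g x) \<le> sqrt (\<omega> * R x)" by (rule real_le_rsqrt)
  then have "norm (g x) \<le> sqrt \<omega> * norm (f x)" by (simp add: real_sqrt_mult R_def)
  then have "norm (f x) * norm (g x) \<le> norm (f x) * (sqrt \<omega> * norm (f x))"
    by (rule mult_left_mono) simp
  moreover have "\<bar>Re (cnj (f x) * g x)\<bar> \<le> norm (f x) * norm (g x)"
    using abs_Re_le_cmod[of "cnj (f x) * g x"] by (simp add: norm_mult)
  ultimately show ?thesis by (simp add: R_def power2_eq_square mult_ac)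
qed

text \<open>Gronwall: the energy identity gives \<open>|R'| \<le> 2 \<surd>\<omega> R\<close>, so \<open>R\<close> times a decreasing exponential is
  nonincreasing, and \<open>R\<close> times an increasing one is nondecreasing.  A zero thus spreads in both directions.\<close>

lemma zero_everywhere:
  assumes x0: "0 < x0" "f x0 = 0" and x: "0 < x"
  shows "f x = 0"
proof -
  let ?b = "2 * sqrt \<omega>"
  have R0: "R x0 = 0" using x0 by (simp add: R_def)
  have d: "((\<lambda>x. R x * exp (s * x)) has_real_derivative (2 * Re (cnj (f x) * g x) + s * R x) * exp (s * x)) (at x)"
    if "0 < x" for x s
  proof -
    have "((\<lambda>x. exp (s * x)) has_real_derivative exp (s * x) * s) (at x)"
      by (auto intro!: derivative_eq_intros)
    from DERIV_mult[OF R_derivative[OF that] this] show ?thesis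
      by (rule DERIV_cong) (simp add: algebra_simps)
  qed
  have "R x * exp (s * x) \<le> 0" if s: "s = (if x0 \<le> x then - ?b else ?b)" for s
  proof (cases "x0 \<le> x")
    case True
    have "R x * exp (s * x) \<le> R x0 * exp (s * x0)"
    proof (rule DERIV_nonpos_imp_nonincreasing[OF True])
      fix t assume "x0 \<le> t" "t \<le> x"
      then have t: "0 < t" using x0 by simp
      have "2 * Re (cnj (f t) * g t) + s * R t \<le> 0" using R_derivative_bound[OF t] s True by simp
      then show "\<exists>y. ((\<lambda>x. R x * exp (s * x)) has_real_derivative y) (at t) \<and> y \<le> 0"
        using d[OF t, of s] by (auto simp: mult_nonpos_nonneg)
    qed
    then show ?thesis using R0 by simp
  next
    case False
    then have le: "x \<le> x0" by simp
    have "R x * exp (s * x) \<le> R x0 * exp (s * x0)"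
    proof (rule DERIV_nonneg_imp_nondecreasing[OF le])
      fix t assume "x \<le> t" "t \<le> x0"
      then have t: "0 < t" using x by simp
      have "2 * Re (cnj (f t) * g t) + s * R t \<ge> 0" using R_derivative_bound[OF t] s False by simp
      then show "\<exists>y. ((\<lambda>x. R x * exp (s * x)) has_real_derivative y) (at t) \<and> y \<ge> 0"
        using d[OF t, of s] by auto
    qed
    then show ?thesis using R0 by simp
  qed
  then have "R x \<le> 0" by (auto simp: mult_le_0_iff)
  then show ?thesis by (simp add: R_def)
qed

text \<open>The derivative of \<open>f / |f|\<close> is a multiple of \<open>Im (cnj f g)\<close>.\<close>

lemma phase_constant:
  assumes nz: "\<And>x. 0 < x \<Longrightarrow> f x \<noteq> 0"
  shows "\<exists>c. norm c = 1 \<and> (\<forall>x>0. f x = c * of_real (norm (f x)))"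
proof -
  let ?q = "\<lambda>x. f x * of_real (R x powr (- 1 / 2))"
  have Rpos: "0 < R x" if "0 < x" for x using nz[OF that] by (simp add: R_def)
  have "(?q has_vector_derivative 0) (at x)" if x: "0 < x" for x
  proof -
    define P where "P = Re (cnj (f x) * g x)"
    have P: "cnj (f x) * g x = of_real P"
      using momentum[OF x] by (simp add: P_def complex_eq_iff)
    have "((\<lambda>x. R x powr (- 1 / 2)) has_real_derivative - 1 / 2 * R x powr (- 1 / 2 - 1) * (2 * P)) (at x)"
      unfolding P_def by (rule DERIV_chain2[OF has_real_derivative_powr[OF Rpos[OF x]] R_derivative[OF x]])
    from has_vector_derivative_mult[OF f'[OF x] has_vector_derivative_of_real[OF this]]
    have "(?q has_vector_derivative f x * of_real (- 1 / 2 * R x powr (- 1 / 2 - 1) * (2 * P)) + g x * of_real (R x powr (- 1 / 2))) (at x)" .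
    moreover have "f x * of_real (- 1 / 2 * R x powr (- 1 / 2 - 1) * (2 * P)) + g x * of_real (R x powr (- 1 / 2)) = 0"
    proof -
      have "R x powr (- 1 / 2) = R x powr (- 1 / 2 - 1) * R x"
        using Rpos[OF x] powr_add[of "R x" "- 1 / 2 - 1" 1] by simp
      moreover have "g x * of_real (R x) = f x * of_real P"
        unfolding P[symmetric] R_def complex_norm_square by (simp add: mult_ac)
      ultimately show ?thesis by (simp add: mult_ac)
    qed
    ultimately show ?thesis by simp
  qed
  then have "\<exists>c. \<forall>x>0. ?q x = c" by (rule half_line_zero_derivative)
  then obtain c where c: "\<forall>x>0. ?q x = c" ..
  have n: "R x powr (- 1 / 2) = 1 / norm (f x)" if "0 < x" for x
  proof -
    have "R x powr (1 / 2) = norm (f x)" by (rule R_half)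
    then show ?thesis using powr_minus[of "R x" "1 / 2"] by (simp add: inverse_eq_divide)
  qed
  have q: "c = f x * of_real (1 / norm (f x))" if "0 < x" for x
  proof -
    have "f x * of_real (R x powr (- 1 / 2)) = c" using c that by blast
    then show ?thesis unfolding n[OF that] by (rule sym)
  qed
  have "f x = c * of_real (norm (f x))" if "0 < x" for x
  proof -
    have "c * of_real (norm (f x)) = f x * of_real (1 / norm (f x) * norm (f x))"
      unfolding q[OF that] of_real_mult by (simp only: mult.assoc)
    also have "1 / norm (f x) * norm (f x) = 1" using nz[OF that] by simp
    finally show ?thesis by simp
  qed
  moreover have "norm c = 1"
    unfolding q[OF zero_less_one] norm_mult norm_of_real using nz[of 1] by simp
  ultimately show ?thesis by blast
qed

text \<open>The substitution \<open>s = |f|\<^sup>-\<^sup>k\<close> with \<open>k = (p - 1) / 2\<close> linearises the equation: since the energy vanishes,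
  the nonlinear terms cancel and \<open>s'' = k\<^sup>2 \<omega> s\<close> remains.  The energy identity fixes the product of the two exponential
  coefficients of \<open>s\<close>, and \<open>s > 0\<close> fixes their signs; so \<open>s\<close> is a hyperbolic cosine of known
  amplitude with an unknown shift.\<close>

lemma norm_eq_phi:
  assumes nz: "\<And>x. 0 < x \<Longrightarrow> f x \<noteq> 0"
  shows "\<exists>a. \<forall>x>0. norm (f x) = phi p \<omega> a x"
proof -
  define k where "k = (p - 1) / 2"
  have k: "0 < k" using p by (simp add: k_def)
  have pk: "p = 2 * k + 1" by (simp add: k_def field_simps)
  define \<kappa> where "\<kappa> = k * sqrt \<omega>"
  have \<kappa>: "0 < \<kappa>" "\<kappa>\<^sup>2 = k\<^sup>2 * \<omega>" using k \<omega> by (auto simp: \<kappa>_def power_mult_distrib)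
  have Rpos: "0 < R x" if "0 < x" for x using nz[OF that] by (simp add: R_def)
  have energy': "(norm (g x))\<^sup>2 = \<omega> * R x - R x powr (k + 1) / (k + 1)" if "0 < x" for x
  proof -
    have "(p + 1) / 2 = k + 1" "2 / (p + 1) = 1 / (k + 1)" using k by (simp_all add: pk field_simps)
    then show ?thesis using energy[OF that] by (simp only:) simp
  qed
  define P where "P x = Re (cnj (f x) * g x)" for x
  define s where "s x = R x powr (- k / 2)" for x
  define s1 where "s1 x = - k * R x powr (- k / 2 - 1) * P x" for x
  have spos: "0 < s x" if "0 < x" for x using Rpos[OF that] by (simp add: s_def)
  have s': "(s has_real_derivative s1 x) (at x)" if x: "0 < x" for x
    unfolding s_def s1_def
    by (rule DERIV_cong[OF DERIV_chain2[OF has_real_derivative_powr[OF Rpos[OF x]] R_derivative[OF x]]])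
      (simp add: P_def)
  have P2: "(P x)\<^sup>2 = R x * (\<omega> * R x - R x powr (k + 1) / (k + 1))" if x: "0 < x" for x
  proof -
    have "(P x)\<^sup>2 = (norm (cnj (f x) * g x))\<^sup>2"
      using momentum[OF x] unfolding cmod_power2 by (simp add: P_def)
    also have "\<dots> = R x * (norm (g x))\<^sup>2" by (simp add: norm_mult power_mult_distrib R_def)
    also have "(norm (g x))\<^sup>2 = \<omega> * R x - R x powr (k + 1) / (k + 1)"
      by (rule energy'[OF x])
    finally show ?thesis .
  qed
  have P': "(P has_real_derivative 2 * \<omega> * R x - (k + 2) / (k + 1) * R x powr (k + 1)) (at x)" if x: "0 < x" for x
  proof -
    have "((\<lambda>x. cnj (f x) * g x) has_vector_derivative
        cnj (f x) * (of_real \<omega> * f x - nonlin p (f x)) + cnj (g x) * g x) (at x)"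
      by (intro has_vector_derivative_mult has_vector_derivative_cnj f' g' x)
    then have "(P has_vector_derivative Re (cnj (f x) * (of_real \<omega> * f x - nonlin p (f x)) + cnj (g x) * g x)) (at x)"
      unfolding P_def by (rule bounded_linear.has_vector_derivative[OF bounded_linear_Re])
    moreover have "Re (cnj (f x) * (of_real \<omega> * f x - nonlin p (f x)) + cnj (g x) * g x)
        = (\<omega> - R x powr k) * R x + (norm (g x))\<^sup>2"
      unfolding nonlin_R cmod_power2 R_def k_def[symmetric]
      by (simp add: algebra_simps power2_eq_square)
    moreover have "\<dots> = 2 * \<omega> * R x - (k + 2) / (k + 1) * R x powr (k + 1)"
    proof -
      have "R x powr (k + 1) = R x powr k * R x" using Rpos[OF x] by (simp add: powr_add)
      moreover have "(norm (g x))\<^sup>2 = \<omega> * R x - R x powr (k + 1) / (k + 1)"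
        by (rule energy'[OF x])
      ultimately show ?thesis using k by (simp add: field_simps)
    qed
    ultimately show ?thesis by (simp add: has_real_derivative_iff_has_vector_derivative)
  qed
  have pw: "R x powr (- k / 2 - 1) = s x / R x" "R x powr (- k / 2 - 1 - 1) = s x / (R x)\<^sup>2"
      "R x powr (k + 1) = R x / (s x)\<^sup>2" if x: "0 < x" for x
  proof -
    note r = Rpos[OF x]
    show a: "R x powr (- k / 2 - 1) = s x / R x" using r by (simp add: powr_diff s_def)
    show "R x powr (- k / 2 - 1 - 1) = s x / (R x)\<^sup>2"
      using r powr_diff[of "R x" "- k / 2 - 1" 1] unfolding a by (simp add: power2_eq_square)
    have "(s x)\<^sup>2 = R x powr (- k)"
      by (simp add: s_def power2_eq_square flip: powr_add)
    then have "R x powr k = 1 / (s x)\<^sup>2" using powr_minus[of "R x" k] by (simp add: field_simps)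
    then show "R x powr (k + 1) = R x / (s x)\<^sup>2"
      using r by (simp add: powr_add)
  qed
  have s1': "(s1 has_real_derivative \<kappa>\<^sup>2 * s x) (at x)" if x: "0 < x" for x
  proof -
    note r = Rpos[OF x]
    have d1: "((\<lambda>x. R x powr (- k / 2 - 1)) has_real_derivative (- k / 2 - 1) * R x powr (- k / 2 - 1 - 1) * (2 * P x)) (at x)"
      unfolding P_def by (rule DERIV_chain2[OF has_real_derivative_powr[OF r] R_derivative[OF x]])
    have "(s1 has_real_derivative
        - k * ((- k / 2 - 1) * R x powr (- k / 2 - 1 - 1) * (2 * P x)) * P x
        + - k * R x powr (- k / 2 - 1) * (2 * \<omega> * R x - (k + 2) / (k + 1) * R x powr (k + 1))) (at x)"
      unfolding s1_def by (rule DERIV_cong[OF DERIV_mult[OF DERIV_cmult[OF d1] P'[OF x]]]) (simp add: algebra_simps)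
    moreover have "- k * ((- k / 2 - 1) * R x powr (- k / 2 - 1 - 1) * (2 * P x)) * P x
        + - k * R x powr (- k / 2 - 1) * (2 * \<omega> * R x - (k + 2) / (k + 1) * R x powr (k + 1)) = \<kappa>\<^sup>2 * s x"
    proof -
      have "- k * ((- k / 2 - 1) * R x powr (- k / 2 - 1 - 1) * (2 * P x)) * P x
          = k * (k + 2) * R x powr (- k / 2 - 1 - 1) * (P x)\<^sup>2"
        by (simp add: power2_eq_square algebra_simps)
      also have "\<dots> = k * (k + 2) * (s x / (R x)\<^sup>2) * (R x * (\<omega> * R x - (R x / (s x)\<^sup>2) / (k + 1)))"
        unfolding P2[OF x] pw[OF x] ..
      also have "\<dots> = k * (k + 2) * s x * (\<omega> - (1 / (s x)\<^sup>2) / (k + 1))"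
        using r by (simp add: power2_eq_square field_simps)
      finally have a: "- k * ((- k / 2 - 1) * R x powr (- k / 2 - 1 - 1) * (2 * P x)) * P x
          = k * (k + 2) * s x * (\<omega> - (1 / (s x)\<^sup>2) / (k + 1))" .
      have b: "- k * R x powr (- k / 2 - 1) * (2 * \<omega> * R x - (k + 2) / (k + 1) * R x powr (k + 1))
          = - k * s x * (2 * \<omega> - (k + 2) / (k + 1) * (1 / (s x)\<^sup>2))"
      proof -
        define C where "C = (k + 2) / (k + 1)"
        have "2 * \<omega> * R x - C * (R x / (s x)\<^sup>2) = R x * (2 * \<omega> - C * (1 / (s x)\<^sup>2))"
          by (simp add: right_diff_distrib)
        moreover have "- k * (s x / R x) * (R x * Y) = - k * s x * Y" for Y using r by simp
        ultimately show ?thesis unfolding pw[OF x] C_def[symmetric] by (simp only:)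
      qed
      define Z where "Z = (1 / (s x)\<^sup>2) / (k + 1)"
      have Z: "(k + 2) / (k + 1) * (1 / (s x)\<^sup>2) = (k + 2) * Z" by (simp add: Z_def)
      show ?thesis unfolding a b \<kappa>(2) Z Z_def[symmetric] by (simp add: algebra_simps power2_eq_square)
    qed
    ultimately show ?thesis by simp
  qed
  have s1sq: "(s1 x)\<^sup>2 = \<kappa>\<^sup>2 * (s x)\<^sup>2 - k\<^sup>2 / (k + 1)" if x: "0 < x" for x
  proof -
    have "(s1 x)\<^sup>2 = k\<^sup>2 * (s x / R x)\<^sup>2 * (R x * (\<omega> * R x - (R x / (s x)\<^sup>2) / (k + 1)))"
      unfolding s1_def power_mult_distrib P2[OF x] pw[OF x] by simp
    also have "\<dots> = k\<^sup>2 * (s x)\<^sup>2 * (\<omega> - (1 / (s x)\<^sup>2) / (k + 1))"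
      using Rpos[OF x] by (simp add: power2_eq_square field_simps)
    also have "\<dots> = \<kappa>\<^sup>2 * (s x)\<^sup>2 - k\<^sup>2 / (k + 1)"
      using spos[OF x] k unfolding \<kappa>(2) by (simp add: right_diff_distrib mult_ac)
    finally show ?thesis .
  qed
  \<comment> \<open>Each of the two first order factors of \<open>s'' = \<kappa>\<^sup>2 s\<close> gives a first integral.\<close>
  have lin: "\<exists>C. \<forall>x>0. (s1 x + e * s x) * exp (- e * x) = C" if e: "e\<^sup>2 = \<kappa>\<^sup>2" for e
  proof (rule half_line_zero_derivative)
    have ee: "\<kappa>\<^sup>2 = e * e" using e by (simp add: power2_eq_square)
    fix x :: real assume x: "0 < x"
    have ex: "((\<lambda>x. exp (- e * x)) has_real_derivative exp (- e * x) * (- e)) (at x)"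
      by (auto intro!: derivative_eq_intros)
    have "((\<lambda>x. (s1 x + e * s x) * exp (- e * x)) has_real_derivative 0) (at x)"
      by (rule DERIV_cong[OF DERIV_mult[OF DERIV_add[OF s1'[OF x] DERIV_cmult[OF s'[OF x]]] ex]])
        (simp add: algebra_simps ee)
    then show "((\<lambda>x. (s1 x + e * s x) * exp (- e * x)) has_vector_derivative 0) (at x)"
      by (simp add: has_real_derivative_iff_has_vector_derivative)
  qed
  obtain A where A: "\<And>x. 0 < x \<Longrightarrow> (s1 x + \<kappa> * s x) * exp (- \<kappa> * x) = A" using lin[of \<kappa>] by blast
  obtain B where B: "\<And>x. 0 < x \<Longrightarrow> (s1 x - \<kappa> * s x) * exp (\<kappa> * x) = B" using lin[of "- \<kappa>"] by auto
  have AB: "A * B = - (k\<^sup>2 / (k + 1))"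
  proof -
    have "A * B = ((s1 1)\<^sup>2 - \<kappa>\<^sup>2 * (s 1)\<^sup>2) * (exp (- \<kappa>) * exp \<kappa>)"
      unfolding A[OF zero_less_one, symmetric] B[OF zero_less_one, symmetric]
      by (simp add: algebra_simps power2_eq_square)
    then show ?thesis using s1sq[of 1] by (simp add: mult_exp_exp)
  qed
  have sol: "2 * \<kappa> * s x = A * exp (\<kappa> * x) - B * exp (- \<kappa> * x)" if x: "0 < x" for x
  proof -
    have "A * exp (\<kappa> * x) = (s1 x + \<kappa> * s x) * (exp (- \<kappa> * x) * exp (\<kappa> * x))"
      unfolding A[OF x, symmetric] by (simp only: mult.assoc)
    moreover have "B * exp (- \<kappa> * x) = (s1 x - \<kappa> * s x) * (exp (\<kappa> * x) * exp (- \<kappa> * x))"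
      unfolding B[OF x, symmetric] by (simp only: mult.assoc)
    ultimately show ?thesis by (simp add: mult_exp_exp algebra_simps)
  qed
  have ABneg: "A * B < 0" using AB k by simp
  have Apos: "0 < A" and Bneg: "B < 0"
  proof -
    have "0 < 2 * \<kappa> * s 1" using spos[of 1] \<kappa>(1) by simp
    then have "0 < A * exp \<kappa> - B * exp (- \<kappa>)" using sol[of 1] by simp
    moreover have "A * exp \<kappa> - B * exp (- \<kappa>) < 0" if "A < 0"
    proof -
      have "0 < B" using ABneg that by (simp add: mult_less_0_iff)
      then show ?thesis using that by (simp add: mult_neg_pos diff_strict_mono less_trans[of _ 0])
    qed
    ultimately have "\<not> A < 0" by fastforce
    then show "0 < A" "B < 0" using ABneg by (auto simp: mult_less_0_iff)
  qed
  define D where "D = sqrt (k\<^sup>2 / (k + 1))"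
  have Dsq: "D * D = A * (- B)" using AB k by (simp add: D_def)
  have Dpos: "0 < D" using k by (simp add: D_def)
  \<comment> \<open>The shift that makes the two exponentials a symmetric pair of amplitude \<open>D\<close>.\<close>
  define a where "a = ln (A / D) / \<kappa>"
  have ea: "D * exp (\<kappa> * a) = A" "D * exp (- \<kappa> * a) = - B"
  proof -
    have e: "exp (\<kappa> * a) = A / D" using \<kappa> Apos Dpos by (simp add: a_def)
    then show "D * exp (\<kappa> * a) = A" using Dpos by simp
    have "exp (- \<kappa> * a) = D / A" using e by (simp add: exp_minus)
    moreover have "D * (D / A) = - B" using Apos by (simp add: Dsq)
    ultimately show "D * exp (- \<kappa> * a) = - B" by (simp only:)
  qed
  have s_cosh: "\<kappa> * s x = D * cosh (\<kappa> * (x + a))" if x: "0 < x" for x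
  proof -
    have "2 * (D * cosh (\<kappa> * (x + a))) = (D * exp (\<kappa> * a)) * exp (\<kappa> * x) + (D * exp (- \<kappa> * a)) * exp (- \<kappa> * x)"
      by (simp add: cosh_def distrib_left exp_add[symmetric] mult.assoc mult_exp_exp add.commute)
    then show ?thesis using sol[OF x] unfolding ea by simp
  qed
  have "norm (f x) = phi p \<omega> a x" if x: "0 < x" for x
  proof -
    have "norm (f x) = R x powr (1 / 2)" by (rule R_half[symmetric])
    also have "\<dots> = s x powr (- 1 / k)" using k by (simp add: s_def powr_powr)
    also have "s x = sqrt (1 / (\<omega> * (k + 1))) * cosh (\<kappa> * (x + a))"
    proof -
      have "s x = D / \<kappa> * cosh (\<kappa> * (x + a))" using s_cosh[OF x] \<kappa> by (simp add: field_simps)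
      moreover have "D / \<kappa> = sqrt (1 / (\<omega> * (k + 1)))"
        using k \<omega> by (simp add: D_def \<kappa>_def real_sqrt_divide real_sqrt_mult)
      ultimately show ?thesis by simp
    qed
    also have "(sqrt (1 / (\<omega> * (k + 1))) * cosh (\<kappa> * (x + a))) powr (- 1 / k)
      = sqrt (1 / (\<omega> * (k + 1))) powr (- 1 / k) * cosh (\<kappa> * (x + a)) powr (- 1 / k)"
      by (rule powr_mult)
    also have "sqrt (1 / (\<omega> * (k + 1))) powr (- 1 / k) = (\<omega> * (k + 1)) powr (1 / (2 * k))"
    proof -
      have "sqrt (1 / (\<omega> * (k + 1))) = (\<omega> * (k + 1)) powr (- 1 / 2)"
        using powr_minus[of "\<omega> * (k + 1)" "1 / 2"] powr_half_sqrt[of "\<omega> * (k + 1)"] k \<omega>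
          real_sqrt_divide[of 1 "\<omega> * (k + 1)"]
        by (simp only: real_sqrt_one inverse_eq_divide minus_divide_left) simp
      then show ?thesis using k by (simp add: powr_powr)
    qed
    also have "(\<omega> * (k + 1)) powr (1 / (2 * k)) = ((p + 1) * \<omega> / 2) powr (1 / (p - 1))"
    proof -
      have "\<omega> * (k + 1) = (p + 1) * \<omega> / 2" "2 * k = p - 1" by (simp_all add: pk field_simps)
      then show ?thesis by (simp only:)
    qed
    also have "cosh (\<kappa> * (x + a)) powr (- 1 / k) = cosh (rate p \<omega> * (x + a)) powr (- 2 / (p - 1))"
    proof -
      have "- 1 / k = - 2 / (p - 1)" by (simp add: k_def)
      moreover have "\<kappa> = rate p \<omega>" by (simp add: \<kappa>_def rate_def k_def)
      ultimately show ?thesis by (simp only:)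
    qed
    finally show ?thesis unfolding phi_cosh[OF p \<omega>] .
  qed
  then show ?thesis by blast
qed

lemma classification:
  "(\<forall>x>0. f x = 0) \<or> (\<exists>c a. norm c = 1 \<and> (\<forall>x>0. f x = c * of_real (phi p \<omega> a x)))"
proof (cases "\<exists>x>0. f x = 0")
  case True
  then show ?thesis using zero_everywhere by blast
next
  case False
  then have nz: "\<And>x. 0 < x \<Longrightarrow> f x \<noteq> 0" by blast
  obtain c where c: "norm c = 1" "\<And>x. 0 < x \<Longrightarrow> f x = c * of_real (norm (f x))"
    using phase_constant[OF nz] by blast
  obtain a where a: "\<And>x. 0 < x \<Longrightarrow> norm (f x) = phi p \<omega> a x"
    using norm_eq_phi[OF nz] by blast
  have "f x = c * of_real (phi p \<omega> a x)" if "0 < x" for x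
    using c(2)[OF that] unfolding a[OF that] .
  then show ?thesis using c(1) by blast
qed

end

section \<open>The profiles of a minimizer\<close>

lemma continuous_on_nonlin:
  assumes "1 < p" "continuous_on S h" shows "continuous_on S (\<lambda>x. nonlin p (h x))"
proof -
  have "continuous_on S (\<lambda>x. norm (h x) powr (p - 1))"
    by (rule continuous_on_powr'[OF continuous_on_norm[OF assms(2)] continuous_on_const])
      (use assms(1) in auto)
  then show ?thesis
    unfolding nonlin_def by (intro continuous_on_mult continuous_on_of_real assms(2))
qed

lemma measurable_half_line_continuous:
  "continuous_on {0<..} h \<Longrightarrow> h \<in> borel_measurable half_line"
  by (rule continuous_imp_measurable_on_sets_lebesgue) auto

text \<open>Two applications of the regularity result for weak derivatives show that the continuous
  representative is twice continuously differentiable, so that the classification of the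
  solutions applies.\<close>

lemma edge_profile:
  assumes p: "1 < p" and \<omega>: "0 < \<omega>" and u: "H1_data u g c"
    and eq: "has_weak_derivative g (\<lambda>x. of_real \<omega> * u x - nonlin p (u x))"
  shows "\<exists>z a. (z = 0 \<or> norm z = 1) \<and> (AE x in half_line. u x = z * of_real (phi p \<omega> a x))"
proof -
  let ?k = "\<lambda>x. of_real \<omega> * u x - nonlin p (u x)"
  have u2: "u \<in> Lq_half_line 2" and g2: "g \<in> Lq_half_line 2" and wd: "has_weak_derivative u g"
    using u by (auto simp: H1_data_def)
  obtain h where h: "continuous_on {0..} h" "AE x in half_line. u x = h x"
      "\<And>x y. 0 \<le> x \<Longrightarrow> x \<le> y \<Longrightarrow> h y - h x = integral {x..y} g"
    using weak_derivative_continuous_representative[OF wd g2] by blast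
  have hc: "continuous_on {0<..} h" by (rule continuous_on_subset[OF h(1)]) auto
  obtain c2 where c2: "AE x in half_line. g x = c2 + primitive ?k x"
    using weak_derivative_primitive[OF eq] by blast
  define G where "G x = c2 + primitive ?k x" for x
  have gG: "AE x in half_line. g x = G x" using c2 by (simp add: G_def)
  note lg = has_weak_derivative_locally_integrable(2)[OF wd]
    and lk = has_weak_derivative_locally_integrable(2)[OF eq]
  have G': "(G has_vector_derivative of_real \<omega> * h x - nonlin p (h x)) (at x)" if x: "0 < x" for x
  proof -
    have "(primitive ?k has_vector_derivative of_real \<omega> * h x - nonlin p (h x)) (at x)"
    proof (rule primitive_has_vector_derivative[OF lk x])
      show "AE x in half_line. ?k x = of_real \<omega> * h x - nonlin p (h x)"
        using h(2) by eventually_elim simp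
      show "continuous_on {0<..} (\<lambda>x. of_real \<omega> * h x - nonlin p (h x))"
        by (intro continuous_on_diff continuous_on_mult continuous_on_const continuous_on_nonlin p hc)
    qed
    then show ?thesis unfolding G_def by (auto intro!: derivative_eq_intros)
  qed
  have Gc: "continuous_on {0<..} G"
    by (intro continuous_at_imp_continuous_on ballI has_vector_derivative_continuous[OF G']) simp
  have h': "(h has_vector_derivative G x) (at x)" if x: "0 < x" for x
  proof -
    have "((\<lambda>x. (h 1 - primitive g 1) + primitive g x) has_vector_derivative G x) (at x)"
      using primitive_has_vector_derivative[OF lg x gG Gc] by (auto intro!: derivative_eq_intros)
    then show ?thesis
    proof (rule has_vector_derivative_transform_within_open)
      show "open {0::real<..}" "x \<in> {0<..}" using x by auto
      fix y :: real assume "y \<in> {0<..}"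
      then show "(h 1 - primitive g 1) + primitive g y = h y"
        using h(3)[of 1 y] h(3)[of y 1] primitive_diff[OF lg, of 1 y] primitive_diff[OF lg, of y 1]
        by (cases "1 \<le> y") (auto simp: algebra_simps)
    qed
  qed
  have hm: "h \<in> borel_measurable half_line" and Gm: "G \<in> borel_measurable half_line"
    by (rule measurable_half_line_continuous[OF hc], rule measurable_half_line_continuous[OF Gc])
  have h2: "h \<in> Lq_half_line 2"
    unfolding Lq_2_iff
    using hm Lq_2_D[OF u2] h(2)
    by (auto elim!: eventually_mono intro!: integrable_cong_AE[THEN iffD1, rotated 3, OF Lq_2_D(2)[OF u2]])
  have G2: "G \<in> Lq_half_line 2"
    unfolding Lq_2_iff
    using Gm Lq_2_D[OF g2] gG
    by (auto elim!: eventually_mono intro!: integrable_cong_AE[THEN iffD1, rotated 3, OF Lq_2_D(2)[OF g2]])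
  have hp: "integrable half_line (\<lambda>x. norm (h x) powr (p + 1))"
    using hm Lq_2_D(1)[OF u2] h(2)
    by (auto elim!: eventually_mono intro!: integrable_cong_AE[THEN iffD1, rotated 3, OF H1_data_powr_integrable(1)[OF u p]])
  interpret stationary p \<omega> h G
    by unfold_locales (use p \<omega> h' G' Lq_2_D(2)[OF h2] Lq_2_D(2)[OF G2] hp integrable_Lq_2_mult[OF h2 G2] in auto)
  have "\<exists>z a. (z = 0 \<or> norm z = 1) \<and> (\<forall>x>0. h x = z * of_real (phi p \<omega> a x))"
    using classification by (metis mult_zero_left)
  then obtain z a where za: "z = 0 \<or> norm z = 1" "\<And>x. 0 < x \<Longrightarrow> h x = z * of_real (phi p \<omega> a x)" by blast
  have "AE x in half_line. u x = z * of_real (phi p \<omega> a x)"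
    using h(2) AE_space[of half_line] by eventually_elim (use za(2) in auto)
  with za(1) show ?thesis by blast
qed

lemma H1_data_AE_unique:
  assumes f: "H1_data f g c" and f': "H1_data f' g' c'" and eq: "AE x in half_line. f x = f' x"
  shows "c = c'" "AE x in half_line. g x = g' x"
proof -
  obtain h h' where hh: "continuous_on {0..} h" "AE x in half_line. f x = h x" "h 0 = c"
      "continuous_on {0..} h'" "AE x in half_line. f' x = h' x" "h' 0 = c'"
    using f f' unfolding H1_data_def by blast
  have "AE x in half_line. h x = h' x"
    using eq hh(2,5) by eventually_elim simp
  from AE_half_line_continuous_eq[OF this hh(1,4), of 0] hh show "c = c'" by simp
  have w: "has_weak_derivative (\<lambda>x. f x + (- 1) * f' x) (\<lambda>x. g x + (- 1) * g' x)"
    using f f' by (intro has_weak_derivative_add) (auto simp: H1_data_def)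
  have "AE x in half_line. g x + (- 1) * g' x = 0"
  proof (rule AE_zero_if_test_integrals_zero)
    show "locally_integrable (\<lambda>x. g x + (- 1) * g' x)" by (rule has_weak_derivative_locally_integrable(2)[OF w])
    fix \<psi> assume \<psi>: "test_function \<psi>"
    have "AE x in half_line. (f x + (- 1) * f' x) * of_real (deriv \<psi> x) = 0"
      using eq by eventually_elim simp
    then have "(LINT x|half_line. (f x + (- 1) * f' x) * of_real (deriv \<psi> x)) = 0"
      by (rule integral_eq_zero_AE)
    moreover have "(LINT x|half_line. (f x + (- 1) * f' x) * of_real (deriv \<psi> x))
        = - (LINT x|half_line. (g x + (- 1) * g' x) * of_real (\<psi> x))"
      using w \<psi> unfolding has_weak_derivative_iff by blast
    ultimately show "(LINT x|half_line. (g x + (- 1) * g' x) * of_real (\<psi> x)) = 0" by simp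
  qed
  then show "AE x in half_line. g x = g' x" by eventually_elim simp
qed

text \<open>All functionals depend only on classes of functions up to null sets; minimality can thus be passed on to
  the explicit profiles, whose derivatives and boundary values are known.\<close>

lemma is_minimizer_cong:
  assumes min: "is_minimizer N p \<beta> \<omega> u" and p: "1 < p"
    and u: "graph_data N u g c" and v: "graph_data N v g' c'" and eq: "graph_eq N u v"
  shows "is_minimizer N p \<beta> \<omega> v"
proof -
  have p0: "0 < p" using p by simp
  have data: "H1_data (u j) (g j) (c j)" "H1_data (v j) (g' j) (c' j)" "AE x in half_line. u j x = v j x"
    if "j \<in> {1..N}" for j
    using u v eq that by (auto simp: graph_data_def graph_eq_def)
  have m: "u j \<in> borel_measurable half_line" "g j \<in> borel_measurable half_line"
      "v j \<in> borel_measurable half_line" "g' j \<in> borel_measurable half_line" if "j \<in> {1..N}" for j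
    using data(1,2)[OF that] Lq_2_D(1) by (auto simp: H1_data_def)
  have e1: "(\<Sum>j=1..N. c j) = (\<Sum>j=1..N. c' j)"
    by (intro sum.cong refl H1_data_AE_unique(1)[OF data])
  have e2: "(\<Sum>j=1..N. sq_integral (g j) + \<omega> * sq_integral (u j)) = (\<Sum>j=1..N. sq_integral (g' j) + \<omega> * sq_integral (v j))"
  proof (intro sum.cong refl)
    fix j assume j: "j \<in> {1..N}"
    have "sq_integral (g j) = sq_integral (g' j)"
      by (rule sq_integral_cong_AE[OF m(2)[OF j] H1_data_AE_unique(2)[OF data[OF j]] m(4)[OF j]])
    moreover have "sq_integral (u j) = sq_integral (v j)"
      by (rule sq_integral_cong_AE[OF m(1)[OF j] data(3)[OF j] m(3)[OF j]])
    ultimately show "sq_integral (g j) + \<omega> * sq_integral (u j) = sq_integral (g' j) + \<omega> * sq_integral (v j)" by simp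
  qed
  have q: "quad N \<beta> \<omega> u g c = quad N \<beta> \<omega> v g' c'" unfolding quad_def e1 e2 ..
  have n: "pow_total N p u = pow_total N p v"
    unfolding pow_total_def
  proof (intro sum.cong refl)
    fix j assume j: "j \<in> {1..N}"
    show "pow_integral p (u j) = pow_integral p (v j)"
      unfolding pow_integral_def
    proof (rule integral_cong_AE)
      show "AE x in half_line. norm (u j x) powr (p + 1) = norm (v j x) powr (p + 1)"
        using data(3)[OF j] by eventually_elim simp
    qed (use m[OF j] in measurable)
  qed
  have un: "u \<in> nehari_set N p \<beta> \<omega>" and ud: "S_omega N p \<beta> \<omega> u = d_omega N p \<beta> \<omega>"
    using min by (auto simp: is_minimizer_def)
  have "v \<in> H1_graph N" using v H1_data_H1_half_line by (auto simp: H1_graph_def graph_data_def)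
  moreover have "\<not> graph_eq N v (\<lambda>j x. 0)"
    using un pow_total_eq_0_iff[OF u p] pow_total_eq_0_iff[OF v p] n by (simp add: nehari_set_def)
  moreover have "I_omega N p \<beta> \<omega> v = 0"
    using un by (simp add: nehari_set_def I_omega_data[OF u p0] I_omega_data[OF v p0] q n)
  moreover have "S_omega N p \<beta> \<omega> v = d_omega N p \<beta> \<omega>"
    using ud by (simp add: S_omega_data[OF u p0] S_omega_data[OF v p0] q n)
  ultimately show ?thesis by (simp add: is_minimizer_def nehari_set_def)
qed

lemma minimizer_profiles:
  assumes min: "is_minimizer N p \<beta> \<omega> u" and p: "1 < p" and \<omega>: "0 < \<omega>"
  shows "\<exists>z a. (\<forall>j\<in>{1..N}. z j = 0 \<or> norm (z j) = 1) \<and>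
    graph_eq N u (\<lambda>j x. z j * of_real (phi p \<omega> (a j) x)) \<and>
    is_minimizer N p \<beta> \<omega> (\<lambda>j x. z j * of_real (phi p \<omega> (a j) x))"
proof -
  have "u \<in> H1_graph N" using min by (auto simp: is_minimizer_def nehari_set_def)
  then obtain g c where u: "graph_data N u g c" using H1_graph_data by blast
  have "\<forall>j\<in>{1..N}. \<exists>z a. (z = 0 \<or> norm z = 1) \<and> (AE x in half_line. u j x = z * of_real (phi p \<omega> a x))"
  proof
    fix j assume j: "j \<in> {1..N}"
    then have uj: "H1_data (u j) (g j) (c j)" using u by (auto simp: graph_data_def)
    show "\<exists>z a. (z = 0 \<or> norm z = 1) \<and> (AE x in half_line. u j x = z * of_real (phi p \<omega> a x))"
      by (rule edge_profile[OF p \<omega> uj minimizer_weak_equation[OF min p u j]])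
  qed
  from bchoice[OF this] obtain z where
    z: "\<forall>j\<in>{1..N}. \<exists>a. (z j = 0 \<or> norm (z j) = 1) \<and> (AE x in half_line. u j x = z j * of_real (phi p \<omega> a x))" ..
  from bchoice[OF z] obtain a where za: "\<forall>j\<in>{1..N}. (z j = 0 \<or> norm (z j) = 1) \<and> (AE x in half_line. u j x = z j * of_real (phi p \<omega> (a j) x))" ..
  have eq: "graph_eq N u (\<lambda>j x. z j * of_real (phi p \<omega> (a j) x))" using za by (simp add: graph_eq_def)
  have "graph_data N (\<lambda>j x. z j * of_real (phi p \<omega> (a j) x)) (\<lambda>j x. z j * of_real (dphi p \<omega> (a j) x))
      (\<lambda>j. z j * of_real (phi p \<omega> (a j) 0))"
    unfolding graph_data_def by (intro ballI H1_data_scale[OF H1_data_phi[OF p \<omega>]])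
  from is_minimizer_cong[OF min p u this eq] za eq show ?thesis by blast
qed

section \<open>The vertex condition\<close>

lemma pairing_self: "pairing f f = of_real (sq_integral f)"
proof -
  have "cnj (f x) * f x = of_real ((norm (f x))\<^sup>2)" for x
    unfolding complex_norm_square by (rule mult.commute)
  then show ?thesis unfolding pairing_def sq_integral_def by (simp only: integral_complex_of_real)
qed

lemma pairing_nonlin_self: "pairing (\<lambda>x. nonlin p (f x)) f = of_real (pow_integral p f)"
proof -
  have "cnj (nonlin p (f x)) * f x = of_real (norm (f x) powr (p + 1))" for x
    unfolding norm_powr_split nonlin_def of_real_mult complex_norm_square by (simp add: mult_ac)
  then show ?thesis unfolding pairing_def pow_integral_def by (simp only: integral_complex_of_real)
qed

text \<open>Turning the phase on one edge changes only the vertex term, which is attractive; so a small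
  rotation cannot increase the modulus of the sum of the boundary values.  To second order in the angle this is
  the inequality below, which prevents partial cancellation in that sum.\<close>

lemma minimizer_phase:
  assumes min: "is_minimizer N p \<beta> \<omega> u" and p: "1 < p" and \<beta>: "\<beta> < 0" and u: "graph_data N u g c"
    and j: "j \<in> {1..N}"
  shows "(norm (c j))\<^sup>2 \<le> Re (cnj (\<Sum>i=1..N. c i) * c j)"
proof -
  define B where "B = (\<Sum>i=1..N. c i)"
  define X where "X = Re (cnj B * c j)"
  define Y where "Y = Im (cnj B * c j)"
  define n0 where "n0 = pow_total N p u"
  define E where "E t = (norm (B + (cis t * c j - c j)))\<^sup>2 - (norm B)\<^sup>2" for t
  note m = minimizer_inequality[OF min p u]
  have n0: "0 < n0" "quad N \<beta> \<omega> u g c = n0" using m by (auto simp: n0_def)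
  have uj: "H1_data (u j) (g j) (c j)" using u j by (auto simp: graph_data_def)
  have le: "E t \<le> 0" if pos: "0 < n0 + (1 / \<beta>) * E t" for t
  proof -
    let ?v = "u(j := \<lambda>x. cis t * u j x)" and ?g = "g(j := \<lambda>x. cis t * g j x)" and ?c = "c(j := cis t * c j)"
    have data: "graph_data N ?v ?g ?c" by (intro graph_data_upd u H1_data_scale uj)
    have n: "pow_total N p ?v = n0"
      unfolding pow_total_upd[OF j] pow_integral_scale n0_def by simp
    have q: "quad N \<beta> \<omega> ?v ?g ?c = n0 + (1 / \<beta>) * E t"
      unfolding quad_upd[OF j] n0(2) sq_integral_scale E_def B_def by simp
    have "n0 powr ((p - 1) / (p + 1)) * n0 powr (2 / (p + 1)) \<le> n0 + (1 / \<beta>) * E t"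
      using m(3)[OF data] pos n0 unfolding n q n0_def[symmetric] by simp
    moreover have "n0 powr ((p - 1) / (p + 1)) * n0 powr (2 / (p + 1)) = n0"
      by (rule powr_complementary_exponents[OF n0(1) p])
    ultimately have "0 \<le> (1 / \<beta>) * E t" by simp
    then show ?thesis using \<beta> by (simp add: zero_le_divide_iff)
  qed
  have E: "E t = 2 * (1 - cos t) * ((norm (c j))\<^sup>2 - X) - 2 * sin t * Y" for t
  proof -
    have 1: "(norm (B + w))\<^sup>2 - (norm B)\<^sup>2 = 2 * Re (cnj B * w) + (norm w)\<^sup>2" for w
      unfolding cmod_power2 by (simp add: power2_eq_square algebra_simps)
    have 2: "Re (cnj B * (cis t * c j - c j)) = (cos t - 1) * X - sin t * Y"
      unfolding X_def Y_def by (simp add: algebra_simps)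
    have 3: "(norm (cis t * c j - c j))\<^sup>2 = 2 * (1 - cos t) * (norm (c j))\<^sup>2"
    proof -
      have "cis t * c j - c j = (cis t - 1) * c j" by (simp add: algebra_simps)
      moreover have "(norm (cis t - 1))\<^sup>2 = 2 * (1 - cos t)"
      proof -
        have "(norm (cis t - 1))\<^sup>2 = (cos t)\<^sup>2 + (sin t)\<^sup>2 + 1 - 2 * cos t"
          unfolding cmod_power2 by (simp add: power2_eq_square algebra_simps)
        then show ?thesis by (simp add: sin_cos_squared_add2)
      qed
      ultimately show ?thesis by (simp add: norm_mult power_mult_distrib)
    qed
    show ?thesis unfolding E_def 1 2 3 by (simp add: algebra_simps)
  qed
  have "((\<lambda>t. n0 + (1 / \<beta>) * (2 * (1 - cos t) * ((norm (c j))\<^sup>2 - X) - 2 * sin t * Y)) \<longlongrightarrow>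
      n0 + (1 / \<beta>) * (2 * (1 - cos 0) * ((norm (c j))\<^sup>2 - X) - 2 * sin 0 * Y)) (at 0)"
    by (intro tendsto_intros)
  then have "((\<lambda>t. n0 + (1 / \<beta>) * E t) \<longlongrightarrow> n0) (at 0)" unfolding E by simp
  from order_tendstoD(1)[OF this n0(1)]
  obtain e where e: "0 < e" "\<And>t. t \<noteq> 0 \<Longrightarrow> \<bar>t\<bar> < e \<Longrightarrow> 0 < n0 + (1 / \<beta>) * E t"
    unfolding eventually_at by (auto simp: dist_real_def)
  define t where "t = min (e / 2) 1"
  have t: "0 < t" "t < e" "t \<le> 1" using e(1) by (auto simp: t_def)
  \<comment> \<open>The sum of both conditions no longer contains the term of first order.\<close>
  have "E t \<le> 0" "E (- t) \<le> 0" using t by (auto intro!: le e(2))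
  moreover have "E t + E (- t) = 4 * ((1 - cos t) * ((norm (c j))\<^sup>2 - X))"
    unfolding E cos_minus sin_minus by (simp add: algebra_simps)
  ultimately have "(1 - cos t) * ((norm (c j))\<^sup>2 - X) \<le> 0" by linarith
  moreover have "cos t < 1"
    using cos_monotone_0_pi[of 0 t] t pi_gt3 by simp
  ultimately show ?thesis by (simp add: mult_le_0_iff X_def B_def)
qed

text \<open>The Euler-Lagrange equation tested with the solution itself, on one edge, gives
  \<open>cnj B z\<^sub>j = \<beta> \<phi>'(0)\<close> for the vertex sum \<open>B\<close>.  By the preceding lemma the right-hand side is positive, so
  all phases agree with that of \<open>B\<close>.  On an edge where the solution vanished, a soliton as test
  function would give \<open>B = 0\<close>.\<close>

lemma minimizer_vertex:
  assumes min: "is_minimizer N p \<beta> \<omega> (\<lambda>j x. z j * of_real (phi p \<omega> (a j) x))"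
    and p: "1 < p" and \<omega>: "0 < \<omega>" and \<beta>: "\<beta> < 0"
    and z: "\<And>j. j \<in> {1..N} \<Longrightarrow> z j = 0 \<or> norm (z j) = 1"
  shows "\<exists>\<zeta>. norm \<zeta> = 1 \<and> (\<forall>j\<in>{1..N}. z j = \<zeta>) \<and>
    (\<forall>j\<in>{1..N}. \<beta> * dphi p \<omega> (a j) 0 = (\<Sum>i=1..N. phi p \<omega> (a i) 0))"
proof -
  define u where "u j x = z j * of_real (phi p \<omega> (a j) x)" for j x
  define g where "g j x = z j * of_real (dphi p \<omega> (a j) x)" for j x
  define c where "c j = z j * of_real (phi p \<omega> (a j) 0)" for j
  define B where "B = (\<Sum>i=1..N. c i)"
  have min: "is_minimizer N p \<beta> \<omega> u" using min unfolding u_def .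
  have u: "graph_data N u g c"
    unfolding graph_data_def u_def g_def c_def by (intro ballI H1_data_scale[OF H1_data_phi[OF p \<omega>]])
  have unit: "cnj B * z j = of_real (\<beta> * dphi p \<omega> (a j) 0) \<and> 0 < \<beta> * dphi p \<omega> (a j) 0"
    if j: "j \<in> {1..N}" and zj: "z j \<noteq> 0" for j
  proof -
    let ?b = "phi p \<omega> (a j) 0" and ?d = "dphi p \<omega> (a j) 0"
    have n1: "norm (z j) = 1" using z[OF j] zj by simp
    have b: "0 < ?b" by (rule phi_pos[OF p \<omega>])
    have uj: "H1_data (u j) (g j) (c j)" using u j by (auto simp: graph_data_def)
    have "of_real (sq_integral (g j)) + of_real \<omega> * of_real (sq_integral (u j)) - of_real (pow_integral p (u j))
        + of_real (1 / \<beta>) * (cnj B * c j) = 0"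
      using minimizer_euler_lagrange[OF min p u j uj] unfolding pairing_self pairing_nonlin_self B_def .
    moreover have "sq_integral (g j) + \<omega> * sq_integral (u j) - pow_integral p (u j) = - (?b * ?d)"
      using phi_virial[OF p \<omega>, of "a j"]
      unfolding u_def g_def sq_integral_scale pow_integral_scale n1 by simp
    ultimately have "of_real (- (?b * ?d)) + of_real (1 / \<beta>) * (cnj B * c j) = 0"
      by (metis of_real_add of_real_diff of_real_mult)
    then have "of_real (1 / \<beta>) * (cnj B * c j) = of_real (?b * ?d)"
      by (simp add: neg_eq_iff_add_eq_0)
    then have "of_real \<beta> * (of_real (1 / \<beta>) * (cnj B * c j)) = of_real \<beta> * of_real (?b * ?d)" by (simp only:)
    then have BC: "cnj B * c j = of_real (\<beta> * (?b * ?d))"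
      using \<beta> by (simp add: mult.assoc[symmetric] flip: of_real_mult)
    have le: "?b\<^sup>2 \<le> \<beta> * (?b * ?d)"
      using minimizer_phase[OF min p \<beta> u j] unfolding B_def[symmetric] BC
      by (simp add: c_def norm_mult n1)
    have "0 < \<beta> * (?b * ?d)" by (rule less_le_trans[OF zero_less_power[OF b] le])
    then have "0 < ?b * (\<beta> * ?d)" by (simp only: mult.left_commute)
    then have pos: "0 < \<beta> * ?d" using b by (simp add: zero_less_mult_iff)
    have "of_real ?b * (cnj B * z j) = of_real ?b * of_real (\<beta> * ?d)"
      using BC by (simp add: c_def mult_ac)
    then have "cnj B * z j = of_real (\<beta> * ?d)" using b by simp
    with pos show ?thesis by blast
  qed
  have ex: "\<exists>j\<in>{1..N}. z j \<noteq> 0"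
  proof (rule ccontr)
    assume "\<not> ?thesis"
    then have "pow_total N p u = 0" by (simp add: pow_total_def u_def pow_integral_def)
    then show False using minimizer_inequality(2)[OF min p u] by simp
  qed
  then obtain k where k: "k \<in> {1..N}" "z k \<noteq> 0" by blast
  have B0: "B \<noteq> 0" using unit[OF k] by auto
  have nz: "z j \<noteq> 0" if j: "j \<in> {1..N}" for j
  proof
    assume z0: "z j = 0"
    have w: "H1_data (\<lambda>x. B * of_real (phi p \<omega> 0 x)) (\<lambda>x. B * of_real (dphi p \<omega> 0 x)) (B * of_real (phi p \<omega> 0 0))"
      by (rule H1_data_scale[OF H1_data_phi[OF p \<omega>]])
    have "of_real (1 / \<beta>) * (cnj B * (B * of_real (phi p \<omega> 0 0))) = 0"
      using minimizer_euler_lagrange[OF min p u j w]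
      by (simp add: u_def g_def z0 pairing_def nonlin_def B_def)
    then show False using B0 \<beta> phi_pos[OF p \<omega>, of 0 0] by simp
  qed
  define \<zeta> where "\<zeta> = B / of_real (norm B)"
  have nB: "norm B = \<beta> * dphi p \<omega> (a j) 0" if j: "j \<in> {1..N}" for j
  proof -
    have "norm (cnj B * z j) = \<beta> * dphi p \<omega> (a j) 0"
      using unit[OF j nz[OF j]] by (simp only: norm_of_real abs_of_pos)
    moreover have "norm (z j) = 1" using z[OF j] nz[OF j] by simp
    ultimately show ?thesis by (simp add: norm_mult)
  qed
  have z\<zeta>: "z j = \<zeta>" if j: "j \<in> {1..N}" for j
  proof -
    have "cnj B * z j = of_real (norm B)" using unit[OF j nz[OF j]] nB[OF j] by (simp only:)
    then have "B * cnj B * z j = B * of_real (norm B)" by (simp add: mult.assoc)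
    then have "of_real (norm B) * (of_real (norm B) * z j) = of_real (norm B) * B"
      by (simp add: complex_norm_square[symmetric] power2_eq_square mult_ac)
    then have "of_real (norm B) * z j = B" using B0 by simp
    then show ?thesis using B0 by (auto simp: \<zeta>_def field_simps)
  qed
  have n\<zeta>: "norm \<zeta> = 1" using B0 by (simp add: \<zeta>_def norm_divide)
  have "B = \<zeta> * of_real (\<Sum>i=1..N. phi p \<omega> (a i) 0)"
    unfolding B_def c_def of_real_sum sum_distrib_left by (intro sum.cong refl) (simp add: z\<zeta>)
  moreover have "0 \<le> (\<Sum>i=1..N. phi p \<omega> (a i) 0)"
    by (intro sum_nonneg less_imp_le phi_pos p \<omega>)
  ultimately have nB': "norm B = (\<Sum>i=1..N. phi p \<omega> (a i) 0)"
    by (simp only: norm_mult n\<zeta> norm_of_real abs_of_nonneg mult_1)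
  show ?thesis
  proof (intro exI[of _ \<zeta>] conjI ballI)
    show "\<beta> * dphi p \<omega> (a j) 0 = (\<Sum>i=1..N. phi p \<omega> (a i) 0)" if "j \<in> {1..N}" for j
      using nB[OF that] unfolding nB' by (rule sym)
  qed (use n\<zeta> z\<zeta> in auto)
qed

section \<open>Second variation\<close>

lemma second_derivative_neg:
  fixes D D' :: "real \<Rightarrow> real"
  assumes D: "\<And>s. (D has_real_derivative D' s) (at s)" and D0: "D' 0 = 0"
    and D2: "(D' has_real_derivative l) (at 0)" and "l < 0" and "0 < e"
  shows "\<exists>s. 0 < s \<and> s < e \<and> D s < D 0"
proof -
  obtain d where d: "0 < d" "\<And>h. 0 < h \<Longrightarrow> h < d \<Longrightarrow> D' (0 + h) < D' 0"
    using DERIV_neg_dec_right[OF D2 \<open>l < 0\<close>] by blast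
  define s where "s = min d e / 2"
  have s: "0 < s" "s < d" "s < e" using d(1) \<open>0 < e\<close> by (auto simp: s_def)
  have "D s < D 0"
  proof (rule DERIV_neg_imp_decreasing_open[OF s(1)])
    show "\<exists>y. (D has_real_derivative y) (at x) \<and> y < 0" if "0 < x" "x < s" for x
      using D[of x] d(2)[of x] that s D0 by auto
    show "continuous_on {0..s} D"
      by (intro continuous_at_imp_continuous_on ballI DERIV_isCont[OF D])
  qed
  with s show ?thesis by blast
qed

definition edge_energy :: "real \<Rightarrow> real \<Rightarrow> real \<Rightarrow> real"
  where "edge_energy p \<omega> a = sq_integral (\<lambda>x. of_real (dphi p \<omega> a x)) + \<omega> * sq_integral (\<lambda>x. of_real (phi p \<omega> a x))"

definition edge_power :: "real \<Rightarrow> real \<Rightarrow> real \<Rightarrow> real"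
  where "edge_power p \<omega> a = pow_integral p (\<lambda>x. of_real (phi p \<omega> a x))"

text \<open>Boundary values as functions of the shift; differentiating in the shift or in the variable is the
  same.\<close>

lemma phi_0_has_derivative:
  assumes "1 < p" "0 < \<omega>"
  shows "((\<lambda>a. phi p \<omega> a 0) has_real_derivative dphi p \<omega> a 0) (at a)"
    and "((\<lambda>a. dphi p \<omega> a 0) has_real_derivative \<omega> * phi p \<omega> a 0 - phi p \<omega> a 0 powr p) (at a)"
proof -
  have e: "(\<lambda>a. phi p \<omega> a 0) = phi p \<omega> 0" "(\<lambda>a. dphi p \<omega> a 0) = dphi p \<omega> 0"
    using phi_shift[of p \<omega> _ 0] by (auto simp: fun_eq_iff)
  have f: "phi p \<omega> a 0 = phi p \<omega> 0 a" "dphi p \<omega> a 0 = dphi p \<omega> 0 a" for a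
    using phi_shift[of p \<omega> a 0] by simp_all
  show "((\<lambda>a. phi p \<omega> a 0) has_real_derivative dphi p \<omega> a 0) (at a)"
    unfolding e f by (rule phi_has_derivative[OF assms])
  show "((\<lambda>a. dphi p \<omega> a 0) has_real_derivative \<omega> * phi p \<omega> a 0 - phi p \<omega> a 0 powr p) (at a)"
    unfolding e f by (rule dphi_has_derivative[OF assms])
qed

lemma edge_power_has_derivative:
  assumes "1 < p" "0 < \<omega>"
  shows "(edge_power p \<omega> has_real_derivative - (phi p \<omega> a 0 powr (p + 1))) (at a)"
proof -
  have "edge_power p \<omega> = (\<lambda>a. pow_integral p (\<lambda>x. of_real (phi p \<omega> a x)))"
    by (rule ext) (rule edge_power_def)
  then show ?thesis using pow_integral_phi_has_derivative[OF assms, of a] by (simp only:)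
qed

lemma edge_energy_has_derivative:
  assumes "1 < p" "0 < \<omega>"
  shows "(edge_energy p \<omega> has_real_derivative - ((dphi p \<omega> a 0)\<^sup>2 + \<omega> * (phi p \<omega> a 0)\<^sup>2)) (at a)"
proof -
  have e: "edge_energy p \<omega> = (\<lambda>a. edge_power p \<omega> a - phi p \<omega> a 0 * dphi p \<omega> a 0)"
  proof
    fix a show "edge_energy p \<omega> a = edge_power p \<omega> a - phi p \<omega> a 0 * dphi p \<omega> a 0"
      using phi_virial[OF assms, of a] by (simp add: edge_energy_def edge_power_def)
  qed
  have pp: "phi p \<omega> a 0 powr (p + 1) = phi p \<omega> a 0 * phi p \<omega> a 0 powr p"
    using phi_powr_p[OF assms, of a 0] by (simp add: power2_eq_square)
  show ?thesis unfolding e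
    by (rule DERIV_cong[OF DERIV_diff[OF edge_power_has_derivative[OF assms]
          DERIV_mult[OF phi_0_has_derivative(1)[OF assms] phi_0_has_derivative(2)[OF assms]]]])
      (simp add: pp pp[unfolded add.commute[of p 1]] power2_eq_square algebra_simps)
qed

lemma edge_power_pos:
  assumes "1 < p" "0 < \<omega>" shows "0 < edge_power p \<omega> a"
proof -
  have "\<not> edge_power p \<omega> a \<le> 0"
  proof
    assume "edge_power p \<omega> a \<le> 0"
    then have "pow_integral p (\<lambda>x. of_real (phi p \<omega> a x)) = 0"
      using pow_integral_nonneg[of p "\<lambda>x. of_real (phi p \<omega> a x)"] by (simp add: edge_power_def)
    then have "AE x in half_line. norm (complex_of_real (phi p \<omega> a x)) powr (p + 1) = 0"
      unfolding pow_integral_def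
      by (subst (asm) integral_nonneg_eq_0_iff_AE[OF H1_data_powr_integrable(1)[OF H1_data_phi[OF assms] assms(1)]]) auto
    then have "AE x in half_line. complex_of_real (phi p \<omega> a x) = 0" by eventually_elim simp
    then have "complex_of_real (phi p \<omega> a 0) = 0"
      by (rule AE_half_line_continuous_eq) (intro continuous_on_of_real phi_continuous assms continuous_on_const order_refl)+
    then show False using phi_pos[OF assms, of a 0] by simp
  qed
  then show ?thesis by simp
qed

text \<open>Within the family of profiles with a common phase and varying shifts, the minimality inequality involves only the two functions
  above and the boundary values.\<close>

lemma minimizer_shifts:
  assumes min: "is_minimizer N p \<beta> \<omega> (\<lambda>j x. \<zeta> * of_real (phi p \<omega> (a j) x))"
    and p: "1 < p" and \<omega>: "0 < \<omega>" and \<zeta>: "norm \<zeta> = 1"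
  defines "Q \<equiv> \<lambda>a. (\<Sum>j=1..N. edge_energy p \<omega> (a j)) + (1 / \<beta>) * (\<Sum>j=1..N. phi p \<omega> (a j) 0)\<^sup>2"
    and "n \<equiv> \<lambda>a. \<Sum>j=1..N. edge_power p \<omega> (a j)"
  shows "Q a = n a" "0 < n a"
    and "\<And>b. 0 < n b \<Longrightarrow> 0 < Q b \<Longrightarrow> n a powr ((p - 1) / (p + 1)) * n b powr (2 / (p + 1)) \<le> Q b"
proof -
  define v where "v b = (\<lambda>j x. \<zeta> * complex_of_real (phi p \<omega> (b j) x))" for b :: "nat \<Rightarrow> real"
  define g where "g b = (\<lambda>j x. \<zeta> * complex_of_real (dphi p \<omega> (b j) x))" for b :: "nat \<Rightarrow> real"
  define c where "c b = (\<lambda>j. \<zeta> * complex_of_real (phi p \<omega> (b j) 0))" for b :: "nat \<Rightarrow> real"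
  have data: "graph_data N (v b) (g b) (c b)" for b
    unfolding graph_data_def v_def g_def c_def by (intro ballI H1_data_scale[OF H1_data_phi[OF p \<omega>]])
  have min': "is_minimizer N p \<beta> \<omega> (v a)" using min unfolding v_def .
  have n: "pow_total N p (v b) = n b" for b
    unfolding pow_total_def n_def v_def pow_integral_scale \<zeta> edge_power_def by simp
  have q: "quad N \<beta> \<omega> (v b) (g b) (c b) = Q b" for b
  proof -
    have "(\<Sum>j=1..N. c b j) = \<zeta> * of_real (\<Sum>j=1..N. phi p \<omega> (b j) 0)"
      unfolding c_def of_real_sum sum_distrib_left ..
    then have "(norm (\<Sum>j=1..N. c b j))\<^sup>2 = (\<Sum>j=1..N. phi p \<omega> (b j) 0)\<^sup>2"
      by (simp only: norm_mult \<zeta> norm_of_real mult_1 power2_abs)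
    then show ?thesis
      unfolding quad_def Q_def g_def v_def sq_integral_scale \<zeta> edge_energy_def by simp
  qed
  note m = minimizer_inequality[OF min' p data, unfolded n q]
  show "Q a = n a" "0 < n a" by (fact m)+
  fix b assume "0 < n b" "0 < Q b"
  with m(3)[OF data] show "n a powr ((p - 1) / (p + 1)) * n b powr (2 / (p + 1)) \<le> Q b"
    unfolding n q by blast
qed

lemma sum_remove_two:
  fixes H :: "'b \<Rightarrow> real"
  assumes "finite A" "i \<in> A" "j \<in> A" "i \<noteq> j"
  shows "sum H A = sum H (A - {i, j}) + (H i + H j)"
proof -
  have "j \<in> A - {i}" "finite (A - {i})" using assms by auto
  then have "sum H (A - {i}) = H j + sum H (A - {i} - {j})" by (intro sum.remove)
  moreover have "A - {i} - {j} = A - {i, j}" by auto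
  ultimately show ?thesis using sum.remove[OF assms(1,2), of H] by simp
qed

lemma sum_two_upd:
  fixes F :: "real \<Rightarrow> real"
  assumes "finite A" "i \<in> A" "j \<in> A" "i \<noteq> j"
  shows "(\<Sum>k\<in>A. F ((a(i := x, j := y)) k)) = (\<Sum>k\<in>A - {i, j}. F (a k)) + (F x + F y)"
proof -
  have "(\<Sum>k\<in>A - {i, j}. F ((a(i := x, j := y)) k)) = (\<Sum>k\<in>A - {i, j}. F (a k))"
    by (intro sum.cong) auto
  moreover have "F ((a(i := x, j := y)) i) = F x" "F ((a(i := x, j := y)) j) = F y" using assms by auto
  ultimately show ?thesis
    using sum_remove_two[OF assms, of "\<lambda>k. F ((a(i := x, j := y)) k)"] by (simp only:)
qed

text \<open>If two edges carry the same profile \<open>\<phi>\<^sub>a\<close>, move one of them to \<open>a + s\<close> and the other to \<open>a - s\<close>.  By symmetry the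
  two sides of the minimality inequality agree to first order in \<open>s\<close>.  The second derivative of their difference is
  \<open>-4 b' b''\<close>, where \<open>b\<close> is the boundary value as a function of the shift: the energies and powers on the
  edges contribute \<open>-8 b' b''\<close> together, and by the vertex condition the vertex term contributes \<open>4 b' b''\<close>.  As \<open>b'\<close> is negative, \<open>b'' = \<omega> b - b\<^sup>p\<close> cannot be negative.\<close>

lemma minimizer_equal_edges:
  assumes min: "is_minimizer N p \<beta> \<omega> (\<lambda>j x. \<zeta> * of_real (phi p \<omega> (a j) x))"
    and p: "1 < p" and \<omega>: "0 < \<omega>" and \<beta>: "\<beta> < 0" and \<zeta>: "norm \<zeta> = 1"
    and vertex: "\<And>j. j \<in> {1..N} \<Longrightarrow> \<beta> * dphi p \<omega> (a j) 0 = (\<Sum>i=1..N. phi p \<omega> (a i) 0)"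
    and ij: "i \<in> {1..N}" "j \<in> {1..N}" "i \<noteq> j" "a i = a j"
  shows "phi p \<omega> (a i) 0 powr p \<le> \<omega> * phi p \<omega> (a i) 0"
proof (rule ccontr)
  assume neg: "\<not> ?thesis"
  define \<alpha> where "\<alpha> = a i"
  define e where "e = edge_energy p \<omega>"
  define n where "n = edge_power p \<omega>"
  define b where "b t = phi p \<omega> t 0" for t
  define b1 where "b1 t = dphi p \<omega> t 0" for t
  define b2 where "b2 = \<omega> * b \<alpha> - b \<alpha> powr p"
  define q0 where "q0 = (\<Sum>k\<in>{1..N} - {i, j}. e (a k))"
  define m0 where "m0 = (\<Sum>k\<in>{1..N} - {i, j}. n (a k))"
  define B0 where "B0 = (\<Sum>k\<in>{1..N} - {i, j}. b (a k))"
  define as where "as s = a(i := \<alpha> + s, j := \<alpha> - s)" for s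
  define Q where "Q s = q0 + (e (\<alpha> + s) + e (\<alpha> - s)) + (1 / \<beta>) * (B0 + (b (\<alpha> + s) + b (\<alpha> - s)))\<^sup>2" for s
  define M where "M s = m0 + (n (\<alpha> + s) + n (\<alpha> - s))" for s
  define r where "r = 2 / (p + 1)"
  define \<mu> where "\<mu> = M 0 powr ((p - 1) / (p + 1))"
  \<comment> \<open>Nonnegative by minimality, as long as \<open>Q s\<close> is positive.\<close>
  define D where "D s = Q s - \<mu> * M s powr r" for s
  have a0: "as 0 = a" using ij by (auto simp: as_def \<alpha>_def)
  have sums: "(\<Sum>k=1..N. F (as s k)) = (\<Sum>k\<in>{1..N} - {i, j}. F (a k)) + (F (\<alpha> + s) + F (\<alpha> - s))"
    for F :: "real \<Rightarrow> real" and s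
    unfolding as_def by (rule sum_two_upd[OF finite_atLeastAtMost ij(1-3)])
  have Qs: "(\<Sum>k=1..N. edge_energy p \<omega> (as s k)) + (1 / \<beta>) * (\<Sum>k=1..N. phi p \<omega> (as s k) 0)\<^sup>2 = Q s" for s
    using sums[of "edge_energy p \<omega>" s] sums[of b s] by (simp only: Q_def q0_def B0_def e_def b_def)
  have Ms: "(\<Sum>k=1..N. edge_power p \<omega> (as s k)) = M s" for s
    using sums[of "edge_power p \<omega>" s] by (simp only: M_def m0_def n_def)
  note ms = minimizer_shifts[OF min p \<omega> \<zeta>]
  have QM: "Q 0 = M 0" "0 < M 0"
    using ms(1,2) Qs[of 0] Ms[of 0] unfolding a0 by simp_all
  have Mpos: "0 < M s" for s
    unfolding M_def m0_def n_def
    by (intro add_nonneg_pos sum_nonneg add_pos_pos less_imp_le edge_power_pos[OF p \<omega>])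
  have ineq: "0 \<le> D s" if "0 < Q s" for s
  proof -
    have "M 0 powr ((p - 1) / (p + 1)) * M s powr (2 / (p + 1)) \<le> Q s"
      using ms(3)[of "as s", unfolded Qs Ms, OF Mpos that] Ms[of 0] unfolding a0 by simp
    then show ?thesis by (simp add: D_def \<mu>_def r_def)
  qed
  have rp: "0 < r" using p by (simp add: r_def)
  have mu: "\<mu> * M 0 powr r = M 0"
    unfolding \<mu>_def r_def by (rule powr_complementary_exponents[OF QM(2) p])
  have D0: "D 0 = 0" by (simp add: D_def mu QM)
  have sh1: "((\<lambda>s. F (\<alpha> + s)) has_real_derivative F' (\<alpha> + s)) (at s)"
    and sh2: "((\<lambda>s. F (\<alpha> - s)) has_real_derivative - F' (\<alpha> - s)) (at s)"
    if "\<And>t. (F has_real_derivative F' t) (at t)" for F F' :: "real \<Rightarrow> real" and s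
  proof -
    have "((\<lambda>s. \<alpha> + s) has_real_derivative 1) (at s)" by (auto intro!: derivative_eq_intros)
    from DERIV_chain2[OF that this] show "((\<lambda>s. F (\<alpha> + s)) has_real_derivative F' (\<alpha> + s)) (at s)" by simp
    have "((\<lambda>s. \<alpha> - s) has_real_derivative - 1) (at s)" by (auto intro!: derivative_eq_intros)
    from DERIV_chain2[OF that this] show "((\<lambda>s. F (\<alpha> - s)) has_real_derivative - F' (\<alpha> - s)) (at s)" by simp
  qed
  define e1 where "e1 t = - ((b1 t)\<^sup>2 + \<omega> * (b t)\<^sup>2)" for t
  define n1 where "n1 t = - (b t powr (p + 1))" for t
  have bpos: "0 < b t" for t by (simp add: b_def phi_pos[OF p \<omega>])
  have db: "(b has_real_derivative b1 t) (at t)" for t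
    using phi_0_has_derivative(1)[OF p \<omega>, of t] unfolding b_def[symmetric] b1_def[symmetric] .
  have db1: "(b1 has_real_derivative \<omega> * b t - b t powr p) (at t)" for t
    using phi_0_has_derivative(2)[OF p \<omega>, of t] unfolding b_def[symmetric] b1_def[symmetric] .
  have de: "(e has_real_derivative e1 t) (at t)" for t
    using edge_energy_has_derivative[OF p \<omega>, of t] unfolding e_def e1_def b_def b1_def .
  have dn: "(n has_real_derivative n1 t) (at t)" for t
    using edge_power_has_derivative[OF p \<omega>, of t] unfolding n_def n1_def b_def .
  have de1: "(e1 has_real_derivative - (2 * b1 t * (\<omega> * b t - b t powr p) + 2 * \<omega> * b t * b1 t)) (at t)" for t
    unfolding e1_def using db[of t] db1[of t] by (auto intro!: derivative_eq_intros)
  have dn1: "(n1 has_real_derivative - ((p + 1) * b t powr p * b1 t)) (at t)" for t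
    unfolding n1_def
    by (rule DERIV_cong[OF DERIV_minus[OF DERIV_chain2[OF has_real_derivative_powr[OF bpos] db]]]) simp
  define T where "T F s = F (\<alpha> + s) - F (\<alpha> - s)" for F :: "real \<Rightarrow> real" and s
  have T0: "T F 0 = 0" for F by (simp add: T_def)
  have dT: "(T F has_real_derivative F' (\<alpha> + s) + F' (\<alpha> - s)) (at s)"
    if "\<And>t. (F has_real_derivative F' t) (at t)" for F F' s
    unfolding T_def by (rule DERIV_cong[OF DERIV_diff[OF sh1[OF that] sh2[OF that]]]) simp
  define C where "C s = B0 + (b (\<alpha> + s) + b (\<alpha> - s))" for s
  have dC: "(C has_real_derivative T b1 s) (at s)" for s
    unfolding C_def T_def by (rule DERIV_cong[OF DERIV_add[OF DERIV_const DERIV_add[OF sh1[OF db] sh2[OF db]]]]) simp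
  have dM: "(M has_real_derivative T n1 s) (at s)" for s
    unfolding M_def T_def by (rule DERIV_cong[OF DERIV_add[OF DERIV_const DERIV_add[OF sh1[OF dn] sh2[OF dn]]]]) simp
  define P where "P s = \<mu> * (r * M s powr (r - 1))" for s
  define D' where "D' s = T e1 s + (2 / \<beta>) * (C s * T b1 s) - P s * T n1 s" for s
  have dD: "(D has_real_derivative D' s) (at s)" for s
  proof -
    have 1: "((\<lambda>s. q0 + (e (\<alpha> + s) + e (\<alpha> - s))) has_real_derivative T e1 s) (at s)"
      unfolding T_def by (rule DERIV_cong[OF DERIV_add[OF DERIV_const DERIV_add[OF sh1[OF de] sh2[OF de]]]]) simp
    have 2: "((\<lambda>s. (1 / \<beta>) * (C s)\<^sup>2) has_real_derivative (2 / \<beta>) * (C s * T b1 s)) (at s)"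
      by (rule DERIV_cong[OF DERIV_cmult[OF DERIV_power[OF dC, of 2]]]) simp
    have 3: "((\<lambda>s. \<mu> * M s powr r) has_real_derivative P s * T n1 s) (at s)"
      by (rule DERIV_cong[OF DERIV_cmult[OF DERIV_chain2[OF has_real_derivative_powr[OF Mpos] dM]]])
        (simp add: P_def)
    have "D = (\<lambda>s. q0 + (e (\<alpha> + s) + e (\<alpha> - s)) + (1 / \<beta>) * (C s)\<^sup>2 - \<mu> * M s powr r)"
      by (rule ext) (simp only: D_def Q_def C_def)
    moreover have "((\<lambda>s. q0 + (e (\<alpha> + s) + e (\<alpha> - s)) + (1 / \<beta>) * (C s)\<^sup>2 - \<mu> * M s powr r) has_real_derivative D' s) (at s)"
      unfolding D'_def by (intro DERIV_diff DERIV_add 1 2 3)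
    ultimately show ?thesis by (simp only:)
  qed
  have D'0: "D' 0 = 0" by (simp add: D'_def T0)
  have C0: "C 0 = \<beta> * b1 \<alpha>"
    using vertex[OF ij(1)] sums[of b 0] unfolding a0 by (simp add: C_def B0_def b_def b1_def \<alpha>_def)
  have P0: "P 0 = r"
  proof -
    have "\<mu> * M 0 powr (r - 1) = 1" using mu QM by (simp add: powr_diff)
    then show ?thesis by (simp add: P_def)
  qed
  have dP: "(P has_real_derivative \<mu> * (r * ((r - 1) * M 0 powr (r - 1 - 1) * T n1 0))) (at 0)"
    unfolding P_def
    by (rule DERIV_cmult[OF DERIV_cmult[OF DERIV_chain2[OF has_real_derivative_powr[OF Mpos] dM]]])
  define l where "l = - 4 * (b1 \<alpha> * b2)"
  have dD': "(D' has_real_derivative l) (at 0)"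
  proof -
    note x1 = dT[OF de1, of 0]
    note x2 = DERIV_cmult[OF DERIV_mult[OF dC[of 0] dT[OF db1, of 0]], of "2 / \<beta>"]
    note x3 = DERIV_mult[OF dP dT[OF dn1, of 0]]
    have "(D' has_real_derivative
      2 * (- (2 * b1 \<alpha> * b2 + 2 * \<omega> * b \<alpha> * b1 \<alpha>)) + (2 / \<beta>) * (C 0 * (2 * b2)) - r * (2 * (- ((p + 1) * b \<alpha> powr p * b1 \<alpha>)))) (at 0)"
      unfolding D'_def
      by (rule DERIV_cong[OF DERIV_diff[OF DERIV_add[OF x1 x2] x3]]) (simp add: T0 P0 b2_def)
    moreover have "2 * (- (2 * b1 \<alpha> * b2 + 2 * \<omega> * b \<alpha> * b1 \<alpha>)) + (2 / \<beta>) * (C 0 * (2 * b2)) - r * (2 * (- ((p + 1) * b \<alpha> powr p * b1 \<alpha>))) = l"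
    proof -
      have "(2 / \<beta>) * (C 0 * (2 * b2)) = 4 * (b1 \<alpha> * b2)" using \<beta> by (simp add: C0)
      moreover have "r * (2 * (- ((p + 1) * b \<alpha> powr p * b1 \<alpha>))) = - 4 * (b \<alpha> powr p * b1 \<alpha>)"
        using p by (simp add: r_def)
      ultimately show ?thesis by (simp add: l_def b2_def algebra_simps)
    qed
    ultimately show ?thesis by simp
  qed
  have "b2 < 0" using neg by (simp add: b2_def b_def \<alpha>_def)
  moreover have "b1 \<alpha> < 0"
  proof -
    have "0 < \<beta> * b1 \<alpha>"
      using vertex[OF ij(1)] ij(1) phi_pos[OF p \<omega>]
      by (auto simp: b1_def \<alpha>_def intro!: sum_pos)
    then show ?thesis using \<beta> by (simp add: zero_less_mult_iff)
  qed
  ultimately have "0 < b1 \<alpha> * b2" by (rule mult_neg_neg[rotated])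
  then have l: "l < 0" by (simp add: l_def)
  have "isCont (\<lambda>s. D s + \<mu> * M s powr r) 0"
    by (rule isCont_add[OF DERIV_isCont[OF dD]
          DERIV_isCont[OF DERIV_cmult[OF DERIV_chain2[OF has_real_derivative_powr[OF Mpos] dM]]]])
  then have "isCont Q 0" by (simp add: D_def)
  then have "\<forall>\<^sub>F s in at 0. 0 < Q s"
    using QM order_tendstoD(1)[of Q "Q 0" "at 0" 0] by (simp add: isCont_def)
  then obtain \<epsilon> where \<epsilon>: "0 < \<epsilon>" "\<And>s. s \<noteq> 0 \<Longrightarrow> \<bar>s\<bar> < \<epsilon> \<Longrightarrow> 0 < Q s"
    unfolding eventually_at by (auto simp: dist_real_def)
  obtain s where "0 < s" "s < \<epsilon>" "D s < D 0"
    using second_derivative_neg[OF dD D'0 dD' l \<epsilon>(1)] by blast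
  then show False using ineq[of s] \<epsilon>(2)[of s] D0 by simp
qed

section \<open>Uniqueness of the pair of parameters\<close>

text \<open>With \<open>y = 1 / t\<close> this is the logarithm of \<open>t\<^sup>p\<^sup>-\<^sup>1 - t\<^sup>p\<^sup>+\<^sup>1\<close>.  In these variables the second equation of
  the pair, \<open>y\<^sub>1 + (N - 1) y\<^sub>N = |\<beta>| \<surd>\<omega>\<close>, is linear.\<close>

definition ell :: "real \<Rightarrow> real \<Rightarrow> real"
  where "ell p y = ln (y\<^sup>2 - 1) - (p + 1) * ln y"

text \<open>The point at which \<open>ell\<close> is largest.\<close>

definition crit :: "real \<Rightarrow> real"
  where "crit p = sqrt ((p + 1) / (p - 1))"

text \<open>The derivative of \<open>ell\<close> without its factor \<open>(p - 1) (crit - y)\<close>.  What matters is that this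
  quotient is positive and decreasing.\<close>

definition slope :: "real \<Rightarrow> real \<Rightarrow> real"
  where "slope p y = (crit p / y + 1) / (y\<^sup>2 - 1)"

lemma crit_gt_1: "1 < p \<Longrightarrow> 1 < crit p"
  by (simp add: crit_def)

lemma crit_sq: "1 < p \<Longrightarrow> (crit p)\<^sup>2 = (p + 1) / (p - 1)"
  by (simp add: crit_def)

lemma one_less_sq: "1 < y \<Longrightarrow> 1 < (y::real)\<^sup>2"
  by (rule one_less_power) auto

lemma slope_pos: "1 < p \<Longrightarrow> 1 < y \<Longrightarrow> 0 < slope p y"
  using crit_gt_1[of p] one_less_sq[of y] by (simp add: slope_def add_pos_pos)

lemma slope_antimono:
  assumes "1 < p" "1 < u" "u \<le> v" shows "slope p v \<le> slope p u"
  unfolding slope_def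
proof (rule frac_le)
  show "0 \<le> crit p / u + 1" using crit_gt_1[OF assms(1)] assms by simp
  show "crit p / v + 1 \<le> crit p / u + 1"
    using crit_gt_1[OF assms(1)] assms by (simp add: frac_le)
  show "0 < u\<^sup>2 - 1" using one_less_sq[OF assms(2)] by simp
  show "u\<^sup>2 - 1 \<le> v\<^sup>2 - 1" using assms by simp
qed

lemma ell_has_derivative:
  assumes "1 < p" "1 < y"
  shows "(ell p has_real_derivative (p - 1) * (crit p - y) * slope p y) (at y)"
proof -
  have y: "0 < y\<^sup>2 - 1" using one_less_sq[OF assms(2)] by simp
  have "(ell p has_real_derivative 2 * y / (y\<^sup>2 - 1) - (p + 1) / y) (at y)"
    unfolding ell_def using y assms by (auto intro!: derivative_eq_intros simp: field_simps)
  moreover have "2 * y / (y\<^sup>2 - 1) - (p + 1) / y = (p - 1) * (crit p - y) * slope p y"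
  proof -
    have "(p - 1) * (crit p - y) * slope p y = (p - 1) * ((crit p)\<^sup>2 - y\<^sup>2) / (y * (y\<^sup>2 - 1))"
      using assms y by (simp add: slope_def field_simps power2_eq_square)
    also have "(p - 1) * ((crit p)\<^sup>2 - y\<^sup>2) = (p + 1) - (p - 1) * y\<^sup>2"
      using assms by (simp add: crit_sq right_diff_distrib)
    also have "((p + 1) - (p - 1) * y\<^sup>2) / (y * (y\<^sup>2 - 1)) = 2 * y / (y\<^sup>2 - 1) - (p + 1) / y"
      using assms y by (simp add: field_simps power2_eq_square)
    finally show ?thesis ..
  qed
  ultimately show ?thesis by simp
qed

lemma ell_strict_mono:
  assumes "1 < p" "1 < u" "u < v" "v \<le> crit p" shows "ell p u < ell p v"
proof (rule DERIV_pos_imp_increasing_open[OF assms(3)])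
  show "\<exists>D. (ell p has_real_derivative D) (at x) \<and> 0 < D" if "u < x" "x < v" for x
    using ell_has_derivative[OF assms(1), of x] slope_pos[OF assms(1), of x] that assms
    by (intro exI[of _ "(p - 1) * (crit p - x) * slope p x"]) auto
  show "continuous_on {u..v} (ell p)"
    by (intro continuous_at_imp_continuous_on ballI DERIV_isCont[OF ell_has_derivative])
      (use assms in auto)
qed

lemma ell_strict_antimono:
  assumes "1 < p" "crit p \<le> u" "u < v" shows "ell p v < ell p u"
proof (rule DERIV_neg_imp_decreasing_open[OF assms(3)])
  have u: "1 < u" using crit_gt_1[OF assms(1)] assms by simp
  show "\<exists>D. (ell p has_real_derivative D) (at x) \<and> D < 0" if "u < x" "x < v" for x
    using ell_has_derivative[OF assms(1), of x] slope_pos[OF assms(1), of x] that assms u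
    by (intro exI[of _ "(p - 1) * (crit p - x) * slope p x"]) (auto simp: mult_pos_neg mult_neg_pos)
  show "continuous_on {u..v} (ell p)"
    by (intro continuous_at_imp_continuous_on ballI DERIV_isCont[OF ell_has_derivative])
      (use assms u in auto)
qed

lemma ell_powr:
  assumes "0 < t" "t < 1"
  shows "t powr (p - 1) - t powr (p + 1) = exp (ell p (1 / t))"
proof -
  have t: "1 < 1 / t" using assms by simp
  have e: "exp ((p + 1) * ln (1 / t)) = (1 / t) powr (p + 1)" using assms by (simp add: powr_def)
  have "exp (ell p (1 / t)) = ((1 / t)\<^sup>2 - 1) / (1 / t) powr (p + 1)"
  proof -
    have q: "0 < (1 / t)\<^sup>2 - 1" using one_less_sq[OF t] by simp
    show ?thesis unfolding ell_def exp_diff e exp_ln[OF q] ..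
  qed
  also have "\<dots> = ((1 / t)\<^sup>2 - 1) * t powr (p + 1)"
    using assms by (simp add: powr_divide)
  also have "\<dots> = t powr (p + 1) / t\<^sup>2 - t powr (p + 1)" by (simp add: left_diff_distrib power_divide)
  also have "t powr (p + 1) / t\<^sup>2 = t powr (p - 1)"
    using assms powr_diff[of t "p + 1" 2] by simp
  finally show ?thesis ..
qed

text \<open>Take two points on both sides of the maximum of \<open>ell\<close> with equal values.  The ratio \<open>R\<close> of the left to the right
  distance from the maximum does not grow when the pair moves apart.  To see this, keep \<open>R\<close> fixed and
  let \<open>k x\<close> be the difference of the values of \<open>ell\<close> at the distances \<open>x\<close> to the right and \<open>R x\<close> to the
  left.  Its derivative is \<open>x\<close> times an increasing function, so after its positive zero the
  function \<open>k\<close> stays nonnegative, and the left point of the new pair is at most \<open>R\<close> times as far away as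
  the right one.\<close>

lemma level_ratio:
  assumes p: "1 < p" and y: "crit p < y" "1 < z" "z < crit p" "ell p y = ell p z"
    and y': "y < y'" "1 < z'" "z' < crit p" "ell p y' = ell p z'"
  shows "(crit p - z') \<le> (crit p - z) / (y - crit p) * (y' - crit p)"
proof -
  define A where "A = crit p"
  define R where "R = (A - z) / (y - A)"
  define d where "d = y - A"
  define d' where "d' = y' - A"
  note A1 = crit_gt_1[OF p, folded A_def]
  have d: "0 < d" "d < d'" using y y' by (auto simp: d_def d'_def A_def)
  have R: "0 < R" using y by (simp add: R_def A_def)
  have Rd: "A - R * d = z" using d by (simp add: R_def d_def)
  have "A - R * d' \<le> z'"
  proof (cases "A - R * d' \<le> 1")
    case False
    define k where "k x = ell p (A + x) - ell p (A - R * x)" for x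
    define K where "K x = R\<^sup>2 * slope p (A - R * x) - slope p (A + x)" for x
    have in1: "1 < A - R * x" "1 < A + x" if "0 \<le> x" "x \<le> d'" for x
      using False that A1 mult_left_mono[OF that(2) less_imp_le[OF R]] by auto
    have k': "(k has_real_derivative (p - 1) * x * K x) (at x)" if "0 \<le> x" "x \<le> d'" for x
    proof -
      have 1: "((\<lambda>x. ell p (A + x)) has_real_derivative (p - 1) * (A - (A + x)) * slope p (A + x) * 1) (at x)"
        by (rule DERIV_chain2[where g="\<lambda>x. A + x", OF ell_has_derivative[OF p in1(2)[OF that], folded A_def]])
          (auto intro!: derivative_eq_intros)
      have 2: "((\<lambda>x. ell p (A - R * x)) has_real_derivative
          (p - 1) * (A - (A - R * x)) * slope p (A - R * x) * (- R)) (at x)"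
        by (rule DERIV_chain2[where g="\<lambda>x. A - R * x", OF ell_has_derivative[OF p in1(1)[OF that], folded A_def]])
          (auto intro!: derivative_eq_intros)
      show ?thesis unfolding k_def
        by (rule DERIV_cong[OF DERIV_diff[OF 1 2]]) (simp add: K_def algebra_simps power2_eq_square)
    qed
    have k0: "k 0 = 0" by (simp add: k_def)
    have kd: "k d = 0" using y(4) by (simp add: k_def Rd) (simp add: d_def)
    \<comment> \<open>The factor \<open>K\<close> of the derivative vanishes somewhere before \<open>d\<close>, and it increases.\<close>
    have "\<exists>\<xi>. 0 < \<xi> \<and> \<xi> < d \<and> (k has_real_derivative 0) (at \<xi>)"
    proof (rule Rolle[OF d(1)])
      show "k 0 = k d" using k0 kd by simp
      show "continuous_on {0..d} k"
        by (intro continuous_at_imp_continuous_on ballI DERIV_isCont[OF k']) (use d in auto)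
      show "k differentiable (at x)" if "0 < x" "x < d" for x
        using k'[of x] that d by (auto simp: real_differentiable_def)
    qed
    then obtain \<xi> where \<xi>: "0 < \<xi>" "\<xi> < d" "(k has_real_derivative 0) (at \<xi>)" by blast
    have "(p - 1) * \<xi> * K \<xi> = 0"
      using DERIV_unique[OF k'[of \<xi>] \<xi>(3)] \<xi> d by simp
    then have K\<xi>: "K \<xi> = 0" using p \<xi> by simp
    have Kpos: "0 \<le> K x" if "\<xi> \<le> x" "x \<le> d'" for x
    proof -
      have "slope p (A - R * \<xi>) \<le> slope p (A - R * x)"
        by (rule slope_antimono[OF p]) (use in1[of x] that \<xi> R in auto)
      moreover have "slope p (A + x) \<le> slope p (A + \<xi>)"
        by (rule slope_antimono[OF p]) (use that \<xi> A1 in auto)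
      ultimately have "K \<xi> \<le> K x" unfolding K_def by (intro diff_mono mult_left_mono) auto
      with K\<xi> show ?thesis by simp
    qed
    have "k d \<le> k d'"
    proof (rule DERIV_nonneg_imp_nondecreasing[where f=k])
      show "d \<le> d'" using d by simp
      fix x assume "d \<le> x" "x \<le> d'"
      then show "\<exists>D. (k has_real_derivative D) (at x) \<and> 0 \<le> D"
        using k'[of x] Kpos[of x] d \<xi> p by (intro exI[of _ "(p - 1) * x * K x"]) auto
    qed
    then have "ell p (A - R * d') \<le> ell p z'"
      using kd y'(4) by (simp add: k_def d'_def)
    then show ?thesis
      using ell_strict_mono[OF p y'(2), of "A - R * d'"] R d by (force simp: A_def not_le[symmetric])
  qed (use y' in simp)
  then show ?thesis unfolding A_def[symmetric] R_def[symmetric] d'_def[symmetric] by simp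
qed

text \<open>The weighted sum \<open>y + M z\<close> is not monotone along the level pairs, but it increases from any
  pair at which it exceeds its value at the maximum: there \<open>1 - M R\<close> is positive, and \<open>R\<close> does not
  grow.  This is where a lower bound on the frequency enters.\<close>

lemma level_sum_less:
  assumes p: "1 < p" and y: "crit p < y" "1 < z" "z < crit p" "ell p y = ell p z"
    and y': "y < y'" "1 < z'" "z' < crit p" "ell p y' = ell p z'"
    and M: "0 \<le> M" and big: "(1 + M) * crit p < y + M * z"
  shows "y + M * z < y' + M * z'"
proof -
  define A where "A = crit p"
  define R where "R = (A - z) / (y - A)"
  have Rd: "A - z = R * (y - A)" using y by (simp add: R_def A_def)
  have le: "A - z' \<le> R * (y' - A)"
    using level_ratio[OF p y y'] by (simp add: A_def R_def)
  have e: "(y - A) * (1 - M * R) = (y + M * z) - (1 + M) * A"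
    using arg_cong[OF Rd, of "\<lambda>t. M * t"] by (simp add: algebra_simps)
  have "0 < (y - A) * (1 - M * R)" unfolding e using big by (simp add: A_def)
  moreover have "0 < y - A" using y by (simp add: A_def)
  ultimately have pos: "0 < 1 - M * R" by (simp add: zero_less_mult_iff)
  have "(y + M * z) - (1 + M) * A = (y - A) * (1 - M * R)" by (rule e[symmetric])
  also have "\<dots> < (y' - A) * (1 - M * R)"
    using y'(1) pos by (intro mult_strict_right_mono) auto
  also have "\<dots> = (y' - A) - M * (R * (y' - A))" by (simp add: algebra_simps)
  also have "\<dots> \<le> (y' - A) - M * (A - z')"
    using mult_left_mono[OF le M] by simp
  finally show ?thesis by (simp add: algebra_simps)
qed

lemma power_difference_inj:
  assumes p: "1 < p" and s: "0 < s" "s < 1" and t: "0 < t" "t < 1"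
    and eq: "s powr (p - 1) - s powr (p + 1) = t powr (p - 1) - t powr (p + 1)"
    and side: "s \<le> 1 / crit p \<and> t \<le> 1 / crit p \<or> 1 / crit p \<le> s \<and> 1 / crit p \<le> t"
  shows "s = t"
proof (rule ccontr)
  assume "s \<noteq> t"
  have l: "ell p (1 / s) = ell p (1 / t)" using eq s t by (simp add: ell_powr)
  have A: "1 < crit p" by (rule crit_gt_1[OF p])
  have ge: "crit p \<le> 1 / r" if "0 < r" "r \<le> 1 / crit p" for r
    using that A by (simp add: field_simps)
  have le: "1 / r \<le> crit p" if "0 < r" "1 / crit p \<le> r" for r
    using that A by (simp add: field_simps)
  have inv: "1 / v < 1 / u" if "0 < u" "u < v" for u v :: real
    using that by (simp add: frac_less2)
  consider "s < t" | "t < s" using \<open>s \<noteq> t\<close> by linarith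
  then show False
  proof cases
    case 1
    then show False
      using side ell_strict_antimono[OF p, of "1/t" "1/s"] ell_strict_mono[OF p, of "1/t" "1/s"]
        ge[of t] le[of s] inv[of s t] s t l by auto
  next
    case 2
    then show False
      using side ell_strict_antimono[OF p, of "1/s" "1/t"] ell_strict_mono[OF p, of "1/s" "1/t"]
        ge[of s] le[of t] inv[of t s] s t l by auto
  qed
qed

text \<open>Of two different solutions, one would have the smaller first component and therefore, by the
  preceding lemma, the larger sum.\<close>

lemma t_pair_eqI:
  assumes p: "1 < p" and N: "1 \<le> N" and big: "real N * crit p < \<bar>\<beta>\<bar> * sqrt \<omega>"
    and t: "0 < t1" "t1 < tN" "tN < 1"
    and eq: "t1 powr (p - 1) - t1 powr (p + 1) = tN powr (p - 1) - tN powr (p + 1)"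
    and sum: "1 / t1 + (real N - 1) / tN = \<bar>\<beta>\<bar> * sqrt \<omega>"
  shows "t_pair N p \<beta> \<omega> = (t1, tN)"
proof -
  define L where "L = \<bar>\<beta>\<bar> * sqrt \<omega>"
  define M where "M = real N - 1"
  have M: "0 \<le> M" "1 + M = real N" using N by (auto simp: M_def)
  let ?sol = "\<lambda>s r. 0 < s \<and> s < r \<and> r < 1 \<and>
    s powr (p - 1) - s powr (p + 1) = r powr (p - 1) - r powr (p + 1) \<and> 1 / s + M / r = L"
  have A: "1 < crit p" by (rule crit_gt_1[OF p])
  have sol: "crit p < 1 / s \<and> 1 < 1 / r \<and> 1 / r < crit p \<and> ell p (1 / s) = ell p (1 / r)"
    if "?sol s r" for s r
  proof -
    have "exp (ell p (1 / s)) = exp (ell p (1 / r))" using that by (simp flip: ell_powr)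
    then have l: "ell p (1 / s) = ell p (1 / r)" by simp
    have "\<not> (s \<le> 1 / crit p \<and> r \<le> 1 / crit p \<or> 1 / crit p \<le> s \<and> 1 / crit p \<le> r)"
      using power_difference_inj[OF p, of s r] that by auto
    then have "s < 1 / crit p" "1 / crit p < r" using that by auto
    then show ?thesis using that l A by (simp add: field_simps)
  qed
  have mono: "\<not> r1 < s1" if "?sol s1 s2" "?sol r1 r2" for s1 s2 r1 r2
  proof
    assume less: "r1 < s1"
    note a = sol[OF that(1)] and b = sol[OF that(2)]
    have "1 / s1 < 1 / r1" using less that by (simp add: frac_less2)
    moreover have "(1 + M) * crit p < 1 / s1 + M * (1 / s2)" using that(1) big by (simp add: M(2) L_def)
    ultimately have "1 / s1 + M * (1 / s2) < 1 / r1 + M * (1 / r2)"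
      using a b M by (intro level_sum_less[OF p]) auto
    then show False using that by simp
  qed
  have uniq: "(s, r) = (t1, tN)" if "?sol s r" for s r
  proof -
    have "?sol t1 tN" using assms by (simp add: L_def M_def)
    from mono[OF this that] mono[OF that this] have "s = t1" by simp
    moreover have "r = tN"
    proof (rule power_difference_inj[OF p])
      have "?sol t1 tN" by fact+
      from sol[OF this] sol[OF that] show "r \<le> 1 / crit p \<and> tN \<le> 1 / crit p \<or> 1 / crit p \<le> r \<and> 1 / crit p \<le> tN"
        using t that A by (simp add: field_simps)
      show "r powr (p - 1) - r powr (p + 1) = tN powr (p - 1) - tN powr (p + 1)"
        using that eq \<open>s = t1\<close> by simp
    qed (use that t in auto)
    ultimately show ?thesis by simp
  qed
  show ?thesis
    unfolding t_pair_def
  proof (rule the_equality)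
    show "case (t1, tN) of (t1, tN) \<Rightarrow> 0 < t1 \<and> t1 < tN \<and> tN < 1 \<and>
      t1 powr (p - 1) - t1 powr (p + 1) = tN powr (p - 1) - tN powr (p + 1) \<and>
      1 / t1 + (real N - 1) / tN = \<bar>\<beta>\<bar> * sqrt \<omega>" using assms by simp
    fix x assume "case x of (t1, tN) \<Rightarrow> 0 < t1 \<and> t1 < tN \<and> tN < 1 \<and>
      t1 powr (p - 1) - t1 powr (p + 1) = tN powr (p - 1) - tN powr (p + 1) \<and>
      1 / t1 + (real N - 1) / tN = \<bar>\<beta>\<bar> * sqrt \<omega>"
    then have "?sol (fst x) (snd x)" by (cases x) (simp add: L_def M_def)
    from uniq[OF this] show "x = (t1, tN)" by simp
  qed
qed

section \<open>Identification of the minimizer\<close>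

lemma frequency_bound:
  fixes N :: nat
  assumes p: "1 < p" and N: "1 \<le> N" and \<beta>: "\<beta> < 0"
    and \<omega>: "\<omega> > (p + 1) / (p - 1) * ((real N)\<^sup>2 / \<beta>\<^sup>2)"
  shows "0 < \<omega>" "real N * crit p < \<bar>\<beta>\<bar> * sqrt \<omega>"
proof -
  have "0 < (p + 1) / (p - 1) * ((real N)\<^sup>2 / \<beta>\<^sup>2)" using assms by simp
  with \<omega> show "0 < \<omega>" by linarith
  have "(real N * crit p)\<^sup>2 = (p + 1) / (p - 1) * ((real N)\<^sup>2 / \<beta>\<^sup>2) * \<beta>\<^sup>2"
    using \<beta> by (simp add: power_mult_distrib crit_sq[OF p])
  also have "\<dots> < \<omega> * \<beta>\<^sup>2" using \<omega> \<beta> by (intro mult_strict_right_mono) auto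
  also have "\<dots> = (\<bar>\<beta>\<bar> * sqrt \<omega>)\<^sup>2" using \<open>0 < \<omega>\<close> by (simp add: power_mult_distrib)
  finally show "real N * crit p < \<bar>\<beta>\<bar> * sqrt \<omega>"
    by (rule power_less_imp_less_base) (use \<open>0 < \<omega>\<close> in simp)
qed

text \<open>In the variable \<open>t\<close> the maximum lies at \<open>t\<^sup>2 = (p - 1) / (p + 1)\<close>, which is also the inflection point of
  the soliton.\<close>

lemma below_crit_iff:
  assumes p: "1 < p" and t: "0 < t"
  shows "t < 1 / crit p \<longleftrightarrow> (p + 1) * t\<^sup>2 < p - 1"
proof -
  have c: "0 < crit p" using crit_gt_1[OF p] by simp
  have "t < 1 / crit p \<longleftrightarrow> t * crit p < 1" using c by (simp add: pos_less_divide_eq)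
  also have "\<dots> \<longleftrightarrow> (t * crit p)\<^sup>2 < 1"
    using c t abs_square_less_1[of "t * crit p"] by simp
  also have "(t * crit p)\<^sup>2 = (p + 1) * t\<^sup>2 / (p - 1)" by (simp add: power_mult_distrib crit_sq[OF p])
  also have "(p + 1) * t\<^sup>2 / (p - 1) < 1 \<longleftrightarrow> (p + 1) * t\<^sup>2 < p - 1" using p by (simp add: pos_divide_less_eq)
  finally show ?thesis .
qed

theorem theorem4p4:
  fixes p \<beta> \<omega> :: real and N :: nat and u :: "nat \<Rightarrow> real \<Rightarrow> complex"
  assumes "p > 1" and "N \<ge> 2" and "\<beta> < 0"
    and "\<omega> > (p + 1) / (p - 1) * ((real N)\<^sup>2 / \<beta>\<^sup>2)"
    and "is_minimizer N p \<beta> \<omega> u"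
  shows "\<exists>\<sigma> \<theta>. bij_betw \<sigma> {1..N} {1..N} \<and>
    graph_eq N u (\<lambda>j x. exp (\<i> * complex_of_real \<theta>) * phi_1 N p \<beta> \<omega> (\<sigma> j) x)"
proof -
  note p = \<open>p > 1\<close> and \<beta> = \<open>\<beta> < 0\<close>
  have N1: "1 \<le> N" using \<open>N \<ge> 2\<close> by simp
  note \<omega> = frequency_bound(1)[OF p N1 \<beta> assms(4)] and big = frequency_bound(2)[OF p N1 \<beta> assms(4)]
  obtain z a where z: "\<forall>j\<in>{1..N}. z j = 0 \<or> norm (z j) = 1"
    and ueq: "graph_eq N u (\<lambda>j x. z j * of_real (phi p \<omega> (a j) x))"
    and zmin: "is_minimizer N p \<beta> \<omega> (\<lambda>j x. z j * of_real (phi p \<omega> (a j) x))"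
    using minimizer_profiles[OF assms(5) p \<omega>] by blast
  obtain \<zeta> where \<zeta>: "norm \<zeta> = 1" and z\<zeta>: "\<forall>j\<in>{1..N}. z j = \<zeta>"
    and vertex: "\<forall>j\<in>{1..N}. \<beta> * dphi p \<omega> (a j) 0 = (\<Sum>i=1..N. phi p \<omega> (a i) 0)"
    using minimizer_vertex[OF zmin p \<omega> \<beta>] z by blast
  have u\<zeta>: "graph_eq N u (\<lambda>j x. \<zeta> * of_real (phi p \<omega> (a j) x))"
    using ueq z\<zeta> by (simp add: graph_eq_def)
  have min: "is_minimizer N p \<beta> \<omega> (\<lambda>j x. \<zeta> * of_real (phi p \<omega> (a j) x))"
  proof (rule is_minimizer_cong[OF zmin p])
    show "graph_data N (\<lambda>j x. z j * of_real (phi p \<omega> (a j) x)) (\<lambda>j x. z j * of_real (dphi p \<omega> (a j) x))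
        (\<lambda>j. z j * of_real (phi p \<omega> (a j) 0))"
      unfolding graph_data_def by (intro ballI H1_data_scale[OF H1_data_phi[OF p \<omega>]])
    show "graph_data N (\<lambda>j x. \<zeta> * of_real (phi p \<omega> (a j) x)) (\<lambda>j x. \<zeta> * of_real (dphi p \<omega> (a j) x))
        (\<lambda>j. \<zeta> * of_real (phi p \<omega> (a j) 0))"
      unfolding graph_data_def by (intro ballI H1_data_scale[OF H1_data_phi[OF p \<omega>]])
    show "graph_eq N (\<lambda>j x. z j * of_real (phi p \<omega> (a j) x)) (\<lambda>j x. \<zeta> * of_real (phi p \<omega> (a j) x))"
      using z\<zeta> by (simp add: graph_eq_def)
  qed
  define \<kappa> where "\<kappa> = rate p \<omega>"
  have \<kappa>: "0 < \<kappa>" using p \<omega> by (simp add: \<kappa>_def rate_def)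
  \<comment> \<open>The parameters of the solitons, in the variable used for the pair \<open>(t\<^sub>1, t\<^sub>N)\<close>.\<close>
  define t where "t j = tanh (\<kappa> * a j)" for j
  define b where "b j = phi p \<omega> (a j) 0" for j
  define B where "B = (\<Sum>i=1..N. b i)"
  define L where "L = \<bar>\<beta>\<bar> * sqrt \<omega>"
  define D where "D = B / L"
  have bpos: "0 < b j" for j by (simp add: b_def phi_pos[OF p \<omega>])
  have Bpos: "0 < B" unfolding B_def by (rule sum_pos) (use N1 bpos in auto)
  have Lpos: "0 < L" unfolding L_def by (rule mult_pos_pos) (use \<beta> \<omega> in auto)
  have Dpos: "0 < D" using Bpos Lpos by (simp add: D_def)
  \<comment> \<open>The vertex condition, since the derivative of the soliton at 0 is \<open>- \<surd>\<omega> t b\<close>.\<close>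
  have tb: "t j * b j = D" if "j \<in> {1..N}" for j
  proof -
    have "\<beta> * dphi p \<omega> (a j) 0 = B" using vertex that by (simp add: B_def b_def)
    moreover have "dphi p \<omega> (a j) 0 = - (sqrt \<omega> * t j * b j)"
      by (simp add: dphi_def t_def b_def \<kappa>_def)
    ultimately have "L * (t j * b j) = B" using \<beta> by (simp add: L_def mult_ac)
    then show ?thesis using Lpos by (simp add: D_def field_simps)
  qed
  have tpos: "0 < t j" if "j \<in> {1..N}" for j
  proof -
    have "0 < t j * b j" using tb[OF that] Dpos by simp
    then show ?thesis using bpos[of j] by (simp add: zero_less_mult_iff)
  qed
  have tlt: "t j < 1" for j using tanh_real_lt_1[of "\<kappa> * a j"] by (simp add: t_def)
  have artanh_t: "a j = 2 / ((p - 1) * sqrt \<omega>) * artanh (t j)" for j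
  proof -
    have "artanh (t j) = \<kappa> * a j" unfolding t_def by (rule artanh_tanh_real)
    moreover have "2 / ((p - 1) * sqrt \<omega>) = 1 / \<kappa>" by (simp add: \<kappa>_def rate_def)
    ultimately show ?thesis using \<kappa> by simp
  qed
  have a_eq: "a i = a j" if "t i = t j" for i j
    using artanh_t[of i] artanh_t[of j] that by simp
  have sum_t: "(\<Sum>j=1..N. 1 / t j) = L"
  proof -
    have "(\<Sum>j=1..N. 1 / t j) = (\<Sum>j=1..N. b j / D)"
    proof (intro sum.cong refl)
      fix j assume j: "j \<in> {1..N}"
      show "1 / t j = b j / D" using tb[OF j] tpos[OF j] Dpos by (simp add: field_simps)
    qed
    also have "\<dots> = B / D" by (simp add: B_def sum_divide_distrib)
    also have "\<dots> = L" using Bpos Lpos by (simp add: D_def)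
    finally show ?thesis .
  qed
  define G where "G s = s powr (p - 1) - s powr (p + 1)" for s
  have Gt: "G (t j) = D powr (p - 1) / ((p + 1) * \<omega> / 2)" if j: "j \<in> {1..N}" for j
  proof -
    have e1: "b j powr (p - 1) = (p + 1) * \<omega> / 2 * (1 - (t j)\<^sup>2)"
      using phi_powr[OF p \<omega>, of "a j" 0] by (simp add: b_def t_def \<kappa>_def)
    have e2: "D powr (p - 1) = t j powr (p - 1) * b j powr (p - 1)"
      unfolding tb[OF j, symmetric] by (rule powr_mult)
    have e3: "G (t j) = t j powr (p - 1) * (1 - (t j)\<^sup>2)"
      using tpos[OF j] powr_add[of "t j" "p - 1" 2] by (simp add: G_def right_diff_distrib add.commute)
    show ?thesis unfolding e3 e2 e1 using p \<omega> by simp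
  qed
  have inj: "t i = t j" if "i \<in> {1..N}" "j \<in> {1..N}"
    "t i \<le> 1 / crit p \<and> t j \<le> 1 / crit p \<or> 1 / crit p \<le> t i \<and> 1 / crit p \<le> t j" for i j
    using power_difference_inj[OF p tpos[OF that(1)] tlt tpos[OF that(2)] tlt] Gt[OF that(1)] Gt[OF that(2)] that(3)
    by (simp add: G_def)
  \<comment> \<open>Two small parameters would be equal, and both edges would be beyond the inflection point.\<close>
  have small_unique: "i = j" if ij: "i \<in> {1..N}" "j \<in> {1..N}" "t i < 1 / crit p" "t j < 1 / crit p" for i j
  proof (rule ccontr)
    assume "i \<noteq> j"
    have "a i = a j" by (rule a_eq[OF inj]) (use ij in auto)
    from minimizer_equal_edges[OF min p \<omega> \<beta> \<zeta> _ ij(1,2) \<open>i \<noteq> j\<close> this] vertex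
    have "b i powr p \<le> \<omega> * b i" by (simp add: b_def)
    moreover have "b i powr p = (p + 1) * \<omega> / 2 * (1 - (t i)\<^sup>2) * b i"
      using phi_powr_p(1)[OF p \<omega>, of "a i" 0] phi_powr[OF p \<omega>, of "a i" 0]
      by (simp add: b_def t_def \<kappa>_def)
    ultimately have "(p + 1) * \<omega> / 2 * (1 - (t i)\<^sup>2) * b i \<le> \<omega> * b i" by (simp only:)
    then have "(p + 1) * \<omega> / 2 * (1 - (t i)\<^sup>2) \<le> \<omega>"
      by (rule mult_right_le_imp_le) (rule bpos)
    then have "\<omega> * ((p + 1) * (1 - (t i)\<^sup>2)) \<le> \<omega> * 2" by (simp add: field_simps)
    then have "(p + 1) * (1 - (t i)\<^sup>2) \<le> 2" using \<omega> by simp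
    then have "p - 1 \<le> (p + 1) * (t i)\<^sup>2" by (simp add: right_diff_distrib)
    then show False using ij(3) below_crit_iff[OF p tpos[OF ij(1)]] by simp
  qed
  \<comment> \<open>Otherwise the sum of the \<open>1 / t\<^sub>j\<close> would be too small for the given frequency.\<close>
  have "\<exists>k\<in>{1..N}. t k < 1 / crit p"
  proof (rule ccontr)
    assume no: "\<not> ?thesis"
    have "(\<Sum>j=1..N. 1 / t j) \<le> (\<Sum>j=1..N. crit p)"
    proof (rule sum_mono)
      fix j assume j: "j \<in> {1..N}"
      then have "1 / crit p \<le> t j" using no by (auto simp: not_less)
      then show "1 / t j \<le> crit p" using tpos[OF j] crit_gt_1[OF p] by (simp add: field_simps)
    qed
    then show False using sum_t big by (simp add: L_def)
  qed
  then obtain k where k: "k \<in> {1..N}" "t k < 1 / crit p" by blast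
  have "\<exists>m\<in>{1..N}. m \<noteq> k"
    using \<open>N \<ge> 2\<close> by (intro bexI[of _ "if k = 1 then 2 else 1"]) auto
  then obtain m where m: "m \<in> {1..N}" "m \<noteq> k" by blast
  have large: "1 / crit p \<le> t j" if "j \<in> {1..N}" "j \<noteq> k" for j
    using small_unique[OF that(1) k(1) _ k(2)] that(2) by (auto simp: not_less[symmetric])
  have tm: "t j = t m" if "j \<in> {1..N}" "j \<noteq> k" for j
    by (rule inj) (use that m large in auto)
  have sum_split: "1 / t k + (real N - 1) / t m = L"
  proof -
    have "(\<Sum>j=1..N. 1 / t j) = 1 / t k + (\<Sum>j\<in>{1..N} - {k}. 1 / t j)"
      using k(1) by (simp add: sum.remove)
    also have "(\<Sum>j\<in>{1..N} - {k}. 1 / t j) = (\<Sum>j\<in>{1..N} - {k}. 1 / t m)"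
      by (intro sum.cong refl) (use tm in auto)
    also have "\<dots> = (real N - 1) / t m" using k(1) N1 by (simp add: of_nat_diff)
    finally show ?thesis using sum_t by simp
  qed
  have pair: "t_pair N p \<beta> \<omega> = (t k, t m)"
  proof (rule t_pair_eqI[OF p N1 big tpos[OF k(1)] _ tlt])
    show "t k < t m" using k(2) large[OF m] by simp
    show "t k powr (p - 1) - t k powr (p + 1) = t m powr (p - 1) - t m powr (p + 1)"
      using Gt[OF k(1)] Gt[OF m(1)] by (simp add: G_def)
    show "1 / t k + (real N - 1) / t m = \<bar>\<beta>\<bar> * sqrt \<omega>" using sum_split by (simp add: L_def)
  qed
  have x1: "x_1 N p \<beta> \<omega> = a k" and xN: "x_N N p \<beta> \<omega> = a m"
    by (simp_all only: x_1_def x_N_def pair fst_conv snd_conv artanh_t[symmetric])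
  \<comment> \<open>The transposition that moves the edge with the small parameter to the first place.\<close>
  define \<sigma> where "\<sigma> = (\<lambda>j. if j = k then 1 else if j = 1 then k else j)"
  have bij: "bij_betw \<sigma> {1..N} {1..N}"
    by (rule bij_betw_byWitness[where f'=\<sigma>]) (use k(1) in \<open>auto simp: \<sigma>_def\<close>)
  have prof: "phi_1 N p \<beta> \<omega> (\<sigma> j) x = of_real (phi p \<omega> (a j) x)" if j: "j \<in> {1..N}" for j x
  proof (cases "j = k")
    case True
    then show ?thesis by (simp add: phi_1_def \<sigma>_def x1)
  next
    case False
    then have "\<sigma> j \<noteq> 1" by (auto simp: \<sigma>_def)
    then show ?thesis using a_eq[OF tm[OF j False]] by (simp add: phi_1_def xN)
  qed
  have "\<zeta> = exp (\<i> * complex_of_real (Arg \<zeta>))"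
  proof -
    have "\<zeta> \<noteq> 0" using \<zeta> by auto
    from cis_Arg[OF this] show ?thesis using \<zeta> by (simp add: sgn_eq cis_conv_exp)
  qed
  with u\<zeta> prof bij show ?thesis
    by (intro exI[of _ \<sigma>] exI[of _ "Arg \<zeta>"]) (auto simp: graph_eq_def)
qed

end
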